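(* For $j=1,2$ let $\Omega_j=\{(x,y)\in\mathbb{R}^2: x^2/a_j^2+y^2/b_j^2=1\}$, $0<b_j\le a_j$, be an ellipse with eccentricity $\mathbf{e}_j=\sqrt{1-(b_j/a_j)^2}$, and let $f_j$ be the associated billiard map. Set $$\Omega_j^*:=\Omega_j\setminus\{p_j^*,-p_j^*\},\qquad p_j^*:=\big(a_j\cos\arctan(1-\mathbf{e}_j^2),\,-b_j\sin\arctan(1-\mathbf{e}_j^2)\big).$$ Then: (i) The billiard maps $f_1$ and $f_2$ are $C^0$-conjugated near their respective boundaries, i.e. there exists $\theta_j^*>0$ ($j=1,2$) such that their restrictions $f_1|_{\Omega_1\times(0,\theta_1^* )}$ and $f_2|_{\Omega_2\times(0,\theta_2^* )}$ are $C^0$-conjugated. Moreover, the restrictions $f_1|_{\Omega_1^*\times(0,\theta_1^* )}$ and $f_2|_{\Omega_2^*\times(0,\theta_2^* )}$ are $C^\infty$-conjugated. (ii) If the billiard maps $f_1$ and $f_2$ are (globally) $C^0$-conjugated, then $\Omega_1$ and $\Omega_2$ are similar (or, equivalently, $\mathbf{e}_1=\mathbf{e}_2$).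
   Context: Here $\Omega_j$ denotes the boundary curve of the elliptic billiard table, and $-p$ is the point symmetric to $p$ with respect to the origin. Billiard map. The phase space of the billiard in $\Omega_j$ is $\Omega_j\times(0,\pi)$: the pair $(s,\theta)$ represents the unit vector based at $s\in\Omega_j$, directed inward, making angle $\theta$ with the positive tangent to $\Omega_j$ at $s$. The map $f_j$ sends $(s,\theta)$ to $(s',\theta')$, where $s'$ is the next point at which the line issued from $s$ in the given direction hits $\Omega_j$, and $\theta'$ is the angle at $s'$ of the velocity reflected so that the angle of incidence equals the angle of reflection. The map extends smoothly to $\theta=0$ and $\theta=\pi$ as the identity there. Conjugacy. Two maps $f$ and $g$ are $C^0$-conjugated (topologically conjugated) if there is a homeomorphism $h$ with $f=h^{-1}\circ g\circ h$; they are $C^\infty$-conjugated if $h$ can be taken to be a $C^\infty$-diffeomorphism. Similar. Two ellipses are similar if they are the same up to a rescaling and an isometry.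
   Formalization: In (i) the strips Ω_j×(0,θ_j* ) are not f_j-invariant unless Ω_j is a circle, so the conjugacy is stated between open invariant sets containing them, with h and its inverse preserving the end θ→0 and h a C^∞-diffeomorphism between the parts over Ω_1* and Ω_2*. *)

theory Defs
  imports "HOL-Analysis.Analysis"
begin

type_synonym plane = "real \<times> real"
type_synonym phase_point = "plane \<times> real"

section \<open>Ellipses\<close>

definition ellipse :: "real \<Rightarrow> real \<Rightarrow> plane set" where
  "ellipse a b = {(x, y). x\<^sup>2 / a\<^sup>2 + y\<^sup>2 / b\<^sup>2 = 1}"

definition eccentricity :: "real \<Rightarrow> real \<Rightarrow> real" where
  "eccentricity a b = sqrt (1 - (b / a)\<^sup>2)"

definition p_star :: "real \<Rightarrow> real \<Rightarrow> plane" where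
  "p_star a b =
    (a * cos (arctan (1 - (eccentricity a b)\<^sup>2)),
     - (b * sin (arctan (1 - (eccentricity a b)\<^sup>2))))"

definition ellipse_star :: "real \<Rightarrow> real \<Rightarrow> plane set" where
  "ellipse_star a b = ellipse a b - {p_star a b, - p_star a b}"

definition similar_sets :: "plane set \<Rightarrow> plane set \<Rightarrow> bool" where
  "similar_sets A B \<longleftrightarrow>
    (\<exists>c>0. \<exists>T. (\<forall>x y. dist (T x) (T y) = dist x y) \<and> B = (\<lambda>x. c *\<^sub>R T x) ` A)"

section \<open>The billiard map\<close>

definition phase_space :: "real \<Rightarrow> real \<Rightarrow> phase_point set" where
  "phase_space a b = ellipse a b \<times> {0<..<pi}"

text \<open>The ellipse is oriented counterclockwise: at \<open>(a cos t, b sin t)\<close> the positive tangent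
  direction is \<open>(- a sin t, b cos t)\<close>.\<close>

definition unit_tangent :: "real \<Rightarrow> real \<Rightarrow> plane \<Rightarrow> plane" where
  "unit_tangent a b s = sgn (- (a * snd s / b), b * fst s / a)"

definition inward_normal :: "real \<Rightarrow> real \<Rightarrow> plane \<Rightarrow> plane" where
  "inward_normal a b s = (- snd (unit_tangent a b s), fst (unit_tangent a b s))"

definition direction :: "real \<Rightarrow> real \<Rightarrow> phase_point \<Rightarrow> plane" where
  "direction a b z =
    cos (snd z) *\<^sub>R unit_tangent a b (fst z) + sin (snd z) *\<^sub>R inward_normal a b (fst z)"

definition reflect :: "plane \<Rightarrow> plane \<Rightarrow> plane" where
  "reflect T v = (2 * (v \<bullet> T)) *\<^sub>R T - v"

definition billiard_step :: "real \<Rightarrow> real \<Rightarrow> phase_point \<Rightarrow> phase_point \<Rightarrow> bool" where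
  "billiard_step a b z z' \<longleftrightarrow>
    z' \<in> phase_space a b \<and>
    (\<exists>t>0. fst z' = fst z + t *\<^sub>R direction a b z) \<and>
    direction a b z' = reflect (unit_tangent a b (fst z')) (direction a b z)"

definition billiard_map :: "real \<Rightarrow> real \<Rightarrow> phase_point \<Rightarrow> phase_point" where
  "billiard_map a b z = (THE z'. billiard_step a b z z')"

section \<open>Smooth maps and conjugacies\<close>

primrec Ck_on :: "nat \<Rightarrow> 'a::euclidean_space set \<Rightarrow> ('a \<Rightarrow> 'b::euclidean_space) \<Rightarrow> bool" where
  "Ck_on 0 U f \<longleftrightarrow> continuous_on U f"
| "Ck_on (Suc k) U f \<longleftrightarrow>
    (\<forall>x\<in>U. f differentiable (at x)) \<and> (\<forall>v. Ck_on k U (\<lambda>x. frechet_derivative f (at x) v))"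

text \<open>Smoothness on a subset that need not be open (here: a piece of the surface
  \<open>phase_space a b\<close> embedded in three-space) means local extendability to a smooth map on an open
  set of the ambient space.\<close>

definition smooth_on :: "'a::euclidean_space set \<Rightarrow> ('a \<Rightarrow> 'b::euclidean_space) \<Rightarrow> bool" where
  "smooth_on X f \<longleftrightarrow>
    (\<forall>x\<in>X. \<exists>U F. open U \<and> x \<in> U \<and> (\<forall>k. Ck_on k U F) \<and> (\<forall>y\<in>U \<inter> X. F y = f y))"

definition smooth_diffeomorphism ::
  "'a::euclidean_space set \<Rightarrow> 'b::euclidean_space set \<Rightarrow> ('a \<Rightarrow> 'b) \<Rightarrow> ('b \<Rightarrow> 'a) \<Rightarrow> bool" where
  "smooth_diffeomorphism X Y h k \<longleftrightarrow> homeomorphism X Y h k \<and> smooth_on X h \<and> smooth_on Y k"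

definition C0_conjugacy ::
  "'a::topological_space set \<Rightarrow> ('a \<Rightarrow> 'a) \<Rightarrow> 'b::topological_space set \<Rightarrow> ('b \<Rightarrow> 'b)
    \<Rightarrow> ('a \<Rightarrow> 'b) \<Rightarrow> ('b \<Rightarrow> 'a) \<Rightarrow> bool" where
  "C0_conjugacy X f Y g h k \<longleftrightarrow> homeomorphism X Y h k \<and> (\<forall>x\<in>X. f x = k (g (h x)))"

definition C0_conjugate ::
  "'a::topological_space set \<Rightarrow> ('a \<Rightarrow> 'a) \<Rightarrow> 'b::topological_space set \<Rightarrow> ('b \<Rightarrow> 'b) \<Rightarrow> bool" where
  "C0_conjugate X f Y g \<longleftrightarrow> (\<exists>h k. C0_conjugacy X f Y g h k)"

text \<open>A strip \<open>ellipse a b \<times> {0<..<\<theta>}\<close> is in general not invariant under the billiard map, because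
  the angle varies along the invariant curves unless \<open>a = b\<close>. In particular, for a circle and a
  non-circular ellipse no homeomorphism from one such strip onto the other can conjugate the two
  maps: one strip is invariant and the other is not. A conjugacy near the boundary is therefore a
  conjugacy between invariant open sets that contain the strips.\<close>

definition invariant_nbhd :: "real \<Rightarrow> real \<Rightarrow> real \<Rightarrow> phase_point set \<Rightarrow> bool" where
  "invariant_nbhd a b \<theta> V \<longleftrightarrow>
    openin (top_of_set (phase_space a b)) V \<and>
    ellipse a b \<times> {0<..<\<theta>} \<subseteq> V \<and>
    billiard_map a b ` V = V"

text \<open>\<open>h\<close> sends points of \<open>V\<close> close to the boundary component \<open>\<theta> = 0\<close> to points close to
  \<open>\<theta> = 0\<close>, uniformly in the base point.\<close>

definition respects_boundary :: "phase_point set \<Rightarrow> (phase_point \<Rightarrow> phase_point) \<Rightarrow> bool" where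
  "respects_boundary V h \<longleftrightarrow> (\<forall>\<epsilon>>0. \<exists>\<delta>>0. \<forall>z\<in>V. snd z < \<delta> \<longrightarrow> snd (h z) < \<epsilon>)"

section \<open>The description defining the billiard map is proper\<close>

lemma unit_tangent_cases:
  assumes "0 < a" "0 < b" "(x, y) \<in> ellipse a b"
  obtains n where "n > 0" "unit_tangent a b (x,y) = (- (a*y/b)/n, (b*x/a)/n)"
    "n\<^sup>2 = (a*y/b)\<^sup>2 + (b*x/a)\<^sup>2"
proof -
  define n where "n = sqrt ((a*y/b)\<^sup>2 + (b*x/a)\<^sup>2)"
  have "x \<noteq> 0 \<or> y \<noteq> 0" using assms by (auto simp: ellipse_def)
  then have "(a*y/b)\<^sup>2 + (b*x/a)\<^sup>2 > 0"
    using assms by (auto simp: sum_power2_gt_zero_iff)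
  then have "n > 0" "n\<^sup>2 = (a*y/b)\<^sup>2 + (b*x/a)\<^sup>2" by (auto simp: n_def)
  moreover have "unit_tangent a b (x,y) = (- (a*y/b)/n, (b*x/a)/n)"
    by (simp add: unit_tangent_def sgn_div_norm norm_Pair n_def divide_inverse mult.commute)
  ultimately show ?thesis using that by blast
qed

lemma billiard_step_ex1:
  assumes ab: "0 < a" "0 < b" and z: "z \<in> phase_space a b"
  shows "\<exists>!z'. billiard_step a b z z'"
proof -
  obtain x y \<theta> where zz: "z = ((x,y),\<theta>)" by (metis surj_pair)
  have E: "(x,y) \<in> ellipse a b" and th: "0 < \<theta>" "\<theta> < pi" using z by (auto simp: phase_space_def zz)
  obtain n where n: "n > 0" "unit_tangent a b (x,y) = (- (a*y/b)/n, (b*x/a)/n)"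
    "n\<^sup>2 = (a*y/b)\<^sup>2 + (b*x/a)\<^sup>2" using unit_tangent_cases[OF ab E] .
  obtain p q where v: "direction a b z = (p,q)" by (metis surj_pair)
  have pv: "p = cos \<theta> * (- (a*y/b)/n) + sin \<theta> * (- (b*x/a)/n)"
    and qv: "q = cos \<theta> * ((b*x/a)/n) + sin \<theta> * (- (a*y/b)/n)"
    using v by (auto simp: direction_def zz inward_normal_def n(2))
  have sn: "sin \<theta> > 0" using th by (simp add: sin_gt_zero)
  have dot: "p * (x/a\<^sup>2) + q*(y/b\<^sup>2) = - sin \<theta> * n / (a*b)"
  proof -
    have "p * (x/a\<^sup>2) + q*(y/b\<^sup>2) = - sin \<theta> / (a*b*n) * n\<^sup>2"
      unfolding n(3) pv qv using ab n(1) by (simp add: field_simps power2_eq_square)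
    then show ?thesis using n(1) by (simp add: power2_eq_square)
  qed
  have unit: "p\<^sup>2+q\<^sup>2 = 1"
  proof -
    define P Q where "P = a*y/b/n" "Q = b*x/a/n"
    have "P\<^sup>2 + Q\<^sup>2 = 1" using n(1) unfolding P_Q_def power_divide[of _ n]
      add_divide_distrib[symmetric] n(3)[symmetric] by simp
    moreover have "p = - cos \<theta> * P - sin \<theta> * Q" "q = cos \<theta> * Q - sin \<theta> * P"
      by (auto simp: pv qv P_Q_def)
    ultimately show ?thesis using sin_cos_squared_add[of \<theta>] by algebra
  qed
  define A where "A = p\<^sup>2/a\<^sup>2 + q\<^sup>2/b\<^sup>2"
  define B where "B = p * (x/a\<^sup>2) + q*(y/b\<^sup>2)"
  have A: "A > 0" 
  proof -
    have "p \<noteq> 0 \<or> q \<noteq> 0" using unit by auto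
    then show ?thesis unfolding A_def using ab by (auto intro: add_pos_nonneg add_nonneg_pos)
  qed
  have B: "B < 0" unfolding B_def dot using sn n(1) ab by (simp add: field_simps)
  have on: "(x + t*p, y+t*q) \<in> ellipse a b \<longleftrightarrow> t * (t * A + 2 * B) = 0" for t
  proof -
    have "(x + t*p)\<^sup>2/a\<^sup>2 + (y+t*q)\<^sup>2/b\<^sup>2 = (x\<^sup>2/a\<^sup>2+y\<^sup>2/b\<^sup>2) + t * (t * A + 2 * B)"
      unfolding A_def B_def by (simp add: power2_eq_square algebra_simps add_divide_distrib)
    then show ?thesis using E by (auto simp: ellipse_def)
  qed
  define t where "t = - 2 * B / A"
  have t: "t > 0" using A B by (simp add: t_def field_simps)
  have ton: "(x + t*p, y+t*q) \<in> ellipse a b" unfolding on t_def using A by (simp add: field_simps)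
  have tun: "t' = t" if "t' > 0" "(x + t'*p, y+t'*q) \<in> ellipse a b" for t'
  proof -
    have "t' * A + 2 * B = 0" using that unfolding on by auto
    then show ?thesis using A unfolding t_def by (simp add: field_simps)
  qed
  define x' y' where "x' = x + t*p" "y' = y+t*q"
  have E': "(x',y') \<in> ellipse a b" using ton by (simp add: x'_y'_def)
  obtain m where m: "m > 0" "unit_tangent a b (x',y') = (- (a*y'/b)/m, (b*x'/a)/m)"
    "m\<^sup>2 = (a*y'/b)\<^sup>2 + (b*x'/a)\<^sup>2" using unit_tangent_cases[OF ab E'] .
  define T1 T2 where "T1 = - (a*y'/b)/m" "T2 = (b*x'/a)/m"
  have T: "unit_tangent a b (x',y') = (T1,T2)" using m(2) by (simp add: T1_T2_def)
  have Tu: "T1\<^sup>2 + T2\<^sup>2 = 1" using m(1) unfolding T1_T2_def power_divide[of _ m] power2_minus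
    add_divide_distrib[symmetric] m(3)[symmetric] by simp
  have B': "p * (x'/a\<^sup>2) + q*(y'/b\<^sup>2) = - B"
  proof -
    have "p * (x'/a\<^sup>2) + q*(y'/b\<^sup>2) = B + t * A" unfolding x'_y'_def A_def B_def
      by (simp add: power2_eq_square algebra_simps add_divide_distrib)
    then show ?thesis using A by (simp add: t_def)
  qed
  define c where "c = p*T1+q*T2"
  define d where "d = p*T2 - q*T1"
  have d: "d > 0"
  proof -
    have "d = a*b/m * (p * (x'/a\<^sup>2) + q*(y'/b\<^sup>2))"
      unfolding d_def T1_T2_def using ab m(1) by (simp add: field_simps power2_eq_square)
    moreover have "a*b/m * (-B) > 0" using B ab m(1) by (intro mult_pos_pos divide_pos_pos) auto
    ultimately show ?thesis using B' by simp
  qed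
  have cd: "c\<^sup>2 + d\<^sup>2 = 1"
  proof -
    have "c\<^sup>2 + d\<^sup>2 = (p\<^sup>2+q\<^sup>2)*(T1\<^sup>2+T2\<^sup>2)" unfolding c_def d_def by algebra
    then show ?thesis using unit Tu by simp
  qed
  have pp: "p = c*T1 + d*T2" "q = c*T2 - d*T1"
    using Tu unfolding c_def d_def by algebra+
  have R: "direction a b ((x',y'),\<phi>) = reflect (unit_tangent a b (x',y')) (p,q)
      \<longleftrightarrow> cos \<phi> = c \<and> sin \<phi> = d" for \<phi>
  proof -
    have "direction a b ((x',y'),\<phi>) = (cos \<phi> * T1 - sin \<phi> * T2, cos \<phi> * T2 + sin \<phi> * T1)"
      by (simp add: direction_def inward_normal_def T)
    moreover have "reflect (unit_tangent a b (x',y')) (p,q) = (c*T1 - d*T2, c*T2+d*T1)"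
      by (simp add: reflect_def T c_def[symmetric] ) (simp add: pp)
    moreover have "(C*T1 - D*T2, C*T2+D*T1) = (c*T1 - d*T2, c*T2+d*T1) \<longleftrightarrow> C = c \<and> D = d" for C D
    proof
      assume "(C*T1 - D*T2, C*T2+D*T1) = (c*T1 - d*T2, c*T2+d*T1)"
      then have e: "C*T1 - D*T2 = c*T1 - d*T2" "C*T2+D*T1 = c*T2+d*T1" by auto
      then show "C = c \<and> D = d" using Tu by algebra
    qed auto
    ultimately show ?thesis by simp
  qed
  have dir: "direction a b z = (p,q)" by (fact v)
  obtain \<phi> where ph: "0 < \<phi>" "\<phi> < pi" "cos \<phi> = c" "sin \<phi> = d"
  proof -
    have c1: "c\<^sup>2 < 1" using cd d zero_less_power[of d 2] by linarith
    then have c2: "-1 < c" "c < 1" by (auto simp: abs_square_less_1 abs_less_iff)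
    have "sin (arccos c) = d" using c2 cd d by (simp add: sin_arccos real_sqrt_unique)
    with c2 show ?thesis using that[of "arccos c"] arccos_lt_bounded[of c] by auto
  qed
  show ?thesis
  proof (rule ex1I[of _ "((x',y'),\<phi>)"])
    show "billiard_step a b z ((x',y'),\<phi>)"
      unfolding billiard_step_def v using t E' ph R
      by (auto simp: phase_space_def zz x'_y'_def intro!: exI[of _ t])
  next
    fix w assume w: "billiard_step a b z w"
    obtain u \<psi> where ww: "w = (u,\<psi>)" by (metis surj_pair)
    from w obtain t' where t': "t' > 0" "u = (x + t'*p, y+t'*q)" 
      unfolding billiard_step_def v by (auto simp: ww zz)
    have "u \<in> ellipse a b" using w by (auto simp: billiard_step_def phase_space_def ww)
    then have u: "u = (x',y')" using tun t' by (auto simp: x'_y'_def)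
    have "cos \<psi> = c" "0 < \<psi>" "\<psi> < pi" using w R[of \<psi>]
      by (auto simp: billiard_step_def v ww u phase_space_def)
    then have "\<psi> = \<phi>" using ph by (metis arccos_cos less_imp_le)
    then show "w = ((x',y'),\<phi>)" by (simp add: ww u)
  qed
qed

corollary billiard_step_billiard_map:
  assumes "0 < a" "0 < b" "z \<in> phase_space a b"
  shows "billiard_step a b z (billiard_map a b z)"
  unfolding billiard_map_def by (rule theI'[OF billiard_step_ex1[OF assms]])

end

theory Submission
  imports Defs
begin

text \<open>The chord of parameters \<open>s - d\<close>, \<open>s + d\<close> is tangent to the confocal conic
  \<open>x\<^sup>2 / (a\<^sup>2 - \<lambda>) + y\<^sup>2 / (b\<^sup>2 - \<lambda>) = 1\<close> with \<open>\<lambda> = a\<^sup>2 b\<^sup>2 (sin d)\<^sup>2 / speed(s)\<^sup>2\<close>, and \<open>\<lambda>\<close> is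
  conserved. On each level set of \<open>\<lambda>\<close> the billiard map preserves a measure
  \<open>dx / sqrt (p + q (sin x)\<^sup>2)\<close>, so it is a rotation in the coordinate given by an incomplete
  elliptic integral.

  For \<open>\<lambda> < b\<^sup>2\<close> (trajectories around the foci) the rotation number depends smoothly and strictly
  increasingly on \<open>\<lambda>\<close> and tends to 0 at the boundary. Matching rotation numbers and angle
  coordinates of the two billiards conjugates them near the boundary; measuring the angle from
  \<open>p_star\<close> makes the conjugacy preserve the fibres over \<open>p_star\<close> and \<open>- p_star\<close>.

  For \<open>\<lambda> > b\<^sup>2\<close> (trajectories between the foci) the levels form two islands exchanged by the map.
  The rotation number of the second iterate on a level decreases strictly from
  \<open>2 arcsin (sqrt (a\<^sup>2 - b\<^sup>2) / a) / pi\<close> at the centre of the island to 0 at the separatrix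
  \<open>\<lambda> = b\<^sup>2\<close>, whose only periodic points lie on the major axis. A curve of periodic points is
  mapped to itself outside the islands and to a different curve inside them. The number of curves of
  \<open>2 q\<close>-periodic points that are not mapped to themselves is therefore a conjugacy invariant, and as
  \<open>q\<close> grows it determines the rotation number at the centre, hence the eccentricity.\<close>

section \<open>Calculus of smooth maps\<close>

text \<open>Both kinds of chord rest on one identity: \<open>elliptic_shift\<close> is used with
  \<open>q = a^2 - b^2\<close> around the foci and with \<open>q = - r^2\<close> between them. Near
  the boundary the normal form \<open>(x, r) -> (x + r, r)\<close> keeps no trace of the ellipse, so
  any two charts with the same range of \<open>r\<close> can be glued. The result is smooth across
  the two exceptional fibres as well; these only have to correspond to each other. For the global
  claim the obstacle is that a homeomorphism need not respect the caustic parameter or any rotation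
  number. It does respect periods, connectedness of sets of periodic points, and whether a component
  is moved off itself. Counting such components replaces rotation numbers: a rational
  \<open>p / q\<close> strictly between the central values of two ellipses gives \<open>2 p\<close>
  of them on one side and fewer on the other. Points with \<open>f (f z) = z\<close> are discarded,
  since the centres of the islands and the chord on the major axis give periodic points that lie on
  no such curve.\<close>

lemma Ck_on_imp_continuous_on: "Ck_on k U f \<Longrightarrow> continuous_on U f"
  by (cases k) (auto intro!: differentiable_imp_continuous_within continuous_at_imp_continuous_on)

lemma Ck_on_SucD: "Ck_on (Suc k) U f \<Longrightarrow> Ck_on k U f"
proof (induction k arbitrary: f)
  case 0
  then show ?case using Ck_on_imp_continuous_on[of "Suc 0" U f] by simp
next
  case (Suc k)
  then show ?case by (metis Ck_on.simps(2))
qed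

lemma Ck_on_subset: "Ck_on k U f \<Longrightarrow> S \<subseteq> U \<Longrightarrow> Ck_on k S f"
proof (induction k arbitrary: f)
  case 0
  then show ?case by (simp add: continuous_on_subset)
next
  case (Suc k)
  then show ?case by (simp add: subset_iff)
qed

text \<open>Openness is what makes the values on \<open>U\<close> determine the derivatives on
  \<open>U\<close>.\<close>

lemma Ck_on_cong:
  assumes "open U" "\<And>x. x \<in> U \<Longrightarrow> f x = g x" "Ck_on k U f"
  shows "Ck_on k U g"
  using assms(2,3)
proof (induction k arbitrary: f g)
  case 0
  then show ?case by (metis Ck_on.simps(1) continuous_on_cong)
next
  case (Suc k)
  have g: "(g has_derivative frechet_derivative f (at x)) (at x)" if "x \<in> U" for x
  proof -
    have "f differentiable (at x)" using Suc.prems that by simp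
    then have "(f has_derivative frechet_derivative f (at x)) (at x)"
      by (simp add: frechet_derivative_works)
    then show ?thesis using Suc.prems(1)
      by (rule has_derivative_transform_within_open[OF _ assms(1) that])
  qed
  have "Ck_on k U (\<lambda>x. frechet_derivative g (at x) v)" for v
  proof (rule Suc.IH)
    show "Ck_on k U (\<lambda>x. frechet_derivative f (at x) v)" using Suc.prems by simp
    show "frechet_derivative f (at x) v = frechet_derivative g (at x) v" if "x \<in> U" for x
      using frechet_derivative_at[OF g[OF that]] by simp
  qed
  then show ?case using g by (auto simp: differentiable_def)
qed

text \<open>The definition speaks of \<open>frechet_derivative\<close>; uniqueness of derivatives on
  an open set permits an explicit formula \<open>D\<close> instead.\<close>

lemma Ck_on_SucI:
  assumes "open U" "\<And>x. x \<in> U \<Longrightarrow> (f has_derivative D x) (at x)"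
    and "\<And>v. Ck_on k U (\<lambda>x. D x v)"
  shows "Ck_on (Suc k) U f"
proof -
  have "Ck_on k U (\<lambda>x. frechet_derivative f (at x) v)" for v
    by (rule Ck_on_cong[OF assms(1) _ assms(3)]) (use frechet_derivative_at[OF assms(2)] in simp)
  then show ?thesis using assms(2) by (auto simp: differentiable_def)
qed

lemma Ck_on_has_derivative:
  "Ck_on (Suc k) U f \<Longrightarrow> x \<in> U \<Longrightarrow> (f has_derivative frechet_derivative f (at x)) (at x)"
  by (simp add: frechet_derivative_works)

lemma Ck_on_const: "open U \<Longrightarrow> Ck_on k U (\<lambda>x. c)"
proof (induction k arbitrary: c)
  case (Suc k)
  then show ?case by (intro Ck_on_SucI[where D="\<lambda>x v. 0"]) auto
qed simp

lemma Ck_on_id: "open U \<Longrightarrow> Ck_on k U (\<lambda>x. x)"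
proof (cases k)
  case (Suc j)
  assume "open U"
  then show ?thesis
    unfolding Suc by (intro Ck_on_SucI[where D="\<lambda>x v. v"]) (auto intro: Ck_on_const)
qed (simp add: continuous_on_id)

lemma Ck_on_bounded_linear:
  assumes "open U" "bounded_linear L" "Ck_on k U f"
  shows "Ck_on k U (\<lambda>x. L (f x))"
  using assms(3)
proof (induction k arbitrary: f)
  case 0
  then show ?case using assms(2) by (simp add: bounded_linear.continuous_on)
next
  case (Suc k)
  show ?case
  proof (rule Ck_on_SucI[OF assms(1)])
    show "((\<lambda>x. L (f x)) has_derivative (\<lambda>v. L (frechet_derivative f (at x) v))) (at x)"
      if "x \<in> U" for x
      using bounded_linear.has_derivative[OF assms(2) Ck_on_has_derivative[OF Suc.prems that]] .
    show "Ck_on k U (\<lambda>x. L (frechet_derivative f (at x) v))" for v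
      using Suc by simp
  qed
qed

lemma Ck_on_add:
  assumes "open U" "Ck_on k U f" "Ck_on k U g"
  shows "Ck_on k U (\<lambda>x. f x + g x)"
  using assms(2,3)
proof (induction k arbitrary: f g)
  case 0
  then show ?case by (simp add: continuous_on_add)
next
  case (Suc k)
  show ?case
  proof (rule Ck_on_SucI[OF assms(1)])
    show "((\<lambda>x. f x + g x) has_derivative
        (\<lambda>v. frechet_derivative f (at x) v + frechet_derivative g (at x) v)) (at x)" if "x \<in> U" for x
      by (rule has_derivative_add[OF Ck_on_has_derivative[OF Suc.prems(1) that]
            Ck_on_has_derivative[OF Suc.prems(2) that]])
  qed (use Suc in simp)
qed

lemma Ck_on_sum:
  assumes "open U" "\<And>i. i \<in> I \<Longrightarrow> Ck_on k U (f i)"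
  shows "Ck_on k U (\<lambda>x. \<Sum>i\<in>I. f i x)"
  using assms(2)
  by (induction I rule: infinite_finite_induct) (auto intro: Ck_on_const Ck_on_add assms(1))

lemma Ck_on_bilinear:
  assumes "open U" "bounded_bilinear M" "Ck_on k U f" "Ck_on k U g"
  shows "Ck_on k U (\<lambda>x. M (f x) (g x))"
  using assms(3,4)
proof (induction k arbitrary: f g)
  case 0
  then show ?case using assms(2) by (simp add: bounded_bilinear.continuous_on)
next
  case (Suc k)
  show ?case
  proof (rule Ck_on_SucI[OF assms(1)])
    show "((\<lambda>x. M (f x) (g x)) has_derivative
        (\<lambda>v. M (f x) (frechet_derivative g (at x) v) + M (frechet_derivative f (at x) v) (g x))) (at x)"
      if "x \<in> U" for x
      by (rule bounded_bilinear.FDERIV[OF assms(2) Ck_on_has_derivative[OF Suc.prems(1) that]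
            Ck_on_has_derivative[OF Suc.prems(2) that]])
    show "Ck_on k U (\<lambda>x. M (f x) (frechet_derivative g (at x) v)
        + M (frechet_derivative f (at x) v) (g x))" for v
      using Suc.prems
      by (intro Ck_on_add[OF assms(1)] Suc.IH) (auto dest: Ck_on_SucD simp del: Ck_on.simps, auto)
  qed
qed

lemma Ck_on_compose:
  assumes "open U" "open V" "f ` U \<subseteq> V" "Ck_on k V g" "Ck_on k U f"
  shows "Ck_on k U (\<lambda>x. g (f x))"
  using assms(4,5)
proof (induction k arbitrary: g)
  case 0
  then show ?case using assms(3) by (auto intro: continuous_on_compose2)
next
  case (Suc k)
  have fU: "f x \<in> V" if "x \<in> U" for x using assms(3) that by auto
  show ?case
  proof (rule Ck_on_SucI[OF assms(1)])
    fix x assume x: "x \<in> U"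
    let ?g = "frechet_derivative g (at (f x))"
    have g: "(g has_derivative ?g) (at (f x))"
      by (rule Ck_on_has_derivative[OF Suc.prems(1) fU[OF x]])
    then have L: "linear ?g" by (rule has_derivative_linear)
    \<comment> \<open>Smoothness of \<open>g\<close> controls its derivative in a fixed direction
      only, whereas here the direction moves with \<open>x\<close>. Expansion in the basis separates
      the two dependencies.\<close>
    have "?g w = (\<Sum>b\<in>Basis. (w \<bullet> b) *\<^sub>R ?g b)" for w
    proof -
      have "?g w = ?g (\<Sum>b\<in>Basis. (w \<bullet> b) *\<^sub>R b)" by (simp add: euclidean_representation)
      also have "\<dots> = (\<Sum>b\<in>Basis. (w \<bullet> b) *\<^sub>R ?g b)"
        by (simp add: linear_sum[OF L] linear_cmul[OF L])
      finally show ?thesis .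
    qed
    then have "(\<lambda>v. ?g (frechet_derivative f (at x) v)) =
        (\<lambda>v. \<Sum>b\<in>Basis. (frechet_derivative f (at x) v \<bullet> b) *\<^sub>R ?g b)" by (rule ext)
    moreover have "((\<lambda>x. g (f x)) has_derivative (\<lambda>v. ?g (frechet_derivative f (at x) v))) (at x)"
      by (rule has_derivative_compose[OF Ck_on_has_derivative[OF Suc.prems(2) x] g])
    ultimately show "((\<lambda>x. g (f x)) has_derivative (\<lambda>v. \<Sum>b\<in>Basis.
        (frechet_derivative f (at x) v \<bullet> b) *\<^sub>R ?g b)) (at x)"
      by (rule has_derivative_eq_rhs[rotated])
  next
    show "Ck_on k U (\<lambda>x. \<Sum>b\<in>Basis. (frechet_derivative f (at x) v \<bullet> b) *\<^sub>R
        frechet_derivative g (at (f x)) b)" for v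
    proof (intro Ck_on_sum Ck_on_bilinear[OF _ bounded_bilinear_scaleR] assms(1))
      fix b :: 'b
      show "Ck_on k U (\<lambda>x. frechet_derivative f (at x) v \<bullet> b)"
        using Suc.prems by (intro Ck_on_bounded_linear[OF assms(1) bounded_linear_inner_left]) simp
      show "Ck_on k U (\<lambda>x. frechet_derivative g (at (f x)) b)"
        using Suc.prems by (intro Suc.IH[where g="\<lambda>y. frechet_derivative g (at y) b"])
          (auto dest: Ck_on_SucD simp del: Ck_on.simps, auto)
    qed
  qed
qed

definition smooth :: "'a::euclidean_space set \<Rightarrow> ('a \<Rightarrow> 'b::euclidean_space) \<Rightarrow> bool" where
  "smooth U f \<longleftrightarrow> open U \<and> (\<forall>k. Ck_on k U f)"

lemma smooth_open: "smooth U f \<Longrightarrow> open U" by (simp add: smooth_def)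

lemma smooth_subset: "smooth U f \<Longrightarrow> open S \<Longrightarrow> S \<subseteq> U \<Longrightarrow> smooth S f"
  using Ck_on_subset unfolding smooth_def by blast

lemma smooth_continuous_on: "smooth U f \<Longrightarrow> continuous_on U f"
  using Ck_on_imp_continuous_on unfolding smooth_def by blast

lemma smooth_const: "open U \<Longrightarrow> smooth U (\<lambda>x. c)"
  by (simp add: smooth_def Ck_on_const)

lemma smooth_id: "open U \<Longrightarrow> smooth U (\<lambda>x. x)"
  by (simp add: smooth_def Ck_on_id)

lemma smooth_bounded_linear: "bounded_linear L \<Longrightarrow> smooth U f \<Longrightarrow> smooth U (\<lambda>x. L (f x))"
  by (simp add: smooth_def Ck_on_bounded_linear)

lemmas smooth_fst = smooth_bounded_linear[OF bounded_linear_fst]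
  and smooth_snd = smooth_bounded_linear[OF bounded_linear_snd]
  and smooth_minus = smooth_bounded_linear[OF bounded_linear_minus[OF bounded_linear_ident]]

lemma smooth_add: "smooth U f \<Longrightarrow> smooth U g \<Longrightarrow> smooth U (\<lambda>x. f x + g x)"
  by (simp add: smooth_def Ck_on_add)

lemma smooth_diff: "smooth U f \<Longrightarrow> smooth U g \<Longrightarrow> smooth U (\<lambda>x. f x - g x)"
  using smooth_add[of U f "\<lambda>x. - g x"] smooth_minus[of U g] by simp

lemma smooth_mult:
  fixes f g :: "'a::euclidean_space \<Rightarrow> real"
  shows "smooth U f \<Longrightarrow> smooth U g \<Longrightarrow> smooth U (\<lambda>x. f x * g x)"
  by (simp add: smooth_def Ck_on_bilinear[OF _ bounded_bilinear_mult])

lemma smooth_power: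
  fixes f :: "'a::euclidean_space \<Rightarrow> real"
  shows "smooth U f \<Longrightarrow> smooth U (\<lambda>x. f x ^ n)"
  by (induction n) (auto intro: smooth_const smooth_mult dest: smooth_open)

lemma smooth_Pair:
  assumes "smooth U f" "smooth U g"
  shows "smooth U (\<lambda>x. (f x, g x))"
proof -
  have "bounded_linear (\<lambda>y. (y, 0))" "bounded_linear (\<lambda>y. (0, y))"
    by (intro bounded_linear_Pair bounded_linear_ident bounded_linear_zero)+
  then have "smooth U (\<lambda>x. (f x, 0) + (0, g x))"
    by (intro smooth_add smooth_bounded_linear[where L="\<lambda>y. (y, 0)"]
        smooth_bounded_linear[where L="\<lambda>y. (0, y)"] assms)
  then show ?thesis by simp
qed

lemma smooth_compose:
  assumes "smooth V g" "smooth U f" "\<And>x. x \<in> U \<Longrightarrow> f x \<in> V"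
  shows "smooth U (\<lambda>x. g (f x))"
  using assms Ck_on_compose[of U V f] by (auto simp: smooth_def image_subset_iff)

lemma smooth_has_derivative:
  "smooth U f \<Longrightarrow> x \<in> U \<Longrightarrow> (f has_derivative frechet_derivative f (at x)) (at x)"
  using Ck_on_has_derivative unfolding smooth_def by blast

lemma smooth_frechet_derivative: "smooth U f \<Longrightarrow> smooth U (\<lambda>x. frechet_derivative f (at x) v)"
  unfolding smooth_def by (metis Ck_on.simps(2))

text \<open>Bootstrapping: a map solving a differential equation with smooth right-hand side is smooth.\<close>

lemma smooth_ode:
  assumes "open U" "\<And>y. y \<in> U \<Longrightarrow> (g has_derivative D (g y)) (at y)"
    and "\<And>v. smooth V (\<lambda>p. D p v)" and "\<And>y. y \<in> U \<Longrightarrow> g y \<in> V"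
  shows "smooth U g"
proof -
  have "Ck_on k U g" for k
  proof (induction k)
    case 0
    have "continuous_on U g"
      by (rule has_derivative_continuous_on[OF has_derivative_at_withinI[OF assms(2)]])
    then show ?case by simp
  next
    case (Suc k)
    show ?case
      using assms by (intro Ck_on_SucI[OF assms(1,2)] Ck_on_compose[OF assms(1) _ _ _ Suc, of V])
        (auto simp: smooth_def)
  qed
  then show ?thesis using assms(1) by (simp add: smooth_def)
qed

text \<open>With \<open>D x\<close> inverse to \<open>f' x\<close>, the derivative of
  \<open>g\<close> at \<open>y\<close> is \<open>D (g y)\<close>: a differential equation to which
  \<open>smooth_ode\<close> applies.\<close>

lemma smooth_inverse_function:
  fixes f :: "'a::euclidean_space \<Rightarrow> 'a"
  assumes "open S" "open T" "\<And>y. y \<in> T \<Longrightarrow> g y \<in> S \<and> f (g y) = y" "\<And>x. x \<in> S \<Longrightarrow> g (f x) = x"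
    and f: "\<And>x. x \<in> S \<Longrightarrow> (f has_derivative f' x) (at x)"
    and D: "\<And>x v. x \<in> S \<Longrightarrow> f' x (D x v) = v" "\<And>v. smooth S (\<lambda>x. D x v)"
  shows "smooth T g"
proof (rule smooth_ode[where V=S and D=D])
  fix y assume y: "y \<in> T"
  then have gy: "g y \<in> S" "f (g y) = y" using assms(3) by auto
  have c: "continuous_on S f"
    by (rule has_derivative_continuous_on[OF has_derivative_at_withinI[OF f]])
  have i: "f' (g y) \<circ> D (g y) = id" using D(1)[OF gy(1)] by auto
  show "(g has_derivative D (g y)) (at y)"
    by (rule has_derivative_inverse_strong_x[where S=S and f=f and f'="f' (g y)" and g=g and y=y
        and g'="D (g y)", OF assms(1) gy(1) c assms(4) f[OF gy(1)] i gy(2)])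
qed (use assms(2,3) D(2) in blast)+

section \<open>Smoothness of elementary functions\<close>

lemma smooth_inverse: "smooth (- {0}) (inverse :: real \<Rightarrow> real)"
proof (rule smooth_ode[where V=UNIV and D="\<lambda>p v. - (p * v * p)"])
  show "(inverse has_derivative (\<lambda>v. - (inverse y * v * inverse y))) (at y)"
    if "y \<in> - {0}" for y :: real
    using that has_derivative_inverse'[of y UNIV] by simp
  show "smooth UNIV (\<lambda>p. - (p * v * p))" for v :: real
    by (intro smooth_minus smooth_mult smooth_const smooth_id) auto
qed auto

lemma smooth_divide:
  fixes f g :: "'a::euclidean_space \<Rightarrow> real"
  assumes "smooth U f" "smooth U g" "\<And>x. x \<in> U \<Longrightarrow> g x \<noteq> 0"
  shows "smooth U (\<lambda>x. f x / g x)"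
proof -
  have "smooth U (\<lambda>x. f x * inverse (g x))"
    using assms by (intro smooth_mult smooth_compose[OF smooth_inverse]) auto
  then show ?thesis by (simp add: divide_inverse)
qed

lemma smooth_sqrt: "smooth {0<..} sqrt"
proof (rule smooth_ode[where V="{0<..}" and D="\<lambda>p v. v / (2 * p)"])
  show "(sqrt has_derivative (\<lambda>v. v / (2 * sqrt y))) (at y)" if "y \<in> {0<..}" for y
  proof -
    have "(\<lambda>v. v / (2 * sqrt y)) = (*) (inverse (sqrt y) / 2)" by (auto simp: field_simps)
    with DERIV_real_sqrt[of y] that show ?thesis by (simp add: has_field_derivative_def)
  qed
  show "smooth {0<..} (\<lambda>p. v / (2 * p))" for v :: real
    by (intro smooth_divide smooth_mult smooth_const smooth_id) auto
qed auto

text \<open>The pair solves an autonomous first-order system; each component alone satisfies a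
  second-order equation.\<close>

lemma smooth_sin_cos: "smooth UNIV (\<lambda>x::real. (sin x, cos x))"
proof (rule smooth_ode[where V=UNIV and D="\<lambda>p v. (snd p * v, - (fst p * v))"])
  show "((\<lambda>x. (sin x, cos x)) has_derivative
      (\<lambda>v. (snd (sin y, cos y) * v, - (fst (sin y, cos y) * v)))) (at y)" for y :: real
    by (auto intro!: derivative_eq_intros)
  show "smooth UNIV (\<lambda>p. (snd p * v, - (fst p * v)))" for v :: real
    by (intro smooth_Pair smooth_minus smooth_mult smooth_const smooth_id smooth_fst smooth_snd) auto
qed auto

lemma smooth_sin: "smooth UNIV (sin :: real \<Rightarrow> real)"
  and smooth_cos: "smooth UNIV (cos :: real \<Rightarrow> real)"
  using smooth_fst[OF smooth_sin_cos] smooth_snd[OF smooth_sin_cos] by (simp_all only: fst_conv snd_conv)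

lemma smooth_arcsin: "smooth {-1<..<1} arcsin"
proof (rule smooth_ode[where V="{-pi/2<..<pi/2}" and D="\<lambda>p v. v / cos p"])
  show "(arcsin has_derivative (\<lambda>v. v / cos (arcsin y))) (at y)" if "y \<in> {-1<..<1}" for y
    using that DERIV_arcsin[of y]
    by (simp add: has_field_derivative_def divide_inverse cos_arcsin mult.commute[of _ "inverse _"])
  show "smooth {-pi/2<..<pi/2} (\<lambda>p. v / cos p)" for v
    by (intro smooth_divide smooth_const smooth_subset[OF smooth_cos])
      (auto dest: cos_gt_zero_pi)
  show "arcsin y \<in> {-pi/2<..<pi/2}" if "y \<in> {-1<..<1}" for y
    using that arcsin_lt_bounded[of y] by auto
qed auto

lemmas smooth_intros = smooth_const smooth_id smooth_fst smooth_snd smooth_minus smooth_add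
  smooth_diff smooth_mult smooth_power smooth_Pair
  smooth_compose[OF smooth_sin] smooth_compose[OF smooth_cos]

section \<open>Smoothness on subsets that are not open\<close>

lemma smooth_imp_smooth_on:
  assumes "\<And>x. x \<in> X \<Longrightarrow> \<exists>U F. x \<in> U \<and> smooth U F \<and> (\<forall>y\<in>U \<inter> X. F y = f y)"
  shows "smooth_on X f"
  unfolding smooth_on_def
proof
  fix x assume "x \<in> X"
  then obtain U F where "x \<in> U" "smooth U F" "\<forall>y\<in>U \<inter> X. F y = f y" using assms by blast
  then show "\<exists>U F. open U \<and> x \<in> U \<and> (\<forall>k. Ck_on k U F) \<and> (\<forall>y\<in>U \<inter> X. F y = f y)"
    unfolding smooth_def by (intro exI[of _ U] exI[of _ F]) simp
qed

lemma smooth_on_subset: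
  assumes "smooth_on X f" "Y \<subseteq> X"
  shows "smooth_on Y f"
  unfolding smooth_on_def
proof
  fix x assume "x \<in> Y"
  then have "x \<in> X" using assms(2) by blast
  then obtain U F where "open U" "x \<in> U" "\<forall>k. Ck_on k U F" "\<forall>y\<in>U \<inter> X. F y = f y"
    using assms(1) unfolding smooth_on_def by meson
  then show "\<exists>U F. open U \<and> x \<in> U \<and> (\<forall>k. Ck_on k U F) \<and> (\<forall>y\<in>U \<inter> Y. F y = f y)"
    using assms(2) by (intro exI[of _ U] exI[of _ F]) auto
qed

lemma smooth_on_imp_continuous_on: 
  assumes "smooth_on X f" shows "continuous_on X f"
  unfolding continuous_on_eq_continuous_within
proof
  fix x assume x: "x \<in> X"
  then obtain U F where U: "open U" "x \<in> U" "\<forall>k. Ck_on k U F" "\<forall>y\<in>U \<inter> X. F y = f y"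
    using assms unfolding smooth_on_def by meson
  then have "continuous_on U F" using Ck_on_imp_continuous_on by blast
  then have "continuous (at x) F" using U by (simp add: continuous_on_eq_continuous_at)
  then have "continuous (at x within X) F" by (rule continuous_at_imp_continuous_at_within)
  then have "(F \<longlongrightarrow> f x) (at x within X)" using U x by (auto simp: continuous_within)
  moreover have "eventually (\<lambda>y. F y = f y) (at x within X)"
    using U by (auto simp: eventually_at_topological)
  ultimately show "continuous (at x within X) f"
    unfolding continuous_within using tendsto_cong by fast
qed

section \<open>Elliptic integrals\<close>

text \<open>One of the two intervals is empty or a single point, so this is the signed integral from
  0 to \<open>x\<close>; \<open>integral {0..x} f\<close> alone vanishes for negative
  \<open>x\<close>.\<close>

definition oriented_integral :: "(real \<Rightarrow> real) \<Rightarrow> real \<Rightarrow> real" where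
  "oriented_integral f x = integral {0..x} f - integral {x..0} f"

lemma oriented_integral_has_derivative:
  assumes "continuous_on UNIV f"
  shows "(oriented_integral f has_real_derivative f x) (at x)"
proof -
  \<comment> \<open>A fixed left end point \<open>- N\<close> allows the fundamental theorem on a
    single interval around \<open>x\<close>, whatever the sign of \<open>x\<close>.\<close>
  obtain N where N: "N > 0" "x \<in> {-N<..<N}" 
    by (rule that[of "\<bar>x\<bar> + 1"]) auto
  have c: "continuous_on A f" for A using assms continuous_on_subset by blast
  have i: "f integrable_on {u..v}" for u v by (intro integrable_continuous_real c)
  have eq: "integral {-N..y} f - integral {-N..0} f = oriented_integral f y" if "y \<in> {-N<..<N}" for y
  proof (cases "y \<ge> 0")
    case True
    then show ?thesis
      using Henstock_Kurzweil_Integration.integral_combine[of "-N" 0 y f] i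
        N(1) by (cases "y = 0") (auto simp: oriented_integral_def algebra_simps)
  next
    case False
    then show ?thesis
      using Henstock_Kurzweil_Integration.integral_combine[of "-N" y 0 f] i that
      by (auto simp: oriented_integral_def)
  qed
  have "((\<lambda>y. integral {-N..y} f) has_real_derivative f x) (at x within {-N..N})"
    by (rule integral_has_real_derivative[OF c]) (use N in auto)
  then have "((\<lambda>y. integral {-N..y} f) has_real_derivative f x) (at x)"
    by (subst (asm) at_within_interior) (use N in auto)
  then have "((\<lambda>y. integral {-N..y} f - integral {-N..0} f) has_real_derivative f x) (at x)"
    by (auto intro!: derivative_eq_intros)
  then show ?thesis
    by (rule has_field_derivative_transform_within_open[where S="{-N<..<N}"])
      (use N eq in auto)
qed

text \<open>The expression is the convex combination of \<open>p\<close> and \<open>p + q\<close>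
  with weights \<open>cos^2 x\<close> and \<open>sin^2 x\<close>, which settles both signs of
  \<open>q\<close>. Other quantities of this shape, such as \<open>speed\<close>, are treated with
  it too.\<close>

lemma radicand_pos:
  fixes p q x :: real
  assumes "p > 0" "p + q > 0"
  shows "p + q * (sin x)\<^sup>2 > 0"
proof -
  have s: "(sin x)\<^sup>2 + (cos x)\<^sup>2 = 1" by simp
  have "p + q * (sin x)\<^sup>2 = p * (cos x)\<^sup>2 + (p + q) * (sin x)\<^sup>2"
    using s by algebra
  moreover have "p * (cos x)\<^sup>2 \<ge> 0" "(p + q) * (sin x)\<^sup>2 \<ge> 0" using assms by auto
  moreover have "sin x \<noteq> 0 \<or> cos x \<noteq> 0" using s by force
  ultimately show ?thesis using assms
    by (metis add_nonneg_pos add_pos_nonneg mult_pos_pos zero_less_power2)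
qed

definition ell_weight :: "real \<Rightarrow> real \<Rightarrow> real \<Rightarrow> real" where
  "ell_weight q p x = 1 / sqrt (p + q * (sin x)\<^sup>2)"

text \<open>The exponents \<open>- j - 1/2\<close> are included because this family is closed under differentiation in
  the parameter \<open>p\<close>, which gives smoothness in both variables by induction.\<close>

definition ell :: "nat \<Rightarrow> real \<Rightarrow> real \<Rightarrow> real \<Rightarrow> real" where
  "ell j q p = oriented_integral (\<lambda>y. ell_weight q p y ^ (2 * j + 1))"

definition ell_domain :: "real \<Rightarrow> real set" where
  "ell_domain q = {p. p > 0 \<and> p + q > 0}"

lemma open_ell_domain [simp]: "open (ell_domain q)"
  unfolding ell_domain_def by (intro open_Collect_conj open_Collect_less) (auto intro!: continuous_intros)

lemma convex_ell_domain: "convex (ell_domain q)"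
proof -
  have "ell_domain q = {max 0 (-q) <..}" by (auto simp: ell_domain_def)
  then show ?thesis by simp
qed

lemma ell_domain_radicand: "p \<in> ell_domain q \<Longrightarrow> p + q * (sin x)\<^sup>2 > 0"
  by (simp add: ell_domain_def radicand_pos)

lemma ell_weight_pos: "p \<in> ell_domain q \<Longrightarrow> ell_weight q p x > 0"
  by (simp add: ell_weight_def ell_domain_radicand)

lemma smooth_ell_weight: "smooth (ell_domain q \<times> UNIV) (\<lambda>z. ell_weight q (fst z) (snd z))"
  unfolding ell_weight_def
  by (intro smooth_divide smooth_compose[OF smooth_sqrt] smooth_intros)
    (auto simp: open_Times ell_domain_radicand, metis ell_domain_radicand order_less_irrefl)

lemma continuous_on_ell_weight:
  assumes "p \<in> ell_domain q"
  shows "continuous_on A (ell_weight q p)"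
proof -
  have "sqrt (p + q * (sin x)\<^sup>2) \<noteq> 0" for x using ell_domain_radicand[OF assms, of x] by auto
  then show ?thesis unfolding ell_weight_def by (intro continuous_intros) auto
qed

lemma ell_has_derivative:
  "p \<in> ell_domain q \<Longrightarrow> (ell j q p has_real_derivative ell_weight q p x ^ (2 * j + 1)) (at x)"
  unfolding ell_def
  by (rule oriented_integral_has_derivative) (intro continuous_intros continuous_on_ell_weight)

lemma ell_weight_has_derivative_param:
  assumes "p \<in> ell_domain q"
  shows "((\<lambda>p. ell_weight q p x ^ (2 * j + 1)) has_real_derivative
     - ((2 * real j + 1) / 2) * ell_weight q p x ^ (2 * Suc j + 1)) (at p within S)"
proof -
  define R where "R = sqrt (p + q * (sin x)\<^sup>2)"
  have R: "R > 0" "p + q * (sin x)\<^sup>2 = R\<^sup>2"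
    using ell_domain_radicand[OF assms, of x] by (auto simp: R_def)
  have "((\<lambda>p. 1 / sqrt (p + k)) has_real_derivative - (1 / 2) * (1 / R) ^ 3) (at p within S)"
    if "R\<^sup>2 = p + k" for k
  proof -
    have "p + k > 0" "sqrt (p + k) = R"
      using that R(1) by (auto simp flip: that simp: real_sqrt_unique)
    then show ?thesis using R(1)
      by (auto intro!: derivative_eq_intros simp: field_simps power2_eq_square power3_eq_cube)
  qed
  from this[of "q * (sin x)\<^sup>2"] R(2)
  have "((\<lambda>p. ell_weight q p x) has_real_derivative - (1/2) * (1/R)^3) (at p within S)"
    by (simp add: ell_weight_def)
  moreover have "ell_weight q p x = 1 / R" by (simp add: ell_weight_def R_def)
  ultimately show ?thesis
    using DERIV_power[where n="2 * j + 1" and f="\<lambda>p. ell_weight q p x" and x=p and s=S]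
    by (fastforce simp: power3_eq_cube algebra_simps)
qed

lemma ell_has_derivative_param:
  assumes p: "p \<in> ell_domain q"
  shows "((\<lambda>p. ell j q p x) has_real_derivative - ((2 * real j + 1) / 2) * ell (Suc j) q p x) (at p)"
proof -
  let ?w = "\<lambda>j p y. ell_weight q p y ^ (2 * j + 1)"
  have c: "continuous_on (ell_domain q \<times> B) (\<lambda>(p, y). ell_weight q p y)" for B
    using smooth_continuous_on[OF smooth_ell_weight, of q]
    by (auto simp: case_prod_unfold intro: continuous_on_subset)
  have "((\<lambda>p. integral (cbox u v) (?w j p)) has_real_derivative
      integral (cbox u v) (\<lambda>y. - ((2 * real j + 1) / 2) * ?w (Suc j) p y)) (at p within ell_domain q)" for u v
  proof (rule leibniz_rule_field_derivative)
    show "(\<lambda>y. ?w j p y) integrable_on cbox u v" if "p \<in> ell_domain q" for p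
      using that by (intro integrable_continuous continuous_intros continuous_on_ell_weight)
    have "continuous_on (ell_domain q \<times> cbox u v)
        (\<lambda>z. - ((2 * real j + 1) / 2) * (case z of (p, y) \<Rightarrow> ell_weight q p y) ^ (2 * Suc j + 1))"
      by (intro continuous_intros c)
    then show "continuous_on (ell_domain q \<times> cbox u v)
        (\<lambda>(p, y). - ((2 * real j + 1) / 2) * ?w (Suc j) p y)"
      by (simp add: case_prod_unfold)
  qed (rule ell_weight_has_derivative_param p convex_ell_domain | assumption)+
  then have "((\<lambda>p. integral {u..v} (?w j p)) has_real_derivative
      - ((2 * real j + 1) / 2) * integral {u..v} (\<lambda>y. ?w (Suc j) p y)) (at p)" for u v
    using p by (simp only: at_within_open[OF p open_ell_domain] cbox_interval integral_mult_right)
  from this[of 0 x] this[of x 0] show ?thesis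
    unfolding ell_def oriented_integral_def
    by (auto intro!: derivative_eq_intros simp: algebra_simps)
qed

lemma ell_has_total_derivative:
  assumes z: "z \<in> ell_domain q \<times> UNIV"
  shows "((\<lambda>z. ell j q (fst z) (snd z)) has_derivative (\<lambda>v.
      - ((2 * real j + 1) / 2) * ell (Suc j) q (fst z) (snd z) * fst v
      + ell_weight q (fst z) (snd z) ^ (2 * j + 1) * snd v)) (at z)"
proof -
  obtain p x where pz: "z = (p, x)" by fastforce
  with z have p: "p \<in> ell_domain q" by simp
  let ?w = "\<lambda>p x. ell_weight q p x ^ (2 * j + 1)"
  have "((\<lambda>(p, x). ell j q p x) has_derivative (\<lambda>(tp, tx).
      - ((2 * real j + 1) / 2) * ell (Suc j) q p x * tp + blinfun_mult_right (?w p x) tx))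
      (at (p, x) within ell_domain q \<times> UNIV)"
  proof (rule has_derivative_partialsI)
    show "((\<lambda>p. ell j q p x) has_derivative (*) (- ((2 * real j + 1) / 2) * ell (Suc j) q p x))
        (at p within ell_domain q)"
      using ell_has_derivative_param[OF p] has_derivative_at_withinI
      unfolding has_field_derivative_def by blast
    show "(ell j q p has_derivative blinfun_mult_right (?w p x)) (at x within UNIV)"
      if "p \<in> ell_domain q" for p x
      using ell_has_derivative[OF that] by (simp add: has_field_derivative_def)
    have "continuous_on (ell_domain q \<times> UNIV)
        (\<lambda>z. blinfun_mult_right (ell_weight q (fst z) (snd z) ^ (2 * j + 1)))"
      by (intro bounded_linear.continuous_on[OF bounded_linear_blinfun_mult_right]
          continuous_intros smooth_continuous_on smooth_ell_weight)
    then show "continuous (at (p, x) within ell_domain q \<times> UNIV)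
        (\<lambda>(p, x). blinfun_mult_right (?w p x))"
      using p by (auto simp: continuous_on_eq_continuous_within case_prod_unfold)
  qed auto
  then show ?thesis
    using p by (simp add: pz case_prod_unfold at_within_open[of _ "ell_domain q \<times> UNIV"] open_Times)
qed

lemma smooth_ell: "smooth (ell_domain q \<times> UNIV) (\<lambda>z. ell j q (fst z) (snd z))"
proof -
  have "Ck_on k (ell_domain q \<times> UNIV) (\<lambda>z. ell j q (fst z) (snd z))" for k
  proof (induction k arbitrary: j)
    case 0
    show ?case
      using has_derivative_continuous_on[OF has_derivative_at_withinI[OF ell_has_total_derivative]]
      by simp
  next
    case (Suc k)
    let ?U = "ell_domain q \<times> (UNIV :: real set)"
    have w: "Ck_on k ?U (\<lambda>z. ell_weight q (fst z) (snd z) ^ (2 * j + 1) * b)" for b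
      using smooth_mult[OF smooth_power[OF smooth_ell_weight[of q], of "2 * j + 1"] smooth_const, of b]
      by (simp add: smooth_def open_Times)
    have e: "Ck_on k ?U (\<lambda>z. - ((2 * real j + 1) / 2) * ell (Suc j) q (fst z) (snd z) * a)" for a
      by (intro Ck_on_bilinear[OF _ bounded_bilinear_mult] Ck_on_const Suc open_Times) auto
    show ?case
      by (rule Ck_on_SucI[OF _ ell_has_total_derivative])
        (use Ck_on_add[OF _ e w] in \<open>auto simp: open_Times\<close>)
  qed
  then show ?thesis by (simp add: smooth_def open_Times)
qed

section \<open>Periodicity, monotonicity and surjectivity of the elliptic integrals\<close>

lemma ell_0 [simp]: "ell j q p 0 = 0"
  by (simp add: ell_def oriented_integral_def)

lemma const_if_derivs_eq:
  fixes f g :: "real \<Rightarrow> real"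
  assumes "\<And>x. (f has_real_derivative d x) (at x)" "\<And>x. (g has_real_derivative d x) (at x)"
  shows "f x - g x = f y - g y"
proof -
  have "((\<lambda>x. f x - g x) has_real_derivative 0) (at x)" for x
    using DERIV_diff[OF assms(1,2)] by simp
  then show ?thesis by (rule DERIV_isconst_all[rule_format]) 
qed

text \<open>The weight is even, so both sides have the same derivative and agree at 0;
  \<open>ell_add_pi\<close> exploits the period \<open>pi\<close> in the same way.\<close>

lemma ell_minus:
  assumes "p \<in> ell_domain q"
  shows "ell j q p (- x) = - ell j q p x"
proof -
  have "((\<lambda>x. - ell j q p (- x)) has_real_derivative ell_weight q p x ^ (2 * j + 1)) (at x)" for x
    by (rule derivative_eq_intros DERIV_chain2[where f="ell j q p" and g=uminus]
        ell_has_derivative[OF assms] refl)+ (simp add: ell_weight_def)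
  from const_if_derivs_eq[OF this ell_has_derivative[OF assms, of j], of x 0] show ?thesis by simp
qed

lemma ell_add_pi:
  assumes "p \<in> ell_domain q"
  shows "ell j q p (x + pi) = ell j q p x + ell j q p pi"
proof -
  have "((\<lambda>x. ell j q p (x + pi)) has_real_derivative ell_weight q p x ^ (2 * j + 1)) (at x)" for x
    by (rule DERIV_cong[OF DERIV_chain2[where f="ell j q p" and g="\<lambda>x. x + pi" and x=x and Db=1,
            OF ell_has_derivative[OF assms]]])
      (auto intro!: derivative_eq_intros simp: ell_weight_def)
  from const_if_derivs_eq[OF this ell_has_derivative[OF assms, of j], of x 0] show ?thesis by simp
qed

lemma ell_pi: "p \<in> ell_domain q \<Longrightarrow> ell j q p pi = 2 * ell j q p (pi / 2)"
  using ell_add_pi[of p q j "- (pi / 2)"] by (simp add: ell_minus)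

lemma ell_add_of_int_pi:
  assumes "p \<in> ell_domain q"
  shows "ell j q p (x + of_int m * pi) = ell j q p x + of_int m * ell j q p pi"
proof -
  have 1: "ell j q p (y + of_nat k * pi) = ell j q p y + of_nat k * ell j q p pi" for k y
  proof (induction k)
    case (Suc k)
    then show ?case using ell_add_pi[OF assms, of j "y + of_nat k * pi"] by (simp add: algebra_simps)
  qed simp
  show ?thesis
  proof (cases "m \<ge> 0")
    case True
    then show ?thesis using 1[of x "nat m"] by simp
  next
    case False
    then show ?thesis using 1[of "x + of_int m * pi" "nat (-m)"] by (simp add: algebra_simps)
  qed
qed

lemma ell_strict_mono:
  assumes "p \<in> ell_domain q"
  shows "strict_mono (ell j q p)"
proof (rule strict_monoI)
  fix x y :: real assume "x < y"
  then show "ell j q p x < ell j q p y"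
    by (rule DERIV_pos_imp_increasing)
      (use ell_has_derivative[OF assms] ell_weight_pos[OF assms] zero_less_power in blast)
qed

lemma ell_less_iff: "p \<in> ell_domain q \<Longrightarrow> ell j q p x < ell j q p y \<longleftrightarrow> x < y"
  and ell_eq_iff: "p \<in> ell_domain q \<Longrightarrow> ell j q p x = ell j q p y \<longleftrightarrow> x = y"
  using ell_strict_mono strict_mono_less strict_mono_eq by blast+

lemma ell_pos: "p \<in> ell_domain q \<Longrightarrow> x > 0 \<Longrightarrow> ell j q p x > 0"
  using ell_less_iff[of p q j 0 x] by simp

lemma continuous_on_ell: "p \<in> ell_domain q \<Longrightarrow> continuous_on A (ell j q p)"
  using ell_has_derivative by (meson DERIV_continuous continuous_at_imp_continuous_on)

lemma bij_ell:
  assumes "p \<in> ell_domain q"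
  shows "bij (ell j q p)"
proof -
  have "y \<in> range (ell j q p)" for y
  proof -
    have e: "ell j q p pi > 0" using ell_pos[OF assms] by simp
    \<comment> \<open>\<open>ell\<close> takes the value \<open>m * ell j q p pi\<close> at
      \<open>m * pi\<close>, so this \<open>n\<close> makes the values at \<open>- n * pi\<close>
      and \<open>n * pi\<close> enclose \<open>y\<close>.\<close>
    define n :: int where "n = \<lceil>\<bar>y\<bar> / ell j q p pi\<rceil>"
    have "of_int n \<ge> \<bar>y\<bar> / ell j q p pi" unfolding n_def by linarith
    then have "of_int n * ell j q p pi \<ge> \<bar>y\<bar>" using e by (simp add: field_simps)
    moreover have "n \<ge> 0"
    proof -
      have "0 \<le> \<bar>y\<bar> / ell j q p pi" using e by simp
      then show ?thesis unfolding n_def by linarith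
    qed
    moreover have "ell j q p (of_int m * pi) = of_int m * ell j q p pi" for m
      using ell_add_of_int_pi[OF assms, of j 0 m] by simp
    ultimately have "\<exists>x. of_int (-n) * pi \<le> x \<and> x \<le> of_int n * pi \<and> ell j q p x = y"
      by (intro IVT' continuous_on_ell assms) (auto simp: ell_minus[OF assms])
    then show ?thesis by auto
  qed
  then show ?thesis
    using ell_strict_mono[OF assms] strict_mono_imp_inj_on by (auto simp: bij_def)
qed

text \<open>If \<open>f / g\<close> is above \<open>K\<close> before \<open>d\<close> and below it
  afterwards, \<open>F - K G\<close> rises up to \<open>d\<close> and then falls. Hence
  \<open>F d / G d\<close> exceeds \<open>K\<close>, the increments between \<open>d\<close> and
  \<open>L\<close> have a quotient below \<open>K\<close>, and prolonging the interval lowers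
  \<open>F / G\<close>.\<close>

lemma antiderivative_ratio_less:
  fixes F G f g :: "real \<Rightarrow> real"
  assumes F: "\<And>x. (F has_real_derivative f x) (at x)" "F 0 = 0"
    and G: "\<And>x. (G has_real_derivative g x) (at x)" "G 0 = 0"
    and d: "0 < d" "d < L"
    and less: "\<And>x. 0 < x \<Longrightarrow> x < d \<Longrightarrow> f x > K * g x"
    and greater: "\<And>x. d < x \<Longrightarrow> x < L \<Longrightarrow> f x < K * g x"
    and pos: "\<And>x. g x > 0"
  shows "G d * F L < F d * G L"
proof -
  let ?H = "\<lambda>x. F x - K * G x"
  have H: "(?H has_real_derivative f x - K * g x) (at x)" for x
    by (intro DERIV_diff DERIV_cmult F G)
  have cH: "continuous_on A ?H" for A
    using H by (meson DERIV_continuous continuous_at_imp_continuous_on)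
  have "?H 0 < ?H d"
  proof (rule DERIV_pos_imp_increasing_open[OF d(1) _ cH])
    show "\<exists>y. (?H has_real_derivative y) (at x) \<and> y > 0" if "0 < x" "x < d" for x
      using H[of x] less[OF that] by (intro exI[of _ "f x - K * g x"]) simp
  qed
  moreover have "?H L < ?H d"
  proof (rule DERIV_neg_imp_decreasing_open[OF d(2) _ cH])
    show "\<exists>y. (?H has_real_derivative y) (at x) \<and> y < 0" if "d < x" "x < L" for x
      using H[of x] greater[OF that] by (intro exI[of _ "f x - K * g x"]) simp
  qed
  moreover have "G x < G y" if "x < y" for x y
    using that by (rule DERIV_pos_imp_increasing) (use G(1) pos in blast)
  from this[OF d(1)] this[OF d(2)] have "G 0 < G d" "G d < G L" .
  ultimately have 1: "K * G d < F d" "F L - F d < K * (G L - G d)" "0 < G d" "0 < G L - G d"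
    using F(2) G(2) by (auto simp: algebra_simps)
  have "G d * (F L - F d) < G d * (K * (G L - G d))" using 1 by (intro mult_strict_left_mono)
  also have "\<dots> = (K * G d) * (G L - G d)" by simp
  also have "\<dots> < F d * (G L - G d)" using 1 by (intro mult_strict_right_mono)
  finally show ?thesis by (simp add: algebra_simps)
qed

lemma sin_squared_less:
  assumes "0 \<le> x" "x < y" "y \<le> pi / 2"
  shows "(sin x)\<^sup>2 < (sin y)\<^sup>2"
  using assms by (intro power_strict_mono sin_monotone_2pi sin_ge_zero) auto

text \<open>Differentiation in \<open>p\<close> turns \<open>ell 0\<close> into a multiple of
  \<open>ell 1\<close>, so this is the sign of the parameter derivative of incomplete over complete
  integral. The quotient of the two integrands is \<open>ell_weight\<close> squared, which decreases
  up to \<open>pi / 2\<close> for \<open>q > 0\<close> and is constant for a circle; hence the weak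
  inequality.\<close>

lemma ell_ratio_param:
  assumes p: "p > 0" and q: "q \<ge> 0" and d: "0 < d" "d < pi / 2"
  shows "ell 0 q p d * ell 1 q p (pi / 2) \<le> ell 1 q p d * ell 0 q p (pi / 2)"
proof (cases "q = 0")
  case True
  have D: "p \<in> ell_domain 0" using p by (simp add: ell_domain_def)
  have "((\<lambda>x. ell 0 0 p x / p) has_real_derivative ell_weight 0 p x ^ (2 * 1 + 1)) (at x)" for x
    using p by (auto intro!: derivative_eq_intros ell_has_derivative[OF D]
        simp: ell_weight_def power3_eq_cube field_simps)
  from const_if_derivs_eq[OF this ell_has_derivative[OF D, of 1], of _ 0]
  have "ell 1 0 p x = ell 0 0 p x / p" for x by simp
  then show ?thesis by (simp add: True)
next
  case False
  then have q: "q > 0" using q by simp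
  have D: "p \<in> ell_domain q" using p q by (simp add: ell_domain_def)
  let ?w = "ell_weight q p"
  have w: "(?w x)\<^sup>2 = 1 / (p + q * (sin x)\<^sup>2)" for x
    using ell_domain_radicand[OF D, of x] by (simp add: ell_weight_def power_divide)
  have cmp: "(?w y)\<^sup>2 < (?w x)\<^sup>2" if "0 \<le> x" "x < y" "y \<le> pi / 2" for x y
    unfolding w using q ell_domain_radicand[OF D] sin_squared_less[OF that]
    by (intro divide_strict_left_mono mult_pos_pos) auto
  have e: "?w x ^ (2 * 1 + 1) = (?w x)\<^sup>2 * ?w x ^ (2 * 0 + 1)" for x
    by (simp add: power2_eq_square power3_eq_cube)
  have "ell 0 q p d * ell 1 q p (pi / 2) < ell 1 q p d * ell 0 q p (pi / 2)"
  proof (rule antiderivative_ratio_less[OF ell_has_derivative[OF D] ell_0 ell_has_derivative[OF D] ell_0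
        d, where K="(?w d)\<^sup>2"], unfold e)
    show "(?w d)\<^sup>2 * ?w x ^ (2 * 0 + 1) < (?w x)\<^sup>2 * ?w x ^ (2 * 0 + 1)" if "0 < x" "x < d" for x
      using cmp[of x d] that d ell_weight_pos[OF D] by (intro mult_strict_right_mono) auto
    show "(?w x)\<^sup>2 * ?w x ^ (2 * 0 + 1) < (?w d)\<^sup>2 * ?w x ^ (2 * 0 + 1)" if "d < x" "x < pi / 2" for x
      using cmp[of d x] that d ell_weight_pos[OF D] by (intro mult_strict_right_mono) auto
  qed (use ell_weight_pos[OF D] in simp)
  then show ?thesis by simp
qed

text \<open>The moduli are compared without differentiating in \<open>m\<close>: the quotient of the
  weights is the root of \<open>(1 - m' s) / (1 - m s)\<close> with \<open>s = sin^2 x\<close>, and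
  this decreases in \<open>s\<close> because \<open>m < m'\<close>.\<close>

lemma ell_ratio_modulus:
  assumes m: "0 \<le> m" "m < m'" "m' < 1" and d: "0 < d" "d < pi / 2"
  shows "ell 0 (-m') 1 d * ell 0 (-m) 1 (pi / 2) < ell 0 (-m) 1 d * ell 0 (-m') 1 (pi / 2)"
proof -
  have D: "1 \<in> ell_domain (-m)" "1 \<in> ell_domain (-m')" using m by (auto simp: ell_domain_def)
  let ?w = "ell_weight (-m) 1" and ?w' = "ell_weight (-m') 1"
  have w: "(?w x / ?w' x) = sqrt ((1 - m' * (sin x)\<^sup>2) / (1 - m * (sin x)\<^sup>2))" for x
    by (simp add: ell_weight_def real_sqrt_divide)
  have cmp: "?w y / ?w' y < ?w x / ?w' x" if "0 \<le> x" "x < y" "y \<le> pi / 2" for x y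
    unfolding w real_sqrt_less_iff
  proof -
    have "1 - m * (sin z)\<^sup>2 > 0" for z using ell_domain_radicand[OF D(1), of z] by simp
    moreover have "(1 - m' * (sin y)\<^sup>2) * (1 - m * (sin x)\<^sup>2) < (1 - m' * (sin x)\<^sup>2) * (1 - m * (sin y)\<^sup>2)"
    proof -
      have "0 < (m' - m) * ((sin y)\<^sup>2 - (sin x)\<^sup>2)"
        using m sin_squared_less[OF that] by (intro mult_pos_pos) auto
      then show ?thesis by (simp add: algebra_simps)
    qed
    ultimately show "(1 - m' * (sin y)\<^sup>2) / (1 - m * (sin y)\<^sup>2) < (1 - m' * (sin x)\<^sup>2) / (1 - m * (sin x)\<^sup>2)"
      by (simp add: divide_less_eq pos_less_divide_eq)
  qed
  note pos = ell_weight_pos[OF D(1)] ell_weight_pos[OF D(2)]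
  show ?thesis
  proof (rule antiderivative_ratio_less[OF ell_has_derivative[OF D(1)] ell_0
        ell_has_derivative[OF D(2)] ell_0 d, where K="?w d / ?w' d"])
    show "?w d / ?w' d * ?w' x ^ (2 * 0 + 1) < ?w x ^ (2 * 0 + 1)" if "0 < x" "x < d" for x
      using cmp[of x d] that d pos(2)[of x] by (simp add: pos_less_divide_eq)
    show "?w x ^ (2 * 0 + 1) < ?w d / ?w' d * ?w' x ^ (2 * 0 + 1)" if "d < x" "x < pi / 2" for x
      using cmp[of d x] that d pos(2)[of x] by (simp add: pos_divide_less_eq)
  qed (use pos in simp)
qed

lemma ell_mono_derivative:
  assumes "p \<in> ell_domain q" "x \<ge> 0"
    and f: "\<And>y. 0 \<le> y \<Longrightarrow> y \<le> x \<Longrightarrow> (f has_real_derivative d y) (at y)"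
  shows "(\<And>y. 0 \<le> y \<Longrightarrow> y \<le> x \<Longrightarrow> d y \<le> ell_weight q p y) \<Longrightarrow> f x - f 0 \<le> ell 0 q p x"
    and "(\<And>y. 0 \<le> y \<Longrightarrow> y \<le> x \<Longrightarrow> ell_weight q p y \<le> d y) \<Longrightarrow> ell 0 q p x \<le> f x - f 0"
proof -
  have D: "((\<lambda>y. ell 0 q p y - f y) has_real_derivative ell_weight q p y - d y) (at y)"
    if "0 \<le> y" "y \<le> x" for y
    using DERIV_diff[OF ell_has_derivative[OF assms(1), of 0] f[OF that]] by simp
  show "f x - f 0 \<le> ell 0 q p x" if "\<And>y. 0 \<le> y \<Longrightarrow> y \<le> x \<Longrightarrow> d y \<le> ell_weight q p y"
    using DERIV_nonneg_imp_nondecreasing[OF assms(2), of "\<lambda>y. ell 0 q p y - f y"] D that by force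
  show "ell 0 q p x \<le> f x - f 0" if "\<And>y. 0 \<le> y \<Longrightarrow> y \<le> x \<Longrightarrow> ell_weight q p y \<le> d y"
    using DERIV_nonpos_imp_nonincreasing[OF assms(2), of "\<lambda>y. ell 0 q p y - f y"] D that by force
qed

text \<open>As \<open>m\<close> tends to 1 the integrand approaches \<open>1 / cos x\<close>, whose
  integral diverges logarithmically at \<open>pi / 2\<close>. The minorant
  \<open>1 / (e + pi / 2 - x)\<close> diverges likewise as \<open>e\<close> tends to 0 and has an
  elementary primitive.\<close>

lemma complete_ell_unbounded:
  assumes "M > 0"
  obtains m where "0 < m" "m < 1" "\<And>m'. m \<le> m' \<Longrightarrow> m' < 1 \<Longrightarrow> M < ell 0 (- m') 1 (pi / 2)"
proof
  \<comment> \<open>The primitive gains \<open>ln (1 + pi / (2 e))\<close>, which the second bound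
    makes at least \<open>M + 1\<close>; the first bound keeps \<open>1 - e^2\<close>
    positive.\<close>
  define e where "e = min (1/2) (pi / 2 / (exp (M + 1) - 1))"
  have ex: "exp (M + 1) > 1" using assms by simp
  have "e > 0" using ex by (simp add: e_def)
  moreover have "e \<le> 1/2" unfolding e_def by (rule min.cobounded1)
  moreover have "e \<le> pi / 2 / (exp (M + 1) - 1)" unfolding e_def by (rule min.cobounded2)
  ultimately have e: "e > 0" "e \<le> 1/2" "e \<le> pi / 2 / (exp (M + 1) - 1)" .
  have "(e + pi / 2) / e = 1 + (pi / 2) / e" using e by (simp add: field_simps)
  moreover have "(pi / 2) / e \<ge> exp (M + 1) - 1" using e ex by (simp add: field_simps)
  ultimately have big: "ln ((e + pi / 2) / e) \<ge> M + 1"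
    using e by (subst ln_ge_iff) (auto simp: add_pos_pos)
  show "0 < 1 - e\<^sup>2" "1 - e\<^sup>2 < 1" using e power_strict_mono[of e 1 2] by auto
  fix m' assume m': "1 - e\<^sup>2 \<le> m'" "m' < 1"
  have D: "1 \<in> ell_domain (-m')" using m' by (auto simp: ell_domain_def)
  have "- ln (e + pi / 2 - pi / 2) - - ln (e + pi / 2 - 0) \<le> ell 0 (-m') 1 (pi / 2)"
  proof (rule ell_mono_derivative(1)[OF D, where f="\<lambda>x. - ln (e + pi / 2 - x)" and d="\<lambda>x. 1 / (e + pi / 2 - x)"])
    fix x :: real assume x: "0 \<le> x" "x \<le> pi / 2"
    then show "((\<lambda>x. - ln (e + pi / 2 - x)) has_real_derivative 1 / (e + pi / 2 - x)) (at x)"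
      using e by (auto intro!: derivative_eq_intros)
    have c: "0 \<le> cos x" "cos x \<le> pi / 2 - x"
      using x cos_ge_zero sin_x_le_x[of "pi / 2 - x"] by (auto simp: cos_sin_eq)
    have "1 - m' * (sin x)\<^sup>2 \<le> 1 - (1 - e\<^sup>2) * (sin x)\<^sup>2"
      using m' by (simp add: mult_right_mono)
    also have "\<dots> = (cos x)\<^sup>2 + e\<^sup>2 * (sin x)\<^sup>2" by (simp add: cos_squared_eq algebra_simps)
    also have "\<dots> \<le> (pi / 2 - x)\<^sup>2 + e\<^sup>2"
      using c by (intro add_mono power_mono) (auto simp: mult_left_le power_le_one_iff abs_square_le_1)
    also have "\<dots> \<le> (e + pi / 2 - x)\<^sup>2"
    proof -
      have "0 \<le> 2 * e * (pi / 2 - x)" using x e by simp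
      moreover have "(e + pi / 2 - x)\<^sup>2 = (pi / 2 - x)\<^sup>2 + e\<^sup>2 + 2 * e * (pi / 2 - x)"
        by (simp add: power2_eq_square algebra_simps)
      ultimately show ?thesis by linarith
    qed
    finally have "sqrt (1 - m' * (sin x)\<^sup>2) \<le> e + pi / 2 - x" using x e by (intro real_le_lsqrt) auto
    then show "1 / (e + pi / 2 - x) \<le> ell_weight (-m') 1 x"
      using ell_domain_radicand[OF D, of x] x e by (auto simp: ell_weight_def intro!: divide_left_mono mult_pos_pos)
  qed auto
  moreover have "- ln (e + pi / 2 - pi / 2) - - ln (e + pi / 2 - 0) = ln ((e + pi / 2) / e)"
    using e add_pos_pos[of e "pi / 2"] by (simp add: ln_div)
  ultimately show "M < ell 0 (- m') 1 (pi / 2)" using big by linarith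
qed

text \<open>Here \<open>q\<close> varies while \<open>p = 1\<close> stays fixed, a direction that
  \<open>smooth_ell\<close> does not cover.\<close>

lemma continuous_on_ell_modulus: "continuous_on {0..<1} (\<lambda>m. ell 0 (-m) 1 x)"
proof -
  have "1 - m * (sin y)\<^sup>2 > 0" if "0 \<le> m" "m < 1" for m y :: real
    using radicand_pos[of 1 "-m" y] that by simp
  then have "continuous_on ({0..<1} \<times> cbox u v) (\<lambda>(m, y). ell_weight (-m) 1 y)" for u v
    unfolding ell_weight_def case_prod_unfold
    by (intro continuous_intros) (force simp: less_le)
  from integral_continuous_on_param[OF this]
  have "continuous_on {0..<1} (\<lambda>m. integral {u..v} (ell_weight (-m) 1))" for u v
    by (simp add: cbox_interval)
  then show ?thesis
    unfolding ell_def oriented_integral_def by (auto intro!: continuous_intros)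
qed

section \<open>A one-parameter form of the Euler addition theorem\<close>

text \<open>Along the family of pairs \<open>(\<xi> - \<eta>, \<xi> + \<eta>)\<close> both \<open>d (\<xi> - \<eta>) / d \<xi>\<close> and \<open>d (\<xi> + \<eta>) / d \<xi>\<close> equal
  \<open>1 / (sin \<eta> * cos \<eta>)\<close> up to a common factor times \<open>sqrt (p + q * (sin x)\<^sup>2)\<close> at the respective
  point, so the elliptic integral between the two points is constant.\<close>

lemma elliptic_shift:
  fixes p q A x :: real
  assumes D: "p \<in> ell_domain q" and A: "0 < A" "A < 1"
  defines "B \<equiv> q * A * (1 - A) / (p + q * A)"
  obtains \<xi> \<eta> where "x = \<xi> - \<eta>" "0 < \<eta>" "\<eta> < pi / 2" "(sin \<eta>)\<^sup>2 = A + B * (sin \<xi>)\<^sup>2"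
    "ell 0 q p (\<xi> + \<eta>) = ell 0 q p x + 2 * ell 0 q p (arcsin (sqrt A))"
    "\<bar>B * sin \<xi> * cos \<xi>\<bar> < sin \<eta> * cos \<eta>"
proof -
  have pq: "p > 0" "p + q > 0" using D by (auto simp: ell_domain_def)
  have "p + q * A = p * (1 - A) + (p + q) * A" by (simp add: algebra_simps)
  then have pA: "p + q * A > 0" using pq A by (simp add: add_pos_pos)
  \<comment> \<open>\<open>A\<close> and \<open>A + B\<close> are the values of
    \<open>sin^2 \<eta>\<close> where \<open>sin \<xi> = 0\<close> and where
    \<open>cos \<xi> = 0\<close>; both must lie strictly between 0 and 1.\<close>
  have AB: "A + B = A * (p + q) / (p + q * A)" "1 - A - B = p * (1 - A) / (p + q * A)"
    using pA by (simp_all add: B_def field_simps)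
  then have AB_pos: "A + B > 0" "1 - A - B > 0" using pA pq A by simp_all
  define N where "N \<xi> = A + B * (sin \<xi>)\<^sup>2" for \<xi>
  have N: "0 < N \<xi>" "N \<xi> < 1" for \<xi>
    using radicand_pos[of A B \<xi>] radicand_pos[of "1 - A" "-B" \<xi>] AB_pos A by (auto simp: N_def)
  define \<eta> where "\<eta> \<xi> = arcsin (sqrt (N \<xi>))" for \<xi>
  have sN: "0 < sqrt (N \<xi>)" "sqrt (N \<xi>) < 1" for \<xi> using N by auto
  have sin_eta: "sin (\<eta> \<xi>) = sqrt (N \<xi>)" for \<xi>
    unfolding \<eta>_def using sN[of \<xi>] by (intro sin_arcsin) linarith+
  have eta: "0 < \<eta> \<xi>" "\<eta> \<xi> < pi / 2" for \<xi>
    using sN[of \<xi>] arcsin_less_mono[of 0 "sqrt (N \<xi>)"] arcsin_less_mono[of "sqrt (N \<xi>)" 1]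
    by (auto simp: \<eta>_def)
  have cos_eta: "cos (\<eta> \<xi>) > 0" for \<xi> using eta[of \<xi>] by (intro cos_gt_zero_pi) auto
  have sin_eta2: "(sin (\<eta> \<xi>))\<^sup>2 = A + B * (sin \<xi>)\<^sup>2" for \<xi> using N[of \<xi>] by (simp add: sin_eta N_def)
  \<comment> \<open>This says that the derivative of \<open>\<eta>\<close> is below 1 in absolute
    value, so \<open>\<xi> - \<eta>\<close> and \<open>\<xi> + \<eta>\<close> both increase and the
    square roots below carry the positive sign. The difference of squares is linear in
    \<open>sin^2 \<xi>\<close> with positive values at both ends.\<close>
  have bound: "\<bar>B * sin \<xi> * cos \<xi>\<bar> < sin (\<eta> \<xi>) * cos (\<eta> \<xi>)" for \<xi>
  proof -
    have "(sin (\<eta> \<xi>) * cos (\<eta> \<xi>))\<^sup>2 - (B * sin \<xi> * cos \<xi>)\<^sup>2 =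
        A * (1 - A) + ((A + B) * (1 - A - B) - A * (1 - A)) * (sin \<xi>)\<^sup>2"
      using sin_eta2[of \<xi>] sin_cos_squared_add[of \<xi>] sin_cos_squared_add[of "\<eta> \<xi>"] by algebra
    moreover have "\<dots> > 0" using AB_pos A by (intro radicand_pos) auto
    ultimately have "\<bar>B * sin \<xi> * cos \<xi>\<bar>\<^sup>2 < (sin (\<eta> \<xi>) * cos (\<eta> \<xi>))\<^sup>2" by simp
    then show ?thesis
      by (rule power2_less_imp_less) (use sin_eta sN cos_eta in \<open>simp add: less_imp_le\<close>)
  qed
  have eta_deriv: "(\<eta> has_real_derivative B * sin \<xi> * cos \<xi> / (sin (\<eta> \<xi>) * cos (\<eta> \<xi>))) (at \<xi>)" for \<xi>
  proof -
    have "cos (\<eta> \<xi>) = sqrt (1 - (sqrt (N \<xi>))\<^sup>2)"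
      unfolding \<eta>_def using sN[of \<xi>] by (intro cos_arcsin) linarith+
    then have arcsin: "(arcsin has_real_derivative inverse (cos (\<eta> \<xi>))) (at (sqrt (N \<xi>)))"
      using DERIV_arcsin[of "sqrt (N \<xi>)"] sN[of \<xi>] by simp
    have "(N has_real_derivative 2 * B * sin \<xi> * cos \<xi>) (at \<xi>)"
      unfolding N_def by (auto intro!: derivative_eq_intros)
    then have sqrt: "((\<lambda>\<xi>. sqrt (N \<xi>)) has_real_derivative
        inverse (sqrt (N \<xi>)) / 2 * (2 * B * sin \<xi> * cos \<xi>)) (at \<xi>)"
      by (rule DERIV_chain2[where f=sqrt and g=N and x="\<xi>", OF DERIV_real_sqrt[OF N(1)]])
    have "((\<lambda>\<xi>. arcsin (sqrt (N \<xi>))) has_real_derivative inverse (cos (\<eta> \<xi>)) *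
        (inverse (sqrt (N \<xi>)) / 2 * (2 * B * sin \<xi> * cos \<xi>))) (at \<xi>)"
      by (rule DERIV_chain2[where f=arcsin and g="\<lambda>\<xi>. sqrt (N \<xi>)" and x=\<xi>, OF arcsin sqrt])
    moreover have "(\<lambda>\<xi>. arcsin (sqrt (N \<xi>))) = \<eta>" by (simp add: \<eta>_def fun_eq_iff)
    moreover have "inverse (cos (\<eta> \<xi>)) * (inverse (sqrt (N \<xi>)) / 2 * (2 * B * sin \<xi> * cos \<xi>)) =
        B * sin \<xi> * cos \<xi> / (sin (\<eta> \<xi>) * cos (\<eta> \<xi>))"
      using sN[of \<xi>] cos_eta[of \<xi>] by (simp add: sin_eta field_simps)
    ultimately show ?thesis by metis
  qed
  \<comment> \<open>The constant of proportionality: \<open>K\<close> times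
    \<open>sin \<eta> cos \<eta> + e B sin \<xi> cos \<xi>\<close> is the root of the radicand at
    \<open>\<xi> + e \<eta>\<close>.\<close>
  define K where "K = sqrt ((p + q * A) / (A * (1 - A)))"
  have K: "K > 0" "K\<^sup>2 = (p + q * A) / (A * (1 - A))" using pA A by (auto simp: K_def less_imp_le)
  have KB: "K\<^sup>2 * B = q" "K\<^sup>2 * (A * (1 - A - B)) = p"
    unfolding AB(2) K(2) using pA A by (auto simp: B_def)
  have weight: "ell_weight q p (\<xi> + e * \<eta> \<xi>) = 1 / (K * (sin (\<eta> \<xi>) * cos (\<eta> \<xi>) + e * (B * sin \<xi> * cos \<xi>)))"
    if e: "e = 1 \<or> e = -1" for e \<xi>
  proof -
    let ?R = "sin (\<eta> \<xi>) * cos (\<eta> \<xi>) + e * (B * sin \<xi> * cos \<xi>)"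
    have e2: "e\<^sup>2 = 1" using e by auto
    have se: "sin (\<xi> + e * \<eta> \<xi>) = sin \<xi> * cos (\<eta> \<xi>) + e * (cos \<xi> * sin (\<eta> \<xi>))"
      using e by (auto simp: sin_add sin_diff)
    have "?R\<^sup>2 = A * (1 - A - B) + B * (sin (\<xi> + e * \<eta> \<xi>))\<^sup>2"
      unfolding se using e2 sin_eta2[of \<xi>] sin_cos_squared_add[of \<xi>] sin_cos_squared_add[of "\<eta> \<xi>"] by algebra
    then have "(K * ?R)\<^sup>2 = K\<^sup>2 * (A * (1 - A - B)) + K\<^sup>2 * B * (sin (\<xi> + e * \<eta> \<xi>))\<^sup>2"
      unfolding power_mult_distrib by (simp only:) (simp add: algebra_simps)
    then have "(K * ?R)\<^sup>2 = p + q * (sin (\<xi> + e * \<eta> \<xi>))\<^sup>2" using KB by simp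
    moreover have "K * ?R > 0" using K bound[of \<xi>] e by (auto simp: abs_less_iff)
    ultimately show ?thesis by (metis ell_weight_def less_imp_le real_sqrt_unique)
  qed
  define G where "G \<xi> = ell 0 q p (\<xi> + \<eta> \<xi>) - ell 0 q p (\<xi> - \<eta> \<xi>)" for \<xi>
  have "(G has_real_derivative 0) (at \<xi>)" for \<xi>
  proof -
    let ?sc = "sin (\<eta> \<xi>) * cos (\<eta> \<xi>)" and ?b = "B * sin \<xi> * cos \<xi>"
    have sc: "?sc > 0" "?sc + ?b > 0" "?sc - ?b > 0"
      using bound[of \<xi>] by (auto simp: abs_less_iff)
    have "(G has_real_derivative ell_weight q p (\<xi> + \<eta> \<xi>) ^ (2 * 0 + 1) * (1 + ?b / ?sc)
        - ell_weight q p (\<xi> - \<eta> \<xi>) ^ (2 * 0 + 1) * (1 - ?b / ?sc)) (at \<xi>)"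
      unfolding G_def
      by (intro DERIV_diff DERIV_chain2[where f="ell 0 q p"] ell_has_derivative[OF D] DERIV_add eta_deriv DERIV_ident)
    moreover have "ell_weight q p (\<xi> + \<eta> \<xi>) = 1 / (K * (?sc + ?b))"
      "ell_weight q p (\<xi> - \<eta> \<xi>) = 1 / (K * (?sc - ?b))"
      using weight[of 1 \<xi>] weight[of "-1" \<xi>] by auto
    moreover have "(1 / (K * (s + b))) ^ (2 * 0 + 1) * (1 + b / s)
        - (1 / (K * (s - b))) ^ (2 * 0 + 1) * (1 - b / s) = 0"
      if "s > 0" "s + b > 0" "s - b > 0" for s b
    proof -
      have "1 + b / s = (s + b) / s" "1 - b / s = (s - b) / s" using that by (simp_all add: field_simps)
      then show ?thesis using that K by simp
    qed
    from this[OF sc] show ?thesis using calculation by (simp only:)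
  qed
  \<comment> \<open>The constant is read off at \<open>\<xi> = 0\<close>, where
    \<open>sin^2 \<eta> = A\<close>.\<close>
  then have G: "G \<xi> = 2 * ell 0 q p (arcsin (sqrt A))" for \<xi>
    using DERIV_isconst_all[of G \<xi> 0] by (simp add: G_def ell_minus[OF D] \<eta>_def N_def)
  \<comment> \<open>Since \<open>0 < \<eta> < pi / 2\<close>, the difference
    \<open>\<xi> - \<eta>\<close> is below \<open>x\<close> at the left end and above
    \<open>x\<close> at the right end.\<close>
  have "\<exists>\<xi>\<ge>x. \<xi> \<le> x + pi / 2 \<and> \<xi> - \<eta> \<xi> = x"
  proof (rule IVT')
    show "continuous_on {x..x + pi / 2} (\<lambda>\<xi>. \<xi> - \<eta> \<xi>)"
      using eta_deriv by (intro continuous_intros continuous_at_imp_continuous_on) (blast intro: DERIV_isCont)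
  qed (use eta[of x] eta[of "x + pi / 2"] in auto)
  then obtain \<xi> where "x = \<xi> - \<eta> \<xi>" by metis
  then show ?thesis using that[of \<xi> "\<eta> \<xi>"] eta sin_eta2 bound G[of \<xi>] by (simp add: G_def)
qed

section \<open>The billiard map in parametric form\<close>

definition ellipse_point :: "real \<Rightarrow> real \<Rightarrow> real \<Rightarrow> plane" where
  "ellipse_point a b t = (a * cos t, b * sin t)"

definition speed :: "real \<Rightarrow> real \<Rightarrow> real \<Rightarrow> real" where
  "speed a b t = sqrt (a\<^sup>2 * (sin t)\<^sup>2 + b\<^sup>2 * (cos t)\<^sup>2)"

lemma speed_squared: "(speed a b t)\<^sup>2 = b\<^sup>2 + (a\<^sup>2 - b\<^sup>2) * (sin t)\<^sup>2"
proof -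
  have "(speed a b t)\<^sup>2 = a\<^sup>2 * (sin t)\<^sup>2 + b\<^sup>2 * (cos t)\<^sup>2" by (simp add: speed_def)
  then show ?thesis by (simp add: cos_squared_eq algebra_simps)
qed

lemma speed_pos: "a > 0 \<Longrightarrow> b > 0 \<Longrightarrow> speed a b t > 0"
  using radicand_pos[of "b\<^sup>2" "a\<^sup>2 - b\<^sup>2" t]
  by (simp add: speed_def cos_squared_eq algebra_simps)

lemma speed_ge: "0 < b \<Longrightarrow> b \<le> a \<Longrightarrow> b \<le> speed a b t"
  unfolding speed_def
  by (rule real_le_rsqrt) (use speed_squared[of a b t] power_mono[of b a 2] in \<open>simp add: speed_def\<close>)

lemma speed_le: "0 < b \<Longrightarrow> b \<le> a \<Longrightarrow> speed a b t \<le> a"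
proof -
  assume "0 < b" "b \<le> a"
  then have "(a\<^sup>2 - b\<^sup>2) * (sin t)\<^sup>2 \<le> (a\<^sup>2 - b\<^sup>2) * 1"
    using power_mono[of b a 2] by (intro mult_left_mono) (auto simp: abs_square_le_1)
  then have "(speed a b t)\<^sup>2 \<le> a\<^sup>2" by (simp add: speed_squared)
  then show ?thesis using \<open>0 < b\<close> \<open>b \<le> a\<close> by (auto intro: power2_le_imp_le)
qed

lemma ellipse_point_in: "a > 0 \<Longrightarrow> b > 0 \<Longrightarrow> ellipse_point a b t \<in> ellipse a b"
  by (simp add: ellipse_point_def ellipse_def power_mult_distrib)

lemma ellipse_pointE:
  assumes "a > 0" "b > 0" "p \<in> ellipse a b"
  obtains t where "0 \<le> t" "t < 2 * pi" "p = ellipse_point a b t"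
proof -
  obtain x y where p: "p = (x, y)" by fastforce
  have "(x / a)\<^sup>2 + (y / b)\<^sup>2 = 1" using assms by (simp add: p ellipse_def power_divide)
  from sincos_total_2pi[OF this] obtain t where "0 \<le> t" "t < 2 * pi" "x / a = cos t" "y / b = sin t"
    by metis
  then show ?thesis using assms that[of t] by (simp add: p ellipse_point_def field_simps)
qed

lemma ellipse_point_eq_iff:
  assumes "a > 0" "b > 0"
  shows "ellipse_point a b s = ellipse_point a b t \<longleftrightarrow> (\<exists>m::int. s = t + 2 * pi * of_int m)"
proof -
  have "ellipse_point a b s = ellipse_point a b t \<longleftrightarrow> sin s = sin t \<and> cos s = cos t"
    using assms by (auto simp: ellipse_point_def)
  then show ?thesis by (auto simp: sin_cos_eq_iff)
qed

lemma ellipse_point_add_pi: "ellipse_point a b (t + pi) = - ellipse_point a b t"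
  by (simp add: ellipse_point_def)

lemma unit_tangent_ellipse_point:
  assumes "a > 0" "b > 0"
  shows "unit_tangent a b (ellipse_point a b t) = (- (a * sin t) / speed a b t, b * cos t / speed a b t)"
proof -
  have "unit_tangent a b (ellipse_point a b t) = sgn (- (a * sin t), b * cos t)"
    using assms by (simp add: unit_tangent_def ellipse_point_def)
  then show ?thesis
    by (simp add: sgn_div_norm norm_Pair speed_def power_mult_distrib divide_inverse mult.commute)
qed

lemma direction_ellipse_point:
  assumes "a > 0" "b > 0"
  shows "direction a b (ellipse_point a b t, \<theta>) =
    ((- (cos \<theta> * (a * sin t)) - sin \<theta> * (b * cos t)) / speed a b t,
     (cos \<theta> * (b * cos t) - sin \<theta> * (a * sin t)) / speed a b t)"
  using assms
  by (simp add: direction_def inward_normal_def unit_tangent_ellipse_point diff_divide_distrib)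

text \<open>Lagrange's identity for the velocity vectors of \<open>ellipse_point\<close> at
  \<open>t\<close> and \<open>s\<close>: their inner product is the right-hand side of
  \<open>cos\<close>, their determinant is \<open>a b sin (s - t)\<close>. A condition on the cosine
  thus fixes the sine, whose sign comes from \<open>0 < \<theta> < pi\<close>.\<close>

lemma chord_angle:
  assumes ab: "a > 0" "b > 0" and \<theta>: "0 < \<theta>" "\<theta> < pi" and d: "sin d \<ge> 0"
    and cos: "cos \<theta> * speed a b t * speed a b s = a\<^sup>2 * sin t * sin s + b\<^sup>2 * cos t * cos s"
    and sin: "\<bar>sin (s - t)\<bar> = sin d"
  shows "sin \<theta> * speed a b t * speed a b s = a * b * sin d"
proof (rule power2_eq_imp_eq)
  let ?n = "speed a b t" and ?m = "speed a b s"
  have n: "?n\<^sup>2 = a\<^sup>2 * (sin t)\<^sup>2 + b\<^sup>2 * (cos t)\<^sup>2" and m: "?m\<^sup>2 = a\<^sup>2 * (sin s)\<^sup>2 + b\<^sup>2 * (cos s)\<^sup>2"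
    by (simp_all add: speed_def)
  have sd: "(sin d)\<^sup>2 = (sin s * cos t - cos s * sin t)\<^sup>2"
    unfolding sin[symmetric] by (simp add: sin_diff)
  have "(sin \<theta> * ?n * ?m)\<^sup>2 = ?n\<^sup>2 * ?m\<^sup>2 - (cos \<theta> * ?n * ?m)\<^sup>2"
    using sin_cos_squared_add[of \<theta>] by algebra
  also have "\<dots> = a\<^sup>2 * b\<^sup>2 * (sin d)\<^sup>2"
    unfolding cos n m sd by algebra
  finally show "(sin \<theta> * ?n * ?m)\<^sup>2 = (a * b * sin d)\<^sup>2" by (simp add: power_mult_distrib)
  show "0 \<le> sin \<theta> * ?n * ?m" using \<theta> ab by (simp add: sin_ge_zero speed_pos less_imp_le)
  show "0 \<le> a * b * sin d" using ab d by simp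
qed

text \<open>The chord joining the parameters \<open>s - d\<close> and \<open>s + d\<close> is parallel to the tangent at \<open>s\<close>.\<close>

lemma billiard_map_chord:
  assumes ab: "a > 0" "b > 0" and d: "0 < d" "d < pi"
    and \<theta>: "0 < \<theta>" "\<theta> < pi" "0 < \<theta>'" "\<theta>' < pi"
    and cos: "cos \<theta> * speed a b (s - d) * speed a b s = a\<^sup>2 * sin (s - d) * sin s + b\<^sup>2 * cos (s - d) * cos s"
      "cos \<theta>' * speed a b (s + d) * speed a b s = a\<^sup>2 * sin (s + d) * sin s + b\<^sup>2 * cos (s + d) * cos s"
  shows "billiard_map a b (ellipse_point a b (s - d), \<theta>) = (ellipse_point a b (s + d), \<theta>')"
proof -
  let ?z = "(ellipse_point a b (s - d), \<theta>)" and ?z' = "(ellipse_point a b (s + d), \<theta>')"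
  let ?e = "(- (a * sin s) / speed a b s, b * cos s / speed a b s)"
  have sd: "sin d > 0" using d by (rule sin_gt_zero)
  note pos = speed_pos[OF ab, of s] speed_pos[OF ab, of "s - d"] speed_pos[OF ab, of "s + d"]
  have sin: "sin \<theta> * speed a b (s - d) * speed a b s = a * b * sin d"
    "sin \<theta>' * speed a b (s + d) * speed a b s = a * b * sin d"
    using sd by (intro chord_angle[OF ab] \<theta> cos; simp)+
  define t t' where tt: "t = s - d" "t' = s + d"
  have sd1: "sin d = sin s * cos t - cos s * sin t" "sin d = sin t' * cos s - cos t' * sin s"
    using sin_diff[of s t] sin_diff[of t' s] by (simp_all add: tt)
  have nt: "(speed a b x)\<^sup>2 = a\<^sup>2 * (sin x)\<^sup>2 + b\<^sup>2 * (cos x)\<^sup>2" for x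
    by (simp add: speed_def)
  have e: "direction a b ?z = ?e"
  proof -
    have "(- (cos \<theta> * (a * sin t)) - sin \<theta> * (b * cos t)) * speed a b s * speed a b t
        = - (a * sin s) * speed a b t * speed a b t"
      "(cos \<theta> * (b * cos t) - sin \<theta> * (a * sin t)) * speed a b s * speed a b t
        = b * cos s * speed a b t * speed a b t"
      using cos(1) sin(1) sd1(1) nt[of t] unfolding tt[symmetric] by algebra+
    then have "(- (cos \<theta> * (a * sin t)) - sin \<theta> * (b * cos t)) * speed a b s = - (a * sin s) * speed a b t"
      "(cos \<theta> * (b * cos t) - sin \<theta> * (a * sin t)) * speed a b s = b * cos s * speed a b t"
      using pos(2) unfolding tt[symmetric] by (metis mult_right_cancel order_less_irrefl)+
    then have "(- (cos \<theta> * (a * sin t)) - sin \<theta> * (b * cos t)) / speed a b t = - (a * sin s) / speed a b s"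
      "(cos \<theta> * (b * cos t) - sin \<theta> * (a * sin t)) / speed a b t = b * cos s / speed a b s"
      using pos(1,2) unfolding tt[symmetric] by (metis frac_eq_eq order_less_irrefl)+
    then show ?thesis
      unfolding direction_ellipse_point[OF ab] tt[symmetric] by (simp only:)
  qed
  \<comment> \<open>The chord vector is \<open>2 sin d\<close> times the velocity at
    \<open>s\<close>, and that velocity has length \<open>speed a b s\<close>.\<close>
  have "fst ?z' = fst ?z + (2 * sin d * speed a b s) *\<^sub>R ?e"
    using pos(1) by (simp add: ellipse_point_def cos_add cos_diff sin_add sin_diff algebra_simps)
  moreover have "2 * sin d * speed a b s > 0" using pos sd by simp
  ultimately have "\<exists>t>0. fst ?z' = fst ?z + t *\<^sub>R ?e" by blast
  moreover have "?z' \<in> phase_space a b"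
    unfolding phase_space_def using ellipse_point_in[OF ab] \<theta> by simp
  moreover have "direction a b ?z' = reflect (unit_tangent a b (ellipse_point a b t')) ?e"
  proof -
    \<comment> \<open>In the frame of tangent \<open>(T1, T2)\<close> and inward normal the incoming
      direction has components \<open>c\<close> and \<open>- k\<close>; reflection changes the sign
      of the second.\<close>
    define T1 T2 where T: "T1 = - (a * sin t') / speed a b t'" "T2 = b * cos t' / speed a b t'"
    define c k where c: "c = cos \<theta>'" "k = sin \<theta>'"
    have n': "speed a b t' > 0" using pos(3) by (simp add: tt)
    have "T1\<^sup>2 + T2\<^sup>2 = (speed a b t')\<^sup>2 / (speed a b t')\<^sup>2"
      by (simp add: T power_divide power_mult_distrib nt flip: add_divide_distrib)
    then have T2: "T1\<^sup>2 + T2\<^sup>2 = 1" using n' by simp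
    define e1 e2 where e12: "e1 = - (a * sin s) / speed a b s" "e2 = b * cos s / speed a b s"
    have eT: "e1 * T1 + e2 * T2 = c"
    proof -
      have "(e1 * T1 + e2 * T2) * (speed a b t' * speed a b s) = cos \<theta>' * speed a b t' * speed a b s"
        unfolding cos(2)[folded tt] using n' pos(1)
        by (simp add: T e12 field_simps power2_eq_square)
      then show ?thesis using n' pos(1) by (simp add: c)
    qed
    have eN: "e1 * T2 - e2 * T1 = k"
    proof -
      have "(e1 * T2 - e2 * T1) * (speed a b t' * speed a b s) = a * b * (sin t' * cos s - cos t' * sin s)"
        using n' pos(1) by (simp add: T e12 field_simps)
      also have "\<dots> = sin \<theta>' * speed a b t' * speed a b s" using sin(2) sd1(2) by (simp add: tt)
      finally show ?thesis using n' pos(1) by (simp add: c)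
    qed
    have "unit_tangent a b (ellipse_point a b t') = (T1, T2)"
      by (simp add: unit_tangent_ellipse_point[OF ab] T)
    moreover have "direction a b ?z' = (c * T1 - k * T2, c * T2 + k * T1)"
      unfolding tt[symmetric] direction_def inward_normal_def
      by (simp add: unit_tangent_ellipse_point[OF ab] T c)
    moreover have "e1 = c * T1 + k * T2" unfolding eT[symmetric] eN[symmetric] using T2 by algebra
    moreover have "e2 = c * T2 - k * T1" unfolding eT[symmetric] eN[symmetric] using T2 by algebra
    moreover have "reflect (T1, T2) (e1, e2) = (2 * c * T1 - e1, 2 * c * T2 - e2)"
      by (simp add: reflect_def eT)
    ultimately show ?thesis unfolding e12[symmetric] by simp
  qed
  ultimately have "billiard_step a b ?z ?z'"
    unfolding billiard_step_def e tt fst_conv by blast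
  moreover have "?z \<in> phase_space a b"
    using ellipse_point_in[OF ab] \<theta> by (simp add: phase_space_def)
  ultimately show ?thesis
    unfolding billiard_map_def by (intro the1_equality billiard_step_ex1 ab)
qed

text \<open>\<open>outer_ccw a b x lam\<close> is tangent to the confocal ellipse with semiaxes \<open>sqrt (a\<^sup>2 - lam)\<close>
  and \<open>sqrt (b\<^sup>2 - lam)\<close>, and \<open>outer_cw a b x lam\<close> is its mirror image in the major axis.\<close>

definition outer_angle :: "real \<Rightarrow> real \<Rightarrow> real \<Rightarrow> real \<Rightarrow> real" where
  "outer_angle a b x lam = arcsin (sqrt lam / speed a b x)"

definition outer_ccw :: "real \<Rightarrow> real \<Rightarrow> real \<Rightarrow> real \<Rightarrow> phase_point" where
  "outer_ccw a b x lam = (ellipse_point a b x, outer_angle a b x lam)"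

definition outer_cw :: "real \<Rightarrow> real \<Rightarrow> real \<Rightarrow> real \<Rightarrow> phase_point" where
  "outer_cw a b x lam = (ellipse_point a b (- x), pi - outer_angle a b x lam)"

lemma outer_angle:
  assumes "0 < b" "b \<le> a" "0 < lam" "lam < b\<^sup>2"
  shows "0 < outer_angle a b x lam" "outer_angle a b x lam < pi / 2"
    "sin (outer_angle a b x lam) = sqrt lam / speed a b x"
    "cos (outer_angle a b x lam) > 0"
    "0 < sqrt lam / speed a b x" "sqrt lam / speed a b x < 1"
proof -
  have n: "speed a b x \<ge> b" using assms by (intro speed_ge)
  have "sqrt lam < b" using assms real_sqrt_less_mono[of lam "b\<^sup>2"] by simp
  then show r: "0 < sqrt lam / speed a b x" "sqrt lam / speed a b x < 1" using n assms by auto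
  have m1: "- 1 \<le> sqrt lam / speed a b x" using r by linarith
  then show "sin (outer_angle a b x lam) = sqrt lam / speed a b x"
    unfolding outer_angle_def using r by (intro sin_arcsin) auto
  show 1: "0 < outer_angle a b x lam" "outer_angle a b x lam < pi / 2"
    using arcsin_less_mono[of 0 "sqrt lam / speed a b x"] arcsin_less_mono[of "sqrt lam / speed a b x" 1] r m1
    by (auto simp: outer_angle_def)
  then show "cos (outer_angle a b x lam) > 0" by (intro cos_gt_zero_pi) auto
qed

text \<open>The caustic relation \<open>sin^2 d = lam speed(s)^2 / (a^2 b^2)\<close> is linear in
  \<open>sin^2 s\<close>. It is the relation in \<open>elliptic_shift\<close> with
  \<open>A = lam / a^2\<close> and \<open>B = q A / b^2\<close>, so the midpoint parameter
  \<open>s\<close> and the half-length \<open>d\<close> serve as \<open>\<xi>\<close> and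
  \<open>\<eta>\<close>.\<close>

lemma outer_step:
  assumes ab: "0 < b" "b \<le> a" and lam: "0 < lam" "lam < b\<^sup>2"
  obtains y where
    "ell 0 (a\<^sup>2 - b\<^sup>2) (b\<^sup>2 - lam) y = ell 0 (a\<^sup>2 - b\<^sup>2) (b\<^sup>2 - lam) x
       + 2 * ell 0 (a\<^sup>2 - b\<^sup>2) (b\<^sup>2 - lam) (arcsin (sqrt lam / a))"
    "billiard_map a b (outer_ccw a b x lam) = outer_ccw a b y lam"
    "billiard_map a b (outer_cw a b x lam) = outer_cw a b y lam"
proof -
  define q p A B where qp: "q = a\<^sup>2 - b\<^sup>2" "p = b\<^sup>2 - lam" "A = lam / a\<^sup>2" "B = q * A * (1 - A) / (p + q * A)"
  have a: "a > 0" using ab by simp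
  have ba: "b\<^sup>2 \<le> a\<^sup>2" using ab by (simp add: power_mono)
  have D: "p \<in> ell_domain q" and A: "0 < A" "A < 1"
    using lam a ba by (auto simp: qp ell_domain_def)
  obtain s d where x: "x = s - d" and d: "0 < d" "d < pi / 2" "(sin d)\<^sup>2 = A + B * (sin s)\<^sup>2"
    and e: "ell 0 q p (s + d) = ell 0 q p x + 2 * ell 0 q p (arcsin (sqrt A))"
    and pos: "\<bar>B * sin s * cos s\<bar> < sin d * cos d"
    using elliptic_shift[OF D A, of x] unfolding qp(4) by metis
  have "p + q * A = b\<^sup>2 * (1 - A)" using a by (simp add: qp field_simps)
  then have B: "B = q * A / b\<^sup>2" using A by (simp add: qp(4))
  define n where "n = speed a b s"
  have n: "n > 0" "n\<^sup>2 = b\<^sup>2 + q * (sin s)\<^sup>2" using a ab by (simp_all add: n_def speed_pos speed_squared qp)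
  have sd: "lam * n\<^sup>2 = a\<^sup>2 * b\<^sup>2 * (sin d)\<^sup>2"
    unfolding d(3) B n(2) using a ab by (simp add: qp(3) field_simps)
  have sdp: "sin d > 0" using d by (intro sin_gt_zero) auto
  have sd': "sqrt lam * n = a * b * sin d"
    by (rule power2_eq_imp_eq) (use sd lam n a ab sdp in \<open>auto simp: power_mult_distrib\<close>)
  \<comment> \<open>Both end points at once, \<open>f = - 1\<close> and \<open>f = 1\<close>. The
    squares agree by algebra; the acute \<open>outer_angle\<close> and the strict bound from
    \<open>elliptic_shift\<close> make both sides nonnegative.\<close>
  have key: "cos (outer_angle a b (s + f * d) lam) * speed a b (s + f * d) * n =
      a\<^sup>2 * sin (s + f * d) * sin s + b\<^sup>2 * cos (s + f * d) * cos s" if f: "f = 1 \<or> f = - 1" for f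
  proof (rule power2_eq_imp_eq)
    let ?t = "s + f * d"
    let ?th = "outer_angle a b ?t lam" and ?m = "speed a b ?t"
    have m: "?m > 0" "?m\<^sup>2 = b\<^sup>2 + q * (sin ?t)\<^sup>2" using a ab by (simp_all add: speed_pos speed_squared qp)
    have f2: "f\<^sup>2 = 1" using f by auto
    have t: "sin ?t = sin s * cos d + f * cos s * sin d" "cos ?t = cos s * cos d - f * sin s * sin d"
      using f by (auto simp: sin_add cos_add sin_diff cos_diff)
    have "a\<^sup>2 * sin ?t * sin s + b\<^sup>2 * cos ?t * cos s = cos d * n\<^sup>2 + f * q * sin d * sin s * cos s"
      unfolding t n(2) qp(1) using sin_cos_squared_add[of s] by algebra
    moreover have "lam * \<dots> = a\<^sup>2 * b\<^sup>2 * sin d * (sin d * cos d + f * (B * sin s * cos s))"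
    proof -
      have "lam * q = a\<^sup>2 * b\<^sup>2 * B" unfolding B using a ab by (simp add: qp(3))
      then show ?thesis using sd by algebra
    qed
    moreover have "a\<^sup>2 * b\<^sup>2 * sin d * (sin d * cos d + f * (B * sin s * cos s)) > 0"
      using a ab sdp pos f by (intro mult_pos_pos) (auto simp: abs_less_iff)
    ultimately show "0 \<le> a\<^sup>2 * sin ?t * sin s + b\<^sup>2 * cos ?t * cos s"
      using lam by (metis less_imp_le zero_less_mult_pos)
    have "sin ?th * ?m = sqrt lam"
      using m outer_angle(3)[OF ab lam, of ?t] by simp
    then have "(sin ?th * ?m * n)\<^sup>2 = a\<^sup>2 * b\<^sup>2 * (sin d)\<^sup>2"
      using sd lam by (simp add: power_mult_distrib)
    then have "(cos ?th * ?m * n)\<^sup>2 = ?m\<^sup>2 * n\<^sup>2 - a\<^sup>2 * b\<^sup>2 * (sin d)\<^sup>2"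
      using sin_cos_squared_add[of ?th] by algebra
    also have "\<dots> = (a\<^sup>2 * sin ?t * sin s + b\<^sup>2 * cos ?t * cos s)\<^sup>2"
      unfolding m(2) n(2) qp(1) t using f2 sin_cos_squared_add[of s] sin_cos_squared_add[of d] by algebra
    finally show "(cos ?th * ?m * n)\<^sup>2 = (a\<^sup>2 * sin ?t * sin s + b\<^sup>2 * cos ?t * cos s)\<^sup>2" .
    show "0 \<le> cos ?th * ?m * n" using outer_angle(4)[OF ab lam, of ?t] m n by simp
  qed
  note th = outer_angle(1,2)[OF ab lam]
  have "billiard_map a b (outer_ccw a b x lam) = outer_ccw a b (s + d) lam"
    unfolding outer_ccw_def x using key[of 1] key[of "-1"] d th[of "s - d"] th[of "s + d"] a ab
    by (intro billiard_map_chord) (auto simp: n_def)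
  moreover have "billiard_map a b (outer_cw a b x lam) = outer_cw a b (s + d) lam"
  proof -
    \<comment> \<open>Read counterclockwise, the mirrored chord spans the complementary arc, with
      midpoint \<open>pi - s\<close> and half-length \<open>pi - d\<close>.\<close>
    have "ellipse_point a b (- x) = ellipse_point a b ((pi - s) - (pi - d))" by (simp add: x)
    moreover have "ellipse_point a b (- (s + d)) = ellipse_point a b ((pi - s) + (pi - d))"
      by (simp add: ellipse_point_def cos_add cos_diff sin_add sin_diff)
    moreover have "billiard_map a b (ellipse_point a b ((pi - s) - (pi - d)), pi - outer_angle a b x lam)
        = (ellipse_point a b ((pi - s) + (pi - d)), pi - outer_angle a b (s + d) lam)"
    proof (rule billiard_map_chord)
      have sp: "speed a b (pi - s) = n" "speed a b (pi - s - (pi - d)) = speed a b (s - d)"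
        "speed a b (pi - s + (pi - d)) = speed a b (s + d)"
        by (simp_all add: n_def speed_def cos_add cos_diff sin_add sin_diff) 
          (simp_all add: power2_eq_square algebra_simps)
      show "cos (pi - outer_angle a b x lam) * speed a b (pi - s - (pi - d)) * speed a b (pi - s) =
          a\<^sup>2 * sin (pi - s - (pi - d)) * sin (pi - s) + b\<^sup>2 * cos (pi - s - (pi - d)) * cos (pi - s)"
        unfolding sp using key[of "-1"] by (simp add: x cos_diff sin_diff algebra_simps)
      show "cos (pi - outer_angle a b (s + d) lam) * speed a b (pi - s + (pi - d)) * speed a b (pi - s) =
          a\<^sup>2 * sin (pi - s + (pi - d)) * sin (pi - s) + b\<^sup>2 * cos (pi - s + (pi - d)) * cos (pi - s)"
        unfolding sp using key[of 1] by (simp add: cos_add sin_add cos_diff sin_diff algebra_simps)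
    qed (use d th[of x] th[of "s + d"] a ab in auto)
    ultimately show ?thesis unfolding outer_cw_def by simp
  qed
  moreover have "sqrt A = sqrt lam / a" using a by (simp add: qp real_sqrt_divide)
  ultimately show ?thesis using that e by (simp add: qp)
qed

text \<open>Trajectories crossing the segment between the foci. On the component of the phase space
  containing the vertical two-periodic point the functions \<open>X = cos t\<close> and \<open>Y = cos \<theta> * speed / focal_dist\<close>
  are coordinates, and \<open>r\<close>, \<open>\<psi>\<close> are polar coordinates with \<open>X = r * sin \<psi>\<close>, \<open>Y = r * cos \<psi>\<close>.
  The parity of \<open>k\<close> distinguishes the two components.\<close>

definition focal_dist :: "real \<Rightarrow> real \<Rightarrow> real" where
  "focal_dist a b = sqrt (a\<^sup>2 - b\<^sup>2)"

definition inner_param :: "nat \<Rightarrow> real \<Rightarrow> real \<Rightarrow> real" where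
  "inner_param k r \<psi> = arccos (r * sin \<psi>) + real k * pi"

definition inner_orbit :: "real \<Rightarrow> real \<Rightarrow> nat \<Rightarrow> real \<Rightarrow> real \<Rightarrow> phase_point" where
  "inner_orbit a b k r \<psi> = (ellipse_point a b (inner_param k r \<psi>),
     arccos (focal_dist a b * r * cos \<psi> / speed a b (inner_param k r \<psi>)))"

lemma sin_add_nat_pi: "sin (x + real k * pi) = (-1) ^ k * sin x"
  and cos_add_nat_pi: "cos (x + real k * pi) = (-1) ^ k * cos x"
  by (simp_all add: sin_add cos_add)

lemma speed_add_nat_pi: "speed a b (x + real k * pi) = speed a b x"
  by (simp add: speed_def sin_add_nat_pi cos_add_nat_pi power_mult_distrib flip: power_mult)

text \<open>The strict bounds keep the arguments of both \<open>arccos\<close> in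
  \<open>inner_orbit\<close> in the proper range, so position and angle really encode the polar
  coordinates.\<close>

lemma inner_coords:
  assumes "0 < b" "b \<le> a" "0 \<le> r" "r < 1"
  shows "cos (inner_param k r \<psi>) = (-1) ^ k * (r * sin \<psi>)"
    and "sin (arccos (r * sin \<psi>)) > 0"
    and "(speed a b (inner_param k r \<psi>))\<^sup>2 = a\<^sup>2 - (a\<^sup>2 - b\<^sup>2) * (r * sin \<psi>)\<^sup>2"
    and "\<bar>focal_dist a b * r * cos \<psi>\<bar> < speed a b (inner_param k r \<psi>)"
    and "0 < snd (inner_orbit a b k r \<psi>)" "snd (inner_orbit a b k r \<psi>) < pi"
    and "cos (snd (inner_orbit a b k r \<psi>)) * speed a b (inner_param k r \<psi>) = focal_dist a b * r * cos \<psi>"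
proof -
  have "\<bar>r * sin \<psi>\<bar> \<le> r * 1" unfolding abs_mult using assms by (intro mult_mono) auto
  then have X: "\<bar>r * sin \<psi>\<bar> < 1" using assms by simp
  then have X': "- 1 < r * sin \<psi>" "r * sin \<psi> < 1" by auto
  then show c: "cos (inner_param k r \<psi>) = (-1) ^ k * (r * sin \<psi>)"
    by (simp add: inner_param_def cos_add_nat_pi)
  show "sin (arccos (r * sin \<psi>)) > 0"
    using X' arccos_lt_bounded[of "r * sin \<psi>"] by (intro sin_gt_zero) auto
  have a: "a > 0" using assms by simp
  show n: "(speed a b (inner_param k r \<psi>))\<^sup>2 = a\<^sup>2 - (a\<^sup>2 - b\<^sup>2) * (r * sin \<psi>)\<^sup>2"
    unfolding speed_squared sin_squared_eq c
    by (simp add: power_mult_distrib algebra_simps flip: power_mult)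
  have f: "(focal_dist a b)\<^sup>2 = a\<^sup>2 - b\<^sup>2" using assms by (simp add: focal_dist_def power_mono)
  have "(a\<^sup>2 - b\<^sup>2) * r\<^sup>2 \<le> (a\<^sup>2 - b\<^sup>2) * 1"
    using assms by (intro mult_left_mono) (auto simp: power_le_one power_mono)
  also have "\<dots> < a\<^sup>2" using assms by simp
  finally have "(focal_dist a b * r * cos \<psi>)\<^sup>2 < (speed a b (inner_param k r \<psi>))\<^sup>2"
    unfolding n power_mult_distrib f by (simp add: cos_squared_eq algebra_simps)
  then have "\<bar>focal_dist a b * r * cos \<psi>\<bar>\<^sup>2 < (speed a b (inner_param k r \<psi>))\<^sup>2" by simp
  then show l: "\<bar>focal_dist a b * r * cos \<psi>\<bar> < speed a b (inner_param k r \<psi>)"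
    by (rule power2_less_imp_less) (use a assms speed_pos less_imp_le in blast)
  define z where "z = focal_dist a b * r * cos \<psi> / speed a b (inner_param k r \<psi>)"
  have "speed a b (inner_param k r \<psi>) > 0" using a assms by (simp add: speed_pos)
  then have z: "- 1 < z" "z < 1" using l by (auto simp: z_def abs_less_iff field_simps)
  then show "0 < snd (inner_orbit a b k r \<psi>)" "snd (inner_orbit a b k r \<psi>) < pi"
    using arccos_lt_bounded[of z] by (auto simp: inner_orbit_def z_def)
  show "cos (snd (inner_orbit a b k r \<psi>)) * speed a b (inner_param k r \<psi>) = focal_dist a b * r * cos \<psi>"
    using z \<open>speed a b (inner_param k r \<psi>) > 0\<close> by (simp add: inner_orbit_def z_def)
qed

text \<open>Unlike in \<open>outer_step\<close>, \<open>\<xi>\<close> and \<open>\<eta>\<close> are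
  not midpoint and half-length. Comparing terms in
  \<open>cos (s - d) = r sin (\<xi> - \<eta>)\<close> and
  \<open>- cos (s + d) = r sin (\<xi> + \<eta>)\<close> gives
  \<open>sin s sin d = r sin \<xi> cos \<eta>\<close> and
  \<open>cos s cos d = - r cos \<xi> sin \<eta>\<close>, solved by
  \<open>sin s = b r sin \<xi> / \<mu>\<close> and \<open>cos d = c r cos \<xi> / a\<close>.\<close>

lemma inner_step:
  assumes ab: "0 < b" "b < a" and r: "0 < r" "r < 1"
  obtains y where
    "ell 0 (- r\<^sup>2) 1 y = ell 0 (- r\<^sup>2) 1 x + 2 * ell 0 (- r\<^sup>2) 1 (arcsin (focal_dist a b / a))"
    "billiard_map a b (inner_orbit a b k r x) = inner_orbit a b (Suc k) r y"
proof -
  have a: "a > 0" using ab by simp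
  define c where "c = focal_dist a b"
  have c: "c > 0" "c\<^sup>2 = a\<^sup>2 - b\<^sup>2" using ab by (auto simp: c_def focal_dist_def power_strict_mono power_mono)
  have r2: "r\<^sup>2 < 1" using r by (simp add: power_less_one_iff)
  have D: "1 \<in> ell_domain (- r\<^sup>2)" using r2 by (simp add: ell_domain_def)
  have A: "0 < (c / a)\<^sup>2" "(c / a)\<^sup>2 < 1"
    using a c ab by (simp, simp add: power_divide)
  \<comment> \<open>\<open>\<mu>\<^sup>2\<close> is the caustic parameter of the level
    \<open>r\<close>.\<close>
  define \<mu> where "\<mu> = sqrt (a\<^sup>2 - c\<^sup>2 * r\<^sup>2)"
  have "c\<^sup>2 * r\<^sup>2 < c\<^sup>2" using mult_strict_left_mono[OF r2, of "c\<^sup>2"] c(1) by simp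
  then have \<mu>b: "a\<^sup>2 - c\<^sup>2 * r\<^sup>2 > b\<^sup>2" using c by linarith
  then have \<mu>2: "\<mu>\<^sup>2 = a\<^sup>2 - c\<^sup>2 * r\<^sup>2" using zero_le_power2[of b] unfolding \<mu>_def by (intro real_sqrt_pow2) linarith
  have \<mu>: "\<mu> > b" unfolding \<mu>_def using \<mu>b ab by (intro real_less_rsqrt) auto
  then have \<mu>0: "\<mu> > 0" using ab by simp
  obtain \<xi> \<eta> where x: "x = \<xi> - \<eta>" and \<eta>: "0 < \<eta>" "\<eta> < pi / 2"
    and sin2: "(sin \<eta>)\<^sup>2 = (c / a)\<^sup>2 + (- r\<^sup>2 * (c / a)\<^sup>2 * (1 - (c / a)\<^sup>2) / (1 + - r\<^sup>2 * (c / a)\<^sup>2)) * (sin \<xi>)\<^sup>2"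
    and e: "ell 0 (- r\<^sup>2) 1 (\<xi> + \<eta>) = ell 0 (- r\<^sup>2) 1 x + 2 * ell 0 (- r\<^sup>2) 1 (arcsin (sqrt ((c / a)\<^sup>2)))"
    by (rule elliptic_shift[OF D A, of x])
  define S where "S = b * r / \<mu> * sin \<xi>"
  define D where "D = c * r / a * cos \<xi>"
  have "b * r / \<mu> < 1" using \<mu> \<mu>0 r ab mult_strict_mono[of b \<mu> r 1] by simp
  moreover have "\<bar>S\<bar> \<le> b * r / \<mu> * 1"
    unfolding S_def abs_mult using \<mu>0 r ab by (intro mult_mono) auto
  ultimately have S1: "\<bar>S\<bar> < 1" by simp
  have ca: "c / a < 1" using A c a by (simp add: power2_less_imp_less power_divide)
  then have "c * r / a < 1" using r c a mult_strict_mono[of "c / a" 1 r 1] by simp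
  moreover have "\<bar>D\<bar> \<le> c * r / a * 1"
    unfolding D_def abs_mult using c r a by (intro mult_mono) auto
  ultimately have D1: "\<bar>D\<bar> < 1" by simp
  \<comment> \<open>The branch with \<open>cos s < 0\<close> makes the velocity at \<open>s\<close>
    point downwards, from the upper island to the lower one; adding \<open>k pi\<close> later
    performs \<open>k\<close> half turns.\<close>
  define s d where "s = pi - arcsin S" "d = arccos D"
  have sin_s: "sin s = S" and cos_s: "cos s = - sqrt (1 - S\<^sup>2)"
    using S1 by (auto simp: s_d_def cos_arcsin abs_less_iff)
  have d: "0 < d" "d < pi" "cos d = D" using D1 arccos_lt_bounded[of D] by (auto simp: s_d_def abs_less_iff)
  have sd: "sin d > 0" using d by (intro sin_gt_zero)
  have S2: "1 - S\<^sup>2 > 0" using S1 by (simp add: abs_square_less_1)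
  then have cs: "cos s < 0" by (simp add: cos_s)
  have s: "pi / 2 < s" "s < 3 * pi / 2" 
    using arcsin_lt_bounded[of S] S1 by (auto simp: s_d_def abs_less_iff)
  have eq1: "b\<^sup>2 * r\<^sup>2 * (sin \<xi>)\<^sup>2 = \<mu>\<^sup>2 * S\<^sup>2" using \<mu>0 by (simp add: S_def power_mult_distrib power_divide)
  have eq2: "c\<^sup>2 * r\<^sup>2 * (cos \<xi>)\<^sup>2 = a\<^sup>2 * D\<^sup>2" using a by (simp add: D_def power_mult_distrib power_divide)
  have sin\<eta>2: "(sin \<eta>)\<^sup>2 = (c / a)\<^sup>2 * (1 - S\<^sup>2)"
  proof -
    have 1: "(1 - (c / a)\<^sup>2) = b\<^sup>2 / a\<^sup>2" "1 + - r\<^sup>2 * (c / a)\<^sup>2 = \<mu>\<^sup>2 / a\<^sup>2"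
      using a by (simp_all add: power_divide \<mu>2 field_simps c(2))
    have "- r\<^sup>2 * K * (b\<^sup>2 / a\<^sup>2) / (\<mu>\<^sup>2 / a\<^sup>2) = - (K * (b\<^sup>2 * r\<^sup>2 / \<mu>\<^sup>2))" for K
      using a by simp
    from this[of "(c / a)\<^sup>2"] have "(sin \<eta>)\<^sup>2 = (c / a)\<^sup>2 - (c / a)\<^sup>2 * (b\<^sup>2 * r\<^sup>2 * (sin \<xi>)\<^sup>2 / \<mu>\<^sup>2)"
      using sin2[unfolded 1] by simp
    moreover have "b\<^sup>2 * r\<^sup>2 * (sin \<xi>)\<^sup>2 / \<mu>\<^sup>2 = S\<^sup>2" using \<mu>0 unfolding eq1 by simp
    ultimately show ?thesis by (simp add: right_diff_distrib)
  qed
  have sin\<eta>: "sin \<eta> = - (c / a) * cos s"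
  proof (rule power2_eq_imp_eq)
    show "(sin \<eta>)\<^sup>2 = (- (c / a) * cos s)\<^sup>2" unfolding sin\<eta>2 cos_s using S2 by (simp add: power_mult_distrib power_divide)
    show "0 \<le> sin \<eta>" using \<eta> by (intro sin_ge_zero) auto
    show "0 \<le> - (c / a) * cos s" using c a cs by (intro mult_nonpos_nonpos) auto
  qed
  have cos\<eta>: "cos \<eta> = b / \<mu> * sin d"
  proof (rule power2_eq_imp_eq)
    have "a\<^sup>2 * \<mu>\<^sup>2 * (cos \<eta>)\<^sup>2 = a\<^sup>2 * \<mu>\<^sup>2 - c\<^sup>2 * \<mu>\<^sup>2 + c\<^sup>2 * (\<mu>\<^sup>2 * S\<^sup>2)"
      unfolding cos_squared_eq sin\<eta>2 using a by (simp add: power_divide field_simps)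
    also have "\<dots> = a\<^sup>2 * (b\<^sup>2 * (sin d)\<^sup>2)"
      unfolding sin_squared_eq d(3) eq1[symmetric]
      using eq2 \<mu>2 c(2) sin_cos_squared_add[of \<xi>] by algebra
    finally show "(cos \<eta>)\<^sup>2 = (b / \<mu> * sin d)\<^sup>2"
      using a \<mu>0 by (simp add: power_mult_distrib power_divide field_simps)
    show "0 \<le> cos \<eta>" using \<eta> by (intro cos_ge_zero) auto
    show "0 \<le> b / \<mu> * sin d" using ab \<mu>0 sd by simp
  qed
  have rs: "r * sin \<xi> * b = \<mu> * S" "c * r * cos \<xi> = a * D" using \<mu>0 a by (auto simp: S_def D_def)
  have rsin: "r * sin \<xi> * cos \<eta> = S * sin d" "r * cos \<xi> * sin \<eta> = - (D * cos s)"
    using rs \<mu>0 a by (simp_all add: cos\<eta> sin\<eta> field_simps)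
  have X0: "cos (s - d) = r * sin x" and X1: "- cos (s + d) = r * sin (\<xi> + \<eta>)"
    using rsin d(3) by (simp_all add: x cos_diff cos_add sin_diff sin_add sin_s algebra_simps)
  \<comment> \<open>\<open>(1 - S^2) (1 - D^2) - S^2 D^2 = 1 - S^2 - D^2\<close>, so
    \<open>S^2 + D^2 < 1\<close> suffices. The bound puts the ends of the chord on opposite sides of
    the major axis, which selects the branch of \<open>arccos\<close> in \<open>t0\<close> and
    \<open>t1\<close>.\<close>
  have key: "\<bar>S * D\<bar> < - cos s * sin d"
  proof -
    have "S\<^sup>2 + D\<^sup>2 < 1"
    proof -
      have "S\<^sup>2 \<le> r\<^sup>2 * (sin \<xi>)\<^sup>2"
      proof -
        have "b\<^sup>2 * (r\<^sup>2 * (sin \<xi>)\<^sup>2) \<le> \<mu>\<^sup>2 * (r\<^sup>2 * (sin \<xi>)\<^sup>2)"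
          using \<mu> ab by (intro mult_right_mono power_mono) auto
        then have "\<mu>\<^sup>2 * S\<^sup>2 \<le> \<mu>\<^sup>2 * (r\<^sup>2 * (sin \<xi>)\<^sup>2)" using eq1 by (simp add: mult.assoc)
        then show ?thesis using \<mu>0 by simp
      qed
      moreover have "D\<^sup>2 \<le> r\<^sup>2 * (cos \<xi>)\<^sup>2"
      proof -
        have "a\<^sup>2 * D\<^sup>2 \<le> a\<^sup>2 * (r\<^sup>2 * (cos \<xi>)\<^sup>2)"
          unfolding eq2[symmetric] c(2) mult.assoc by (intro mult_right_mono) auto
        then show ?thesis using a by simp
      qed
      moreover have "r\<^sup>2 * (sin \<xi>)\<^sup>2 + r\<^sup>2 * (cos \<xi>)\<^sup>2 = r\<^sup>2" by (simp flip: distrib_left)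
      ultimately show ?thesis using r2 by linarith
    qed
    then have "\<bar>S * D\<bar>\<^sup>2 < (- cos s * sin d)\<^sup>2"
      using sin_cos_squared_add[of s] sin_cos_squared_add[of d]
      by (simp add: power_mult_distrib cos_squared_eq[of s] sin_squared_eq[of d] sin_s d(3) algebra_simps)
    then show ?thesis by (rule power2_less_imp_less) (use cs sd in \<open>simp add: mult_nonpos_nonneg\<close>)
  qed
  have sin_t0: "sin (s - d) > 0" and sin_t1: "sin (s + d) < 0"
    using key d(3) by (simp_all add: sin_diff sin_add sin_s abs_less_iff algebra_simps)
  have t0: "arccos (r * sin x) = s - d"
  proof -
    have "0 < s - d"
      using sin_t0 sin_ge_zero[of "d - s"] s d sin_minus[of "s - d"] by (cases "s \<le> d") auto
    moreover have "s - d < pi"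
      using sin_t0 sin_le_zero[of "s - d"] s d by (cases "s - d \<ge> pi") auto
    ultimately show ?thesis unfolding X0[symmetric] by (intro arccos_cos) auto
  qed
  have t1: "arccos (r * sin (\<xi> + \<eta>)) = s + d - pi"
  proof -
    have "pi < s + d" using sin_t1 sin_ge_zero[of "s + d"] s d by (cases "s + d \<le> pi") auto
    moreover have "s + d < 2 * pi"
      using sin_t1 sin_ge_zero[of "s + d - 2 * pi"] s d by (cases "s + d \<ge> 2 * pi") (auto simp: sin_diff)
    ultimately have "arccos (cos (s + d - pi)) = s + d - pi" by (intro arccos_cos) linarith+
    moreover have "r * sin (\<xi> + \<eta>) = cos (s + d - pi)" by (simp flip: X1 add: cos_diff)
    ultimately show ?thesis by (simp only:)
  qed
  define n where "n = speed a b s"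
  have n0: "n > 0" using a ab by (simp add: n_def speed_pos)
  have n2: "n\<^sup>2 = b\<^sup>2 + c\<^sup>2 * S\<^sup>2" by (simp add: n_def speed_squared sin_s c(2))
  \<comment> \<open>The caustic relation of \<open>outer_step\<close> again, now with
    \<open>\<mu>\<close> as the root of the caustic parameter.\<close>
  have n: "n * \<mu> = a * b * sin d"
  proof (rule power2_eq_imp_eq)
    have "b\<^sup>2 * (a\<^sup>2 * (sin d)\<^sup>2) = b\<^sup>2 * \<mu>\<^sup>2 + c\<^sup>2 * (\<mu>\<^sup>2 * S\<^sup>2)"
      unfolding sin_squared_eq d(3) eq1[symmetric] using eq2 \<mu>2 c(2) sin_cos_squared_add[of \<xi>] by algebra
    then show "(n * \<mu>)\<^sup>2 = (a * b * sin d)\<^sup>2"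
      by (simp add: power_mult_distrib n2 algebra_simps)
  qed (use n0 \<mu>0 a ab sd in auto)
  have ncos: "c * (r * cos \<xi> * cos \<eta>) * n = D * n\<^sup>2" "c * (r * sin \<xi> * sin \<eta>) * n = - (c\<^sup>2 * S * cos s * sin d)"
  proof -
    have "c * (r * cos \<xi> * cos \<eta>) * n = (c * r * cos \<xi>) * (b / \<mu> * sin d) * n" by (simp add: cos\<eta>)
    also have "\<dots> = D * n * (a * b * sin d / \<mu>)" by (simp add: rs(2))
    also have "a * b * sin d / \<mu> = n" using n \<mu>0 by (simp add: field_simps)
    finally show "c * (r * cos \<xi> * cos \<eta>) * n = D * n\<^sup>2" by (simp only: power2_eq_square mult.assoc)
    have "c * (r * sin \<xi> * sin \<eta>) * n * (a * b) = - (c\<^sup>2 * (r * sin \<xi> * b) * cos s * n)"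
      using a by (simp add: sin\<eta> power2_eq_square)
    also have "\<dots> = - (c\<^sup>2 * S * cos s * sin d) * (a * b)" 
      unfolding rs(1) using n by (simp add: algebra_simps)
    finally have ab_eq: "c * (r * sin \<xi> * sin \<eta>) * n * (a * b) = - (c\<^sup>2 * S * cos s * sin d) * (a * b)" .
    have "a * b \<noteq> 0" using a ab by simp
    from iffD1[OF mult_right_cancel[OF this] ab_eq]
    show "c * (r * sin \<xi> * sin \<eta>) * n = - (c\<^sup>2 * S * cos s * sin d)" .
  qed
  have a2: "a\<^sup>2 = b\<^sup>2 + c\<^sup>2" using c by simp
  have R0: "c * r * cos x * n = a\<^sup>2 * sin (s - d) * sin s + b\<^sup>2 * cos (s - d) * cos s"
  proof -
    have "c * r * cos x * n = D * n\<^sup>2 - c\<^sup>2 * S * cos s * sin d"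
      unfolding x cos_diff using ncos by algebra
    also have "\<dots> = a\<^sup>2 * sin (s - d) * sin s + b\<^sup>2 * cos (s - d) * cos s"
      unfolding sin_diff cos_diff sin_s d(3) n2 a2 using sin_cos_squared_add[of s, unfolded sin_s] by algebra
    finally show ?thesis .
  qed
  have R1: "c * r * cos (\<xi> + \<eta>) * n = a\<^sup>2 * sin (s + d) * sin s + b\<^sup>2 * cos (s + d) * cos s"
  proof -
    have "c * r * cos (\<xi> + \<eta>) * n = D * n\<^sup>2 + c\<^sup>2 * S * cos s * sin d"
      unfolding cos_add using ncos by algebra
    also have "\<dots> = a\<^sup>2 * sin (s + d) * sin s + b\<^sup>2 * cos (s + d) * cos s"
      unfolding sin_add cos_add sin_s d(3) n2 a2 using sin_cos_squared_add[of s, unfolded sin_s] by algebra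
    finally show ?thesis .
  qed
  have p0: "inner_param k r x = s + real k * pi - d" and p1: "inner_param (Suc k) r (\<xi> + \<eta>) = s + real k * pi + d"
    unfolding inner_param_def t0 t1 by (simp_all add: distrib_right)
  note ic = inner_coords[OF ab(1) less_imp_le[OF ab(2)] less_imp_le[OF r(1)] r(2), folded c_def]
  have "billiard_map a b (ellipse_point a b (s + real k * pi - d), snd (inner_orbit a b k r x)) =
      (ellipse_point a b (s + real k * pi + d), snd (inner_orbit a b (Suc k) r (\<xi> + \<eta>)))"
  proof (rule billiard_map_chord[OF a ab(1) d(1,2)])
    have sh: "s + real k * pi - d = s - d + real k * pi" "s + real k * pi + d = s + d + real k * pi" by simp_all
    have sq: "u * ((-1) ^ k * v) * ((-1) ^ k * w) = u * v * w" for u v w :: real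
      by (cases "even k") auto
    show "cos (snd (inner_orbit a b k r x)) * speed a b (s + real k * pi - d) * speed a b (s + real k * pi) =
        a\<^sup>2 * sin (s + real k * pi - d) * sin (s + real k * pi) + b\<^sup>2 * cos (s + real k * pi - d) * cos (s + real k * pi)"
      using ic(7)[of k x, unfolded p0] R0
      unfolding sh speed_add_nat_pi sin_add_nat_pi cos_add_nat_pi n_def sq by simp
    show "cos (snd (inner_orbit a b (Suc k) r (\<xi> + \<eta>))) * speed a b (s + real k * pi + d) * speed a b (s + real k * pi) =
        a\<^sup>2 * sin (s + real k * pi + d) * sin (s + real k * pi) + b\<^sup>2 * cos (s + real k * pi + d) * cos (s + real k * pi)"
      using ic(7)[of "Suc k" "\<xi> + \<eta>", unfolded p1] R1
      unfolding sh speed_add_nat_pi sin_add_nat_pi cos_add_nat_pi n_def sq by simp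
  qed (use ic in auto)
  moreover have "inner_orbit a b k r x = (ellipse_point a b (s + real k * pi - d), snd (inner_orbit a b k r x))"
    "inner_orbit a b (Suc k) r (\<xi> + \<eta>) = (ellipse_point a b (s + real k * pi + d), snd (inner_orbit a b (Suc k) r (\<xi> + \<eta>)))"
    by (simp_all add: inner_orbit_def p0 p1)
  ultimately have "billiard_map a b (inner_orbit a b k r x) = inner_orbit a b (Suc k) r (\<xi> + \<eta>)" by metis
  then show ?thesis using that e c a by (simp add: real_sqrt_divide c_def)
qed

section \<open>Action-angle coordinates near the boundary\<close>

text \<open>The parameter \<open>\<lambda>\<close> of the confocal conic tangent to the trajectory.\<close>

definition caustic :: "real \<Rightarrow> real \<Rightarrow> phase_point \<Rightarrow> real" where
  "caustic a b z = (sin (snd z))\<^sup>2 * ((a / b * snd (fst z))\<^sup>2 + (b / a * fst (fst z))\<^sup>2)"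

lemma caustic_ellipse_point:
  "a > 0 \<Longrightarrow> b > 0 \<Longrightarrow> caustic a b (ellipse_point a b t, \<theta>) = (sin \<theta>)\<^sup>2 * (speed a b t)\<^sup>2"
  by (simp add: caustic_def ellipse_point_def speed_def power_mult_distrib)

lemma continuous_on_caustic: "continuous_on A (caustic a b)"
  unfolding caustic_def by (intro continuous_intros)

lemma smooth_caustic: "open U \<Longrightarrow> smooth U (caustic a b)"
  unfolding caustic_def by (intro smooth_intros) auto

lemma outer_ccw_in:
  assumes "0 < b" "b \<le> a" "0 < lam" "lam < b\<^sup>2"
  shows "outer_ccw a b t lam \<in> phase_space a b" "snd (outer_ccw a b t lam) < pi / 2"
    "caustic a b (outer_ccw a b t lam) = lam"
proof -
  note o = outer_angle[OF assms, of t]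
  have a: "a > 0" using assms by simp
  show "outer_ccw a b t lam \<in> phase_space a b" "snd (outer_ccw a b t lam) < pi / 2"
    using o a assms by (auto simp: outer_ccw_def phase_space_def ellipse_point_in)
  have "speed a b t > 0" using a assms by (simp add: speed_pos)
  then show "caustic a b (outer_ccw a b t lam) = lam"
    unfolding outer_ccw_def using a assms o(3)
    by (simp add: caustic_ellipse_point power_divide)
qed

lemma outer_angle_unique:
  assumes "a > 0" "b > 0" "0 < \<theta>" "\<theta> < pi / 2" "lam = (sin \<theta>)\<^sup>2 * (speed a b t)\<^sup>2"
  shows "outer_angle a b t lam = \<theta>"
proof -
  have "sin \<theta> > 0" using assms by (intro sin_gt_zero) auto
  moreover have "speed a b t > 0" using assms by (simp add: speed_pos)
  ultimately have "sqrt lam / speed a b t = sin \<theta>"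
    using assms by (simp add: real_sqrt_mult)
  then show ?thesis using assms by (simp add: outer_angle_def arcsin_sin)
qed

lemma outer_ccw_surj:
  assumes "a > 0" "b > 0" "z \<in> phase_space a b" "snd z < pi / 2"
  obtains t where "z = outer_ccw a b t (caustic a b z)"
proof -
  obtain p \<theta> where z: "z = (p, \<theta>)" by fastforce
  obtain t where t: "p = ellipse_point a b t"
    using assms by (auto simp: z phase_space_def elim: ellipse_pointE)
  have "outer_angle a b t (caustic a b z) = \<theta>"
    using assms by (intro outer_angle_unique) (auto simp: z t phase_space_def caustic_ellipse_point)
  then show ?thesis using that[of t] by (simp add: outer_ccw_def z t)
qed

lemma outer_ccw_eq_iff:
  assumes "0 < b" "b \<le> a" "0 < lam" "lam < b\<^sup>2" "0 < lam'" "lam' < b\<^sup>2"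
  shows "outer_ccw a b s lam = outer_ccw a b t lam' \<longleftrightarrow>
    lam = lam' \<and> (\<exists>m::int. s = t + 2 * pi * of_int m)"
proof
  assume e: "outer_ccw a b s lam = outer_ccw a b t lam'"
  then have "lam = lam'" using outer_ccw_in(3) assms by metis
  then show "lam = lam' \<and> (\<exists>m::int. s = t + 2 * pi * of_int m)"
    using e assms by (simp add: outer_ccw_def ellipse_point_eq_iff)
next
  assume r: "lam = lam' \<and> (\<exists>m::int. s = t + 2 * pi * of_int m)"
  then have "ellipse_point a b s = ellipse_point a b t" using assms by (subst ellipse_point_eq_iff) auto
  moreover from this have "speed a b s = speed a b t"
    using assms by (auto simp: speed_def ellipse_point_def)
  ultimately show "outer_ccw a b s lam = outer_ccw a b t lam'"
    using r by (simp add: outer_ccw_def outer_angle_def)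
qed

lemma smooth_outer_ccw:
  assumes "0 < b" "b \<le> a"
  shows "smooth (UNIV \<times> {0<..<b\<^sup>2}) (\<lambda>(t, lam). outer_ccw a b t lam)"
proof -
  let ?U = "(UNIV :: real set) \<times> {0<..<b\<^sup>2}"
  have oU: "open ?U" by (intro open_Times) auto
  have a: "a > 0" using assms by simp
  have "smooth ?U (\<lambda>z. speed a b (fst z))"
    unfolding speed_def
  proof (intro smooth_compose[OF smooth_sqrt] smooth_intros oU)
    fix z :: "real \<times> real"
    show "a\<^sup>2 * (sin (fst z))\<^sup>2 + b\<^sup>2 * (cos (fst z))\<^sup>2 \<in> {0<..}"
      using speed_pos[OF a assms(1), of "fst z"] by (simp add: speed_def)
  qed auto
  moreover have "smooth ?U (\<lambda>z. sqrt (snd z))"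
    by (intro smooth_compose[OF smooth_sqrt] smooth_intros oU) auto
  moreover have "speed a b t \<noteq> 0" for t using speed_pos[OF a assms(1), of t] by simp
  ultimately have "smooth ?U (\<lambda>z. sqrt (snd z) / speed a b (fst z))"
    by (intro smooth_divide) auto
  then have "smooth ?U (\<lambda>z. outer_angle a b (fst z) (snd z))"
    unfolding outer_angle_def
    by (rule smooth_compose[OF smooth_arcsin]) 
      (use outer_angle(5,6)[OF assms] in \<open>force intro: less_trans[of "-1" 0]\<close>)
  then show ?thesis
    unfolding outer_ccw_def ellipse_point_def case_prod_unfold
    by (intro smooth_intros oU) auto
qed

definition outer_ell :: "real \<Rightarrow> real \<Rightarrow> nat \<Rightarrow> real \<Rightarrow> real \<Rightarrow> real" where
  "outer_ell a b j lam = ell j (a\<^sup>2 - b\<^sup>2) (b\<^sup>2 - lam)"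

lemma outer_domain: "0 < b \<Longrightarrow> b \<le> a \<Longrightarrow> lam < b\<^sup>2 \<Longrightarrow> b\<^sup>2 - lam \<in> ell_domain (a\<^sup>2 - b\<^sup>2)"
  unfolding ell_domain_def mem_Collect_eq
  by (intro conjI) (use power_mono[of b a 2] in linarith)+

lemma smooth_outer_ell:
  assumes "0 < b" "b \<le> a" "smooth U f" "smooth U g" "\<And>x. x \<in> U \<Longrightarrow> f x < b\<^sup>2"
  shows "smooth U (\<lambda>x. outer_ell a b j (f x) (g x))"
proof -
  have "smooth U (\<lambda>x. (b\<^sup>2 - f x, g x))" using assms by (intro smooth_intros) (auto dest: smooth_open)
  from smooth_compose[OF smooth_ell this, of "a\<^sup>2 - b\<^sup>2" j] assms outer_domain show ?thesis
    by (simp add: outer_ell_def)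
qed

text \<open>The angle coordinate of a phase point vanishes on the fibre over \<open>p_star a b\<close>.\<close>

definition base_param :: "real \<Rightarrow> real \<Rightarrow> real" where
  "base_param a b = - arctan (1 - (eccentricity a b)\<^sup>2)"

lemma p_star_eq: "p_star a b = ellipse_point a b (base_param a b)"
  by (simp add: p_star_def ellipse_point_def base_param_def)

definition angle :: "real \<Rightarrow> real \<Rightarrow> real \<Rightarrow> real \<Rightarrow> real" where
  "angle a b lam t = pi * (outer_ell a b 0 lam t - outer_ell a b 0 lam (base_param a b)) / outer_ell a b 0 lam pi"

text \<open>The advance of \<open>angle\<close> in one bounce, that is, \<open>2 pi\<close> times
  the rotation number. The limit \<open>arcsin (sqrt lam / a)\<close> is the half-length of the
  chord centred at parameter 0, where \<open>speed\<close> equals \<open>b\<close>.\<close>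

definition rotation :: "real \<Rightarrow> real \<Rightarrow> real \<Rightarrow> real" where
  "rotation a b lam = 2 * pi * outer_ell a b 0 lam (arcsin (sqrt lam / a)) / outer_ell a b 0 lam pi"

section \<open>Angle and rotation as functions of the caustic parameter\<close>

context
  fixes a b :: real
  assumes ab: "0 < b" "b \<le> a"
begin

lemma a_pos: "0 < a" using ab by simp

lemma outer_ell_pos: "lam < b\<^sup>2 \<Longrightarrow> x > 0 \<Longrightarrow> outer_ell a b j lam x > 0"
  unfolding outer_ell_def by (intro ell_pos outer_domain ab)

lemma angle_eq_iff: "lam < b\<^sup>2 \<Longrightarrow> angle a b lam s = angle a b lam t \<longleftrightarrow> s = t"
  using outer_ell_pos[of lam pi 0] ell_eq_iff[OF outer_domain[OF ab]]
  by (auto simp: angle_def outer_ell_def)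

lemma angle_add_of_int_pi:
  "lam < b\<^sup>2 \<Longrightarrow> angle a b lam (t + of_int m * pi) = angle a b lam t + of_int m * pi"
  using outer_ell_pos[of lam pi 0] ell_add_of_int_pi[OF outer_domain[OF ab]]
  by (simp add: angle_def outer_ell_def field_simps)

lemma angle_base: "angle a b lam (base_param a b) = 0"
  by (simp add: angle_def)

lemma angle_surj:
  assumes "lam < b\<^sup>2" obtains t where "angle a b lam t = u"
proof -
  obtain t where "outer_ell a b 0 lam t = u * outer_ell a b 0 lam pi / pi + outer_ell a b 0 lam (base_param a b)"
    using bij_ell[OF outer_domain[OF ab assms]] unfolding outer_ell_def by (metis bij_pointE)
  then have "angle a b lam t = u" using outer_ell_pos[of lam pi 0] assms by (simp add: angle_def)
  then show ?thesis using that by blast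
qed

lemma billiard_map_outer_ccw:
  assumes "0 < lam" "lam < b\<^sup>2" "angle a b lam s = angle a b lam t + rotation a b lam"
  shows "billiard_map a b (outer_ccw a b t lam) = outer_ccw a b s lam"
    and "billiard_map a b (outer_cw a b t lam) = outer_cw a b s lam"
proof -
  obtain y where y: "outer_ell a b 0 lam y = outer_ell a b 0 lam t + 2 * outer_ell a b 0 lam (arcsin (sqrt lam / a))"
    "billiard_map a b (outer_ccw a b t lam) = outer_ccw a b y lam"
    "billiard_map a b (outer_cw a b t lam) = outer_cw a b y lam"
    using outer_step[OF ab assms(1,2)] unfolding outer_ell_def by metis
  have "angle a b lam y = angle a b lam t + rotation a b lam"
    unfolding angle_def rotation_def y(1) by (simp add: algebra_simps flip: add_divide_distrib)
  then have "y = s" using assms angle_eq_iff by metis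
  then show "billiard_map a b (outer_ccw a b t lam) = outer_ccw a b s lam"
    "billiard_map a b (outer_cw a b t lam) = outer_cw a b s lam" using y by simp_all
qed

lemma smooth_angle: "smooth (UNIV \<times> {..<b\<^sup>2}) (\<lambda>z. angle a b (snd z) (fst z))"
proof -
  have o: "open ((UNIV :: real set) \<times> {..<b\<^sup>2})" by (intro open_Times) auto
  have "outer_ell a b 0 lam pi \<noteq> 0" if "lam < b\<^sup>2" for lam
    using outer_ell_pos[OF that, of pi 0] by simp
  then show ?thesis
    unfolding angle_def by (intro smooth_divide smooth_outer_ell smooth_intros o ab) auto
qed

lemma angle_has_derivative:
  assumes "lam < b\<^sup>2"
  shows "(angle a b lam has_real_derivative
    pi * ell_weight (a\<^sup>2 - b\<^sup>2) (b\<^sup>2 - lam) t / outer_ell a b 0 lam pi) (at t)"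
  using outer_ell_pos[OF assms, of pi 0] ell_has_derivative[OF outer_domain[OF ab assms], of 0]
  unfolding angle_def[abs_def] outer_ell_def
  by (auto intro!: derivative_eq_intros)

text \<open>Carrying \<open>lam\<close> along makes this the inverse of a self-map of a plane
  region, so the inverse function argument gives smoothness in both variables jointly.\<close>

definition angle_inv :: "real \<times> real \<Rightarrow> real \<times> real" where
  "angle_inv z = (inv (angle a b (snd z)) (fst z), snd z)"

lemma angle_angle_inv: "snd z < b\<^sup>2 \<Longrightarrow> angle a b (snd z) (fst (angle_inv z)) = fst z"
  unfolding angle_inv_def fst_conv by (metis angle_surj f_inv_into_f rangeI)

lemma angle_inv_angle: "lam < b\<^sup>2 \<Longrightarrow> angle_inv (angle a b lam t, lam) = (t, lam)"
  using angle_angle_inv[of "(angle a b lam t, lam)"] angle_eq_iff[of lam] by (simp add: angle_inv_def)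

lemma smooth_angle_inv: "smooth (UNIV \<times> {..<b\<^sup>2}) angle_inv"
proof (rule smooth_inverse_function)
  let ?S = "(UNIV :: real set) \<times> {..<b\<^sup>2}" and ?g = "\<lambda>z. angle a b (snd z) (fst z)"
  let ?f = "\<lambda>z. (?g z, snd z)"
  define d where "d z = frechet_derivative ?g (at z)" for z
  show o: "open ?S" "open ?S" by (intro open_Times; simp)+
  show "angle_inv y \<in> ?S \<and> ?f (angle_inv y) = y" if "y \<in> ?S" for y
    using that angle_angle_inv[of y] by (auto simp: angle_inv_def)
  show "angle_inv (?f x) = x" if "x \<in> ?S" for x
    using that angle_inv_angle by auto
  have d: "(?g has_derivative d z) (at z)" if "z \<in> ?S" for z
    unfolding d_def by (rule smooth_has_derivative[OF smooth_angle that])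
  show "(?f has_derivative (\<lambda>v. (d z v, snd v))) (at z)" if "z \<in> ?S" for z
    using d[OF that] by (auto intro!: derivative_eq_intros)
  have lin: "d z (v, w) = v * d z (1, 0) + w * d z (0, 1)" if "z \<in> ?S" for z v w
  proof -
    have l: "linear (d z)" using d[OF that] by (rule has_derivative_linear)
    have "d z (v, w) = d z (v *\<^sub>R (1, 0) + w *\<^sub>R (0, 1))" by simp
    also have "\<dots> = v * d z (1, 0) + w * d z (0, 1)"
      by (simp only: linear_add[OF l] linear_cmul[OF l] real_scaleR_def)
    finally show ?thesis .
  qed
  have nz: "d z (1, 0) \<noteq> 0" if "z \<in> ?S" for z
  proof -
    obtain t lam where z: "z = (t, lam)" by fastforce
    have l: "lam < b\<^sup>2" using that z by auto
    have "((\<lambda>t. (t, lam)) has_derivative (\<lambda>v. (v, 0))) (at t)" by (auto intro!: derivative_eq_intros)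
    moreover have "(?g has_derivative d z) (at (t, lam))" using d[OF that] z by simp
    ultimately have "((\<lambda>t. ?g (t, lam)) has_derivative (\<lambda>v. d z (v, 0))) (at t)"
      by (rule has_derivative_compose)
    moreover have "(angle a b lam has_derivative (\<lambda>v. pi * ell_weight (a\<^sup>2 - b\<^sup>2) (b\<^sup>2 - lam) t / outer_ell a b 0 lam pi * v)) (at t)"
      using angle_has_derivative[OF l, of t] unfolding has_field_derivative_def .
    ultimately have "(\<lambda>v. d z (v, 0)) = (\<lambda>v. pi * ell_weight (a\<^sup>2 - b\<^sup>2) (b\<^sup>2 - lam) t / outer_ell a b 0 lam pi * v)"
      by (simp add: has_derivative_unique)
    from fun_cong[OF this, of 1]
    have "d z (1, 0) = pi * ell_weight (a\<^sup>2 - b\<^sup>2) (b\<^sup>2 - lam) t / outer_ell a b 0 lam pi" by simp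
    then show ?thesis
      using outer_ell_pos[OF l, of pi 0] ell_weight_pos[OF outer_domain[OF ab l], of t] by simp
  qed
  \<comment> \<open>The derivative \<open>(d z v, snd v)\<close> is triangular; inverting it takes
    only a division by \<open>d z (1, 0)\<close>.\<close>
  let ?D = "\<lambda>z v. ((fst v - snd v * d z (0, 1)) / d z (1, 0), snd v)"
  show "(\<lambda>v. (d z v, snd v)) (?D z v) = v" if "z \<in> ?S" for z v
    using nz[OF that] lin[OF that, of "(fst v - snd v * d z (0, 1)) / d z (1, 0)" "snd v"]
    by (simp add: prod_eq_iff)
  have sd: "smooth ?S (\<lambda>z. d z w)" for w
    unfolding d_def by (rule smooth_frechet_derivative[OF smooth_angle])
  have "smooth ?S (\<lambda>z. fst v - snd v * d z (0, 1))" for v :: "real \<times> real"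
    by (rule smooth_diff[OF smooth_const[OF o(1)] smooth_mult[OF smooth_const[OF o(1)] sd]])
  then have "smooth ?S (\<lambda>z. (fst v - snd v * d z (0, 1)) / d z (1, 0))" for v :: "real \<times> real"
    by (rule smooth_divide[OF _ sd nz])
  then show "smooth ?S (\<lambda>z. ?D z v)" for v
    by (rule smooth_Pair[OF _ smooth_const[OF o(1)]])
qed

lemma sqrt_div_bounds: "0 < lam \<Longrightarrow> lam < b\<^sup>2 \<Longrightarrow> 0 < sqrt lam / a \<and> sqrt lam / a < 1"
  using ab real_sqrt_less_mono[of lam "b\<^sup>2"] by simp

lemma smooth_rotation: "smooth {0<..<b\<^sup>2} (rotation a b)"
proof -
  have "outer_ell a b 0 lam pi \<noteq> 0" if "lam < b\<^sup>2" for lam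
    using outer_ell_pos[OF that, of pi 0] by simp
  moreover have "- 1 < sqrt lam / a" if "0 < lam" "lam < b\<^sup>2" for lam
    using sqrt_div_bounds[OF that] by linarith
  ultimately show ?thesis
    unfolding rotation_def[abs_def]
    by (intro smooth_divide smooth_mult smooth_outer_ell smooth_compose[OF smooth_arcsin]
        smooth_compose[OF smooth_sqrt] smooth_const smooth_id ab)
      (use sqrt_div_bounds ab in auto)
qed

lemma continuous_on_rotation: "continuous_on {0..<b\<^sup>2} (rotation a b)"
proof -
  have cont: "continuous_on {0..<b\<^sup>2} (\<lambda>lam. outer_ell a b 0 lam (f lam))" if "continuous_on {0..<b\<^sup>2} f" for f
    unfolding outer_ell_def
    by (rule continuous_on_compose2[OF smooth_continuous_on[OF smooth_ell], where f="\<lambda>lam. (b\<^sup>2 - lam, f lam)", simplified])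
      (use outer_domain[OF ab] in \<open>auto intro!: continuous_intros that\<close>)
  have "sqrt lam / a \<le> 1" if "lam < b\<^sup>2" "0 \<le> lam" for lam
    using sqrt_div_bounds[of lam] that by (cases "lam = 0") auto
  moreover have "- 1 \<le> sqrt lam / a" if "0 \<le> lam" for lam
    using that a_pos by (smt (verit) divide_nonneg_pos real_sqrt_ge_zero)
  moreover have "outer_ell a b 0 lam pi \<noteq> 0" if "lam < b\<^sup>2" for lam
    using outer_ell_pos[OF that, of pi 0] by simp
  ultimately show ?thesis
    unfolding rotation_def[abs_def] by (intro continuous_intros cont) (use a_pos in auto)
qed

lemma rotation_0: "rotation a b 0 = 0"
  by (simp add: rotation_def outer_ell_def)

text \<open>\<open>lam\<close> enters through \<open>p = b^2 - lam\<close>, which turns the factor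
  \<open>- 1/2\<close> of the parameter derivative into \<open>1/2\<close>.\<close>

lemma outer_ell_has_derivative_param:
  assumes "lam < b\<^sup>2" "(f has_real_derivative f') (at lam)"
  shows "((\<lambda>lam. outer_ell a b 0 lam (f lam)) has_real_derivative
    outer_ell a b 1 lam (f lam) / 2 + ell_weight (a\<^sup>2 - b\<^sup>2) (b\<^sup>2 - lam) (f lam) * f') (at lam)"
proof -
  have D: "(b\<^sup>2 - lam, f lam) \<in> ell_domain (a\<^sup>2 - b\<^sup>2) \<times> UNIV" using outer_domain[OF ab assms(1)] by simp
  have "((\<lambda>lam. (b\<^sup>2 - lam, f lam)) has_derivative (\<lambda>h. (- h, f' * h))) (at lam)"
    using assms(2) by (auto intro!: derivative_eq_intros simp: has_field_derivative_def)
  from has_derivative_compose[OF this ell_has_total_derivative[OF D, of 0]]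
  show ?thesis
    unfolding has_field_derivative_def outer_ell_def fst_conv snd_conv
    by (rule has_derivative_eq_rhs) (auto simp: algebra_simps)
qed

text \<open>Two effects add up in the quotient rule. Changing the weight at a fixed limit
  contributes a nonnegative amount by \<open>ell_ratio_param\<close>; the limit
  \<open>arcsin (sqrt lam / a)\<close> itself moves at positive speed, which gives strictness even
  for a circle.\<close>

lemma rotation_deriv_pos:
  assumes "0 < lam" "lam < b\<^sup>2"
  obtains d where "(rotation a b has_real_derivative d) (at lam)" "d > 0"
proof -
  note s = sqrt_div_bounds[OF assms]
  have m1: "- 1 < sqrt lam / a" using s by linarith
  define \<delta> where "\<delta> = arcsin (sqrt lam / a)"
  have \<delta>: "0 < \<delta>" "\<delta> < pi / 2"
    using arcsin_less_mono[of 0 "sqrt lam / a"] arcsin_less_mono[of "sqrt lam / a" 1] s m1 by (auto simp: \<delta>_def)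
  define \<delta>' where "\<delta>' = inverse (sqrt (1 - (sqrt lam / a)\<^sup>2)) * (inverse (sqrt lam) / 2 / a)"
  have sq: "(sqrt lam / a)\<^sup>2 < 1" using s by (intro iffD2[OF abs_square_less_1]) auto
  then have \<delta>'_pos: "\<delta>' > 0" unfolding \<delta>'_def using a_pos assms by (intro mult_pos_pos) auto
  have "((\<lambda>lam. sqrt lam / a) has_real_derivative inverse (sqrt lam) / 2 / a) (at lam)"
    using DERIV_cdivide[OF DERIV_real_sqrt[OF assms(1)]] .
  moreover have "(arcsin has_real_derivative inverse (sqrt (1 - (sqrt lam / a)\<^sup>2))) (at (sqrt lam / a))"
    using s m1 by (intro DERIV_arcsin) auto
  ultimately have "((\<lambda>lam. arcsin (sqrt lam / a)) has_real_derivative \<delta>') (at lam)"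
    unfolding \<delta>'_def by (intro DERIV_chain2[where f=arcsin and g="\<lambda>lam. sqrt lam / a"])
  from outer_ell_has_derivative_param[OF assms(2) this]
  have N: "((\<lambda>lam. outer_ell a b 0 lam (arcsin (sqrt lam / a))) has_real_derivative
      outer_ell a b 1 lam \<delta> / 2 + ell_weight (a\<^sup>2 - b\<^sup>2) (b\<^sup>2 - lam) \<delta> * \<delta>') (at lam)" (is "(_ has_real_derivative ?N') _")
    by (simp add: \<delta>_def)
  have K: "((\<lambda>lam. outer_ell a b 0 lam pi) has_real_derivative outer_ell a b 1 lam pi / 2) (at lam)"
    using outer_ell_has_derivative_param[OF assms(2) DERIV_const[of pi]] by simp
  let ?K = "outer_ell a b 0 lam pi" and ?K' = "outer_ell a b 1 lam pi / 2" and ?N = "outer_ell a b 0 lam \<delta>"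
  have Kp: "?K > 0" using outer_ell_pos[OF assms(2)] by simp
  have "((\<lambda>lam. 2 * pi * (outer_ell a b 0 lam (arcsin (sqrt lam / a)) / outer_ell a b 0 lam pi)) has_real_derivative
      2 * pi * ((?N' * ?K - ?N * ?K') / (?K * ?K))) (at lam)"
    using Kp by (intro DERIV_cmult DERIV_divide[OF N K, folded \<delta>_def]) simp
  then have der: "(rotation a b has_real_derivative 2 * pi * ((?N' * ?K - ?N * ?K') / (?K * ?K))) (at lam)"
    by (simp add: rotation_def[abs_def])
  have "outer_ell a b j lam pi = 2 * outer_ell a b j lam (pi / 2)" for j
    using ell_pi[OF outer_domain[OF ab assms(2)]] by (simp add: outer_ell_def)
  moreover have "?N * outer_ell a b 1 lam (pi / 2) \<le> outer_ell a b 1 lam \<delta> * outer_ell a b 0 lam (pi / 2)"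
    unfolding outer_ell_def using assms ab by (intro ell_ratio_param \<delta>) (auto simp: power_mono)
  ultimately have "?N * ?K' \<le> outer_ell a b 1 lam \<delta> / 2 * ?K" by simp
  moreover have "0 < ell_weight (a\<^sup>2 - b\<^sup>2) (b\<^sup>2 - lam) \<delta> * \<delta>' * ?K"
    using Kp \<delta>'_pos ell_weight_pos[OF outer_domain[OF ab assms(2)]] by simp
  ultimately have "?N' * ?K - ?N * ?K' > 0" by (simp only: distrib_right)
  then have "2 * pi * ((?N' * ?K - ?N * ?K') / (?K * ?K)) > 0" using Kp by simp
  then show ?thesis using that der by blast
qed

lemma rotation_less:
  assumes xy: "0 \<le> x" "x < y" "y < b\<^sup>2"
  shows "rotation a b x < rotation a b y"
  using xy(2)
proof (rule DERIV_pos_imp_increasing_open)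
  show "\<exists>d. (rotation a b has_real_derivative d) (at z) \<and> d > 0" if "x < z" "z < y" for z
    using rotation_deriv_pos[of z] xy that by (metis le_less_trans less_trans)
  show "continuous_on {x..y} (rotation a b)"
    using continuous_on_rotation by (rule continuous_on_subset) (use xy in auto)
qed

lemma rotation_less_iff:
  "0 \<le> x \<Longrightarrow> x < b\<^sup>2 \<Longrightarrow> 0 \<le> y \<Longrightarrow> y < b\<^sup>2 \<Longrightarrow> rotation a b x < rotation a b y \<longleftrightarrow> x < y"
  using rotation_less[of x y] rotation_less[of y x] by (cases x y rule: linorder_cases) auto

lemma rotation_surj:
  assumes "0 < L" "L < b\<^sup>2" "0 < r" "r < rotation a b L"
  shows "\<exists>lam. 0 < lam \<and> lam < L \<and> rotation a b lam = r"
proof -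
  have "continuous_on {0..L} (rotation a b)"
    using continuous_on_rotation by (rule continuous_on_subset) (use assms in auto)
  then obtain lam where "0 \<le> lam" "lam \<le> L" "rotation a b lam = r"
    using IVT'[of "rotation a b" 0 r L] assms rotation_0 by auto
  moreover from this have "lam \<noteq> 0" "lam \<noteq> L" using assms rotation_0 by auto
  ultimately show ?thesis by (intro exI[of _ lam]) auto
qed

definition rotation_inv :: "real \<Rightarrow> real" where
  "rotation_inv = inv_into {0<..<b\<^sup>2} (rotation a b)"

lemma rotation_inv_rotation:
  "0 < lam \<Longrightarrow> lam < b\<^sup>2 \<Longrightarrow> rotation_inv (rotation a b lam) = lam"
  unfolding rotation_inv_def
proof (rule inv_into_f_f)
  show "inj_on (rotation a b) {0<..<b\<^sup>2}"
  proof (rule inj_onI)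
    fix x y assume "x \<in> {0<..<b\<^sup>2}" "y \<in> {0<..<b\<^sup>2}" "rotation a b x = rotation a b y"
    then show "x = y" using rotation_less[of x y] rotation_less[of y x] by (cases x y rule: linorder_cases) auto
  qed
qed simp

lemma rotation_inv:
  assumes "0 < L" "L < b\<^sup>2" "0 < r" "r < rotation a b L"
  shows "0 < rotation_inv r" "rotation_inv r < L" "rotation a b (rotation_inv r) = r"
proof -
  obtain lam where "0 < lam" "lam < L" "rotation a b lam = r" using rotation_surj[OF assms] by blast
  then show "0 < rotation_inv r" "rotation_inv r < L" "rotation a b (rotation_inv r) = r"
    using rotation_inv_rotation[of lam] assms by auto
qed

lemma smooth_rotation_inv:
  assumes L: "0 < L" "L < b\<^sup>2"
  shows "smooth {0<..<rotation a b L} rotation_inv"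
proof (rule smooth_inverse_function)
  let ?S = "{0<..<L}" and ?T = "{0<..<rotation a b L}"
  show "open ?S" "open ?T" by auto
  show "rotation_inv y \<in> ?S \<and> rotation a b (rotation_inv y) = y" if "y \<in> ?T" for y
    using that rotation_inv[OF L] by auto
  show "rotation_inv (rotation a b x) = x" if "x \<in> ?S" for x
    using that L by (intro rotation_inv_rotation) auto
  show d: "(rotation a b has_derivative frechet_derivative (rotation a b) (at x)) (at x)" if "x \<in> ?S" for x
    using that L by (intro smooth_has_derivative[OF smooth_rotation]) auto
  have lin: "frechet_derivative (rotation a b) (at x) v = v * frechet_derivative (rotation a b) (at x) 1"
    if "x \<in> ?S" for x v
    using linear_cmul[OF has_derivative_linear[OF d[OF that]], of v 1] by simp
  have nz: "frechet_derivative (rotation a b) (at x) 1 \<noteq> 0" if x: "x \<in> ?S" for x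
  proof -
    obtain d' where d': "(rotation a b has_real_derivative d') (at x)" "d' > 0"
      using rotation_deriv_pos[of x] x L by auto
    from fun_cong[OF frechet_derivative_at[OF d'(1)[unfolded has_field_derivative_def]], of 1] d'(2)
    show ?thesis by simp
  qed
  show "frechet_derivative (rotation a b) (at x) (v / frechet_derivative (rotation a b) (at x) 1) = v"
    if "x \<in> ?S" for x v
    using lin[OF that, of "v / frechet_derivative (rotation a b) (at x) 1"] nz[OF that] by simp
  have "smooth ?S (rotation a b)"
    by (rule smooth_subset[OF smooth_rotation]) (use L in auto)
  then have sf: "smooth ?S (\<lambda>x. frechet_derivative (rotation a b) (at x) 1)"
    by (rule smooth_frechet_derivative)
  show "smooth ?S (\<lambda>x. v / frechet_derivative (rotation a b) (at x) 1)" for v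
    by (rule smooth_divide[OF smooth_const[OF smooth_open[OF sf]] sf nz])
qed

end

text \<open>The inverse of the action-angle coordinates: the arguments are the angle and the
  rotation per bounce. Taking the rotation rather than \<open>lam\<close> as action makes the
  billiard \<open>(x, r) -> (x + r, r)\<close> for every ellipse.\<close>

definition boundary_map :: "real \<Rightarrow> real \<Rightarrow> real \<times> real \<Rightarrow> phase_point" where
  "boundary_map a b u = outer_ccw a b (fst (angle_inv a b (fst u, rotation_inv a b (snd u)))) (rotation_inv a b (snd u))"

text \<open>\<open>Q\<close> is a covering of a region near the boundary by a strip that depends on
  \<open>R\<close> only, so that two ellipses can share it. A local section is defined on an open
  set of the ambient space, which is the form that \<open>smooth_on\<close> asks for.\<close>

locale boundary_chart =
  fixes a b R :: real and Q :: "real \<times> real \<Rightarrow> phase_point" and D :: "(real \<times> real) set"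
  defines "D \<equiv> UNIV \<times> {0<..<R}"
  assumes smooth_chart: "smooth D Q"
    and chart_in: "u \<in> D \<Longrightarrow> Q u \<in> phase_space a b"
    and local_section: "u \<in> D \<Longrightarrow> \<exists>U F. Q u \<in> U \<and> smooth U F \<and> F ` U \<subseteq> D \<and> (\<forall>y\<in>U \<inter> phase_space a b. Q (F y) = y)"
    and chart_eq_iff: "u \<in> D \<Longrightarrow> v \<in> D \<Longrightarrow> Q u = Q v \<longleftrightarrow> snd u = snd v \<and> (\<exists>m::int. fst u = fst v + 2 * pi * of_int m)"
    and chart_step: "(x, r) \<in> D \<Longrightarrow> billiard_map a b (Q (x, r)) = Q (x + r, r)"
    and chart_strip: "\<exists>\<theta>>0. ellipse a b \<times> {0<..<\<theta>} \<subseteq> Q ` D"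
    and chart_boundary: "e > 0 \<Longrightarrow> \<exists>d>0. \<forall>u\<in>D. snd u < d \<longrightarrow> snd (Q u) < e"
      "e > 0 \<Longrightarrow> \<exists>d>0. \<forall>u\<in>D. snd (Q u) < d \<longrightarrow> snd u < e"
    and chart_base: "u \<in> D \<Longrightarrow> fst (Q u) \<in> {p_star a b, - p_star a b} \<longleftrightarrow> (\<exists>m::int. fst u = of_int m * pi)"

lemma boundary_chart_boundary_map:
  assumes ab: "0 < b" "b \<le> a" and L: "0 < L" "L < b\<^sup>2" and R: "R = rotation a b L"
  shows "boundary_chart a b R (boundary_map a b)"
proof -
  let ?D = "(UNIV :: real set) \<times> {0<..<R}" and ?Q = "boundary_map a b"
  have a: "a > 0" using ab by simp
  have Q: "?Q (angle a b lam t, rotation a b lam) = outer_ccw a b t lam" if "0 < lam" "lam < L" for t lam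
    using that L by (simp add: boundary_map_def rotation_inv_rotation[OF ab] angle_inv_angle[OF ab])
  have cover: "\<exists>lam t. 0 < lam \<and> lam < L \<and> u = (angle a b lam t, rotation a b lam)" if u: "u \<in> ?D" for u
  proof -
    have r: "0 < snd u" "snd u < rotation a b L" using u by (auto simp: R)
    obtain lam where "0 < lam" "lam < L" "rotation a b lam = snd u" using rotation_surj[OF ab L r] by blast
    moreover obtain t where "angle a b lam t = fst u" using angle_surj[OF ab, of lam "fst u"] L calculation by auto
    ultimately show ?thesis by (metis prod.collapse)
  qed
  have rot_in: "(x, rotation a b lam) \<in> ?D" if "0 < lam" "lam < L" for x lam
    using rotation_less[OF ab, of 0 lam] rotation_less[OF ab, of lam L] that L rotation_0[OF ab] by (simp add: R)
  have in_range: "z \<in> ?Q ` ?D" if z: "z \<in> phase_space a b" "snd z < pi / 2" "0 < caustic a b z" "caustic a b z < L" for z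
  proof -
    obtain t where "z = outer_ccw a b t (caustic a b z)" using outer_ccw_surj[OF a ab(1) z(1,2)] .
    then have "z = ?Q (angle a b (caustic a b z) t, rotation a b (caustic a b z))" using Q z by simp
    then show ?thesis using rot_in z by blast
  qed
  have caustic_le: "caustic a b z \<le> a\<^sup>2 * (snd z)\<^sup>2" and caustic_pos: "0 < caustic a b z"
    if z: "z \<in> phase_space a b" for z
  proof -
    obtain p \<theta> where zp: "z = (p, \<theta>)" by fastforce
    have "p \<in> ellipse a b" using z by (simp add: zp phase_space_def)
    then obtain t where t: "p = ellipse_point a b t" by (rule ellipse_pointE[OF a ab(1)])
    have th: "0 < \<theta>" "\<theta> < pi" using z by (auto simp: zp phase_space_def)
    have s: "0 < sin \<theta>" "sin \<theta> \<le> \<theta>" using th by (auto simp: sin_gt_zero sin_x_le_x)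
    have n: "0 < speed a b t" "speed a b t \<le> a" using a ab by (auto simp: speed_pos speed_le)
    have c: "caustic a b z = (sin \<theta>)\<^sup>2 * (speed a b t)\<^sup>2" using a ab by (simp add: zp t caustic_ellipse_point)
    show "0 < caustic a b z" unfolding c using s n by simp
    have "(sin \<theta>)\<^sup>2 * (speed a b t)\<^sup>2 \<le> \<theta>\<^sup>2 * a\<^sup>2" using s n by (intro mult_mono power_mono) auto
    then show "caustic a b z \<le> a\<^sup>2 * (snd z)\<^sup>2" unfolding c by (simp add: zp mult.commute)
  qed
  show ?thesis
  proof (unfold_locales)
    have inv: "smooth ?D (\<lambda>u. rotation_inv a b (snd u))"
      unfolding R by (intro smooth_compose[OF smooth_rotation_inv[OF ab L]] smooth_snd smooth_id open_Times) auto
    have inv_less: "0 < rotation_inv a b (snd u)" "rotation_inv a b (snd u) < b\<^sup>2" if "u \<in> ?D" for u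
      using rotation_inv[OF ab L, of "snd u"] that L by (auto simp: R)
    have "smooth ?D (\<lambda>u. (fst u, rotation_inv a b (snd u)))"
      using inv by (intro smooth_intros) (auto simp: open_Times)
    then have "smooth ?D (\<lambda>u. angle_inv a b (fst u, rotation_inv a b (snd u)))"
      by (rule smooth_compose[OF smooth_angle_inv[OF ab]]) (use inv_less in auto)
    then have "smooth ?D (\<lambda>u. (fst (angle_inv a b (fst u, rotation_inv a b (snd u))), rotation_inv a b (snd u)))"
      using inv by (intro smooth_Pair smooth_fst)
    from smooth_compose[OF smooth_outer_ccw[OF ab] this] inv_less
    show "smooth ?D ?Q" unfolding boundary_map_def by auto
  next
    show "?Q u \<in> phase_space a b" if "u \<in> ?D" for u
      using cover[OF that] Q outer_ccw_in(1)[OF ab] L by auto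
  next
    fix u assume "u \<in> ?D"
    then obtain lam0 t0 where l0: "0 < lam0" "lam0 < L" and u: "u = (angle a b lam0 t0, rotation a b lam0)"
      using cover by blast
    \<comment> \<open>For a point of the ellipse with parameter \<open>t\<close> these are
      \<open>sin (t - t0)\<close> and \<open>cos (t - t0)\<close>. Where \<open>w > 0\<close>,
      \<open>arcsin\<close> of \<open>v\<close> recovers \<open>t - t0\<close>, and the formula
      makes sense off the ellipse.\<close>
    define v where "v z = (snd (fst z) / b) * cos t0 - (fst (fst z) / a) * sin t0" for z :: phase_point
    define w where "w z = (fst (fst z) / a) * cos t0 + (snd (fst z) / b) * sin t0" for z :: phase_point
    define U where "U = {z. -1 < v z \<and> v z < 1 \<and> 0 < w z \<and> 0 < snd z \<and> snd z < pi / 2 \<and>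
        0 < caustic a b z \<and> caustic a b z < L}"
    have oU: "open U"
      unfolding U_def v_def w_def 
      by (intro open_Collect_conj open_Collect_less continuous_intros continuous_on_caustic) (use a ab in auto)
    define F where "F z = (angle a b (caustic a b z) (t0 + arcsin (v z)), rotation a b (caustic a b z))" for z
    have sv: "smooth U v"
      unfolding v_def by (intro smooth_divide smooth_intros oU) (use a ab in auto)
    have "smooth U (\<lambda>z. t0 + arcsin (v z))"
      by (intro smooth_add smooth_const oU smooth_compose[OF smooth_arcsin sv]) (auto simp: U_def)
    then have "smooth U (\<lambda>z. (t0 + arcsin (v z), caustic a b z))"
      by (intro smooth_Pair smooth_caustic oU)
    from smooth_compose[OF smooth_angle[OF ab] this]
    have s1: "smooth U (\<lambda>z. angle a b (caustic a b z) (t0 + arcsin (v z)))"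
      using L by (force simp: U_def)
    have s2: "smooth U (\<lambda>z. rotation a b (caustic a b z))"
      by (rule smooth_compose[OF smooth_rotation[OF ab] smooth_caustic[OF oU]]) (use L in \<open>auto simp: U_def\<close>)
    have "smooth U F" unfolding F_def by (rule smooth_Pair[OF s1 s2])
    moreover have "?Q u \<in> U"
    proof -
      have l0b: "lam0 < b\<^sup>2" using l0 L by simp
      have Qu: "?Q u = outer_ccw a b t0 lam0" unfolding u using Q l0 by simp
      have "v (?Q u) = 0" "w (?Q u) = 1"
        unfolding Qu v_def w_def outer_ccw_def ellipse_point_def using a ab
        by (simp_all flip: power2_eq_square)
      moreover have "0 < snd (?Q u)" using outer_angle(1)[OF ab l0(1) l0b] by (simp add: Qu outer_ccw_def)
      ultimately show ?thesis using outer_ccw_in[OF ab l0(1) l0b, of t0] l0 by (simp add: U_def flip: Qu)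
    qed
    moreover have "F ` U \<subseteq> ?D" using rot_in by (auto simp: F_def U_def)
    moreover have "?Q (F y) = y" if y: "y \<in> U \<inter> phase_space a b" for y
    proof -
      let ?l = "caustic a b y" and ?t = "t0 + arcsin (v y)"
      have yU: "-1 < v y" "v y < 1" "0 < w y" "snd y < pi / 2" "0 < snd y" "0 < ?l" "?l < L" using y by (auto simp: U_def)
      have e: "(fst (fst y) / a)\<^sup>2 + (snd (fst y) / b)\<^sup>2 = 1"
        using y by (auto simp: phase_space_def ellipse_def power_divide)
      have "(v y)\<^sup>2 + (w y)\<^sup>2 = ((fst (fst y) / a)\<^sup>2 + (snd (fst y) / b)\<^sup>2) * ((sin t0)\<^sup>2 + (cos t0)\<^sup>2)"
        unfolding v_def w_def by algebra
      then have "w y = sqrt (1 - (v y)\<^sup>2)" using e yU(3) by (intro real_sqrt_unique[symmetric]) auto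
      then have sc: "sin (arcsin (v y)) = v y" "cos (arcsin (v y)) = w y"
        using yU by (auto simp: cos_arcsin)
      have s1: "(sin t0)\<^sup>2 + (cos t0)\<^sup>2 = 1" by simp
      have "cos ?t = fst (fst y) / a" unfolding cos_add sc unfolding v_def w_def using s1 by algebra
      moreover have "sin ?t = snd (fst y) / b" unfolding sin_add sc unfolding v_def w_def using s1 by algebra
      ultimately have "fst y = ellipse_point a b ?t" using a ab by (simp add: ellipse_point_def)
      then have y': "y = (ellipse_point a b ?t, snd y)" by (metis prod.collapse)
      have "outer_angle a b ?t ?l = snd y"
        using a ab yU by (intro outer_angle_unique) (auto simp: caustic_ellipse_point[symmetric] simp flip: y')
      then have "y = outer_ccw a b ?t ?l" using y' by (simp add: outer_ccw_def)
      then show ?thesis unfolding F_def using Q yU by simp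
    qed
    ultimately show "\<exists>U F. ?Q u \<in> U \<and> smooth U F \<and> F ` U \<subseteq> ?D \<and> (\<forall>y\<in>U \<inter> phase_space a b. ?Q (F y) = y)"
      by blast
  next
    fix u v assume "u \<in> ?D" "v \<in> ?D"
    then obtain lam t lam' t' where u: "0 < lam" "lam < L" "u = (angle a b lam t, rotation a b lam)"
      and v: "0 < lam'" "lam' < L" "v = (angle a b lam' t', rotation a b lam')"
      using cover by metis
    have "rotation a b lam = rotation a b lam' \<longleftrightarrow> lam = lam'"
      using rotation_less[OF ab, of lam lam'] rotation_less[OF ab, of lam' lam] u v L
      by (cases lam lam' rule: linorder_cases) auto
    moreover have "t = t' + 2 * pi * of_int m \<longleftrightarrow> angle a b lam t = angle a b lam t' + 2 * pi * of_int m" for m :: int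
    proof -
      have "angle a b lam t' + 2 * pi * of_int m = angle a b lam (t' + 2 * pi * of_int m)"
        using angle_add_of_int_pi[OF ab, of lam t' "2 * m"] u L by (simp add: mult_ac)
      then show ?thesis using angle_eq_iff[OF ab, of lam] u L by simp
    qed
    ultimately show "?Q u = ?Q v \<longleftrightarrow> snd u = snd v \<and> (\<exists>m::int. fst u = fst v + 2 * pi * of_int m)"
      using outer_ccw_eq_iff[OF ab, of lam lam' t t'] u v L by (auto simp: Q)
  next
    fix x r assume "(x, r) \<in> ?D"
    then obtain lam t where u: "0 < lam" "lam < L" "(x, r) = (angle a b lam t, rotation a b lam)"
      using cover by blast
    obtain s where s: "angle a b lam s = angle a b lam t + rotation a b lam"
      using angle_surj[OF ab, of lam] u L by (metis less_trans)
    then have "billiard_map a b (outer_ccw a b t lam) = outer_ccw a b s lam"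
      using u L by (intro billiard_map_outer_ccw[OF ab]) auto
    then show "billiard_map a b (?Q (x, r)) = ?Q (x + r, r)" using u s Q[of lam t] Q[of lam s] by simp
  next
    \<comment> \<open>The caustic parameter is at most \<open>a^2\<close> times the squared angle,
      so the second bound forces it below \<open>L\<close>; the first one excludes clockwise
      vectors.\<close>
    define \<theta> where "\<theta> = min (pi / 2) (sqrt L / a)"
    have "\<theta> > 0" using L a by (simp add: \<theta>_def)
    moreover have "ellipse a b \<times> {0<..<\<theta>} \<subseteq> ?Q ` ?D"
    proof
      fix z assume z: "z \<in> ellipse a b \<times> {0<..<\<theta>}"
      then have z': "z \<in> phase_space a b" by (auto simp: phase_space_def \<theta>_def)
      have "0 < snd z" "snd z < sqrt L / a" using z by (auto simp: \<theta>_def)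
      then have "(a * snd z)\<^sup>2 < (sqrt L)\<^sup>2" using a by (intro power_strict_mono) (auto simp: field_simps)
      then have "a\<^sup>2 * (snd z)\<^sup>2 < L" using L by (simp add: power_mult_distrib)
      then show "z \<in> ?Q ` ?D"
        using z caustic_le[OF z'] caustic_pos[OF z'] by (intro in_range z') (auto simp: \<theta>_def)
    qed
    ultimately show "\<exists>\<theta>>0. ellipse a b \<times> {0<..<\<theta>} \<subseteq> ?Q ` ?D" by blast
  next
    fix e :: real assume e: "e > 0"
    define e' where "e' = min e (pi / 4)"
    have "e' \<le> pi / 4" unfolding e'_def by (rule min.cobounded2)
    moreover have "pi / 4 < pi / 2" using pi_gt_zero by simp
    ultimately have "e' < pi / 2" by (rule le_less_trans)
    moreover have "0 < e'" "e' \<le> e" using e by (auto simp: e'_def)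
    ultimately have e': "0 < e'" "e' \<le> e" "e' < pi / 2" by blast+
    have se: "0 < sin e'" using e' by (intro sin_gt_zero) auto
    \<comment> \<open>\<open>sin\<close> of the angle is \<open>sqrt lam / speed\<close> with
      \<open>speed \<ge> b\<close>, so \<open>lam < l\<close> forces it below
      \<open>sin e'\<close>.\<close>
    define l where "l = min L ((b * sin e')\<^sup>2)"
    have l: "0 < l" "l < b\<^sup>2" "l \<le> L" "l \<le> (b * sin e')\<^sup>2" using L se ab by (auto simp: l_def)
    show "\<exists>d>0. \<forall>u\<in>?D. snd u < d \<longrightarrow> snd (?Q u) < e"
    proof (intro exI conjI ballI impI)
      show "rotation a b l > 0" using rotation_less[OF ab, of 0 l] rotation_0[OF ab] l by simp
      fix u assume "u \<in> ?D" "snd u < rotation a b l"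
      then obtain lam t where u: "0 < lam" "lam < L" "u = (angle a b lam t, rotation a b lam)" using cover by blast
      then have lam: "lam < l" using \<open>snd u < _\<close> rotation_less_iff[OF ab, of lam l] l L by simp
      then have lb: "lam < b\<^sup>2" using l by simp
      have "sqrt lam < sqrt ((b * sin e')\<^sup>2)" using lam l by (intro real_sqrt_less_mono) simp
      then have "sqrt lam < sin e' * b" using ab se by (simp add: mult.commute)
      also have "\<dots> \<le> sin e' * speed a b t" using se speed_ge[OF ab] by (intro mult_left_mono) auto
      finally have "sin (outer_angle a b t lam) < sin e'"
        using speed_pos[OF a ab(1), of t] by (simp add: outer_angle(3)[OF ab u(1) lb] field_simps)
      then have "outer_angle a b t lam < e'"
        using outer_angle(1,2)[OF ab u(1) lb, of t] e' sin_monotone_2pi_le[of e' "outer_angle a b t lam"] by (smt (verit))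
      then show "snd (?Q u) < e" using e' u Q by (simp add: outer_ccw_def)
    qed
  next
    fix e :: real assume e: "e > 0"
    have RL: "rotation a b L > 0" using rotation_less[OF ab, of 0 L] rotation_0[OF ab] L by simp
    define r where "r = min e (rotation a b L / 2)"
    have r: "0 < r" "r < rotation a b L" "r \<le> e" using e RL by (auto simp: r_def)
    obtain l where l: "0 < l" "l < L" "rotation a b l = r" using rotation_surj[OF ab L r(1,2)] by blast
    show "\<exists>d>0. \<forall>u\<in>?D. snd (?Q u) < d \<longrightarrow> snd u < e"
    proof (intro exI conjI ballI impI)
      show "sqrt l / a > 0" using l a by simp
      fix u assume u': "u \<in> ?D" "snd (?Q u) < sqrt l / a"
      then obtain lam t where u: "0 < lam" "lam < L" "u = (angle a b lam t, rotation a b lam)" using cover by blast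
      have lb: "lam < b\<^sup>2" using u L by simp
      let ?z = "outer_ccw a b t lam"
      have z: "?z \<in> phase_space a b" "caustic a b ?z = lam" "?Q u = ?z"
        using outer_ccw_in[OF ab u(1) lb, of t] Q u by auto
      have "0 < snd ?z" "snd ?z < sqrt l / a" using z u' by (auto simp: phase_space_def)
      then have "(a * snd ?z)\<^sup>2 < (sqrt l)\<^sup>2" using a by (intro power_strict_mono) (auto simp: field_simps)
      then have "lam < l" using caustic_le[OF z(1)] z(2) l by (simp add: power_mult_distrib)
      then have "rotation a b lam < r" using rotation_less[OF ab, of lam l] u l L by simp
      then show "snd u < e" using u r by simp
    qed
  next
    fix u assume "u \<in> ?D"
    then obtain lam t where u: "0 < lam" "lam < L" "u = (angle a b lam t, rotation a b lam)" using cover by blast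
    let ?t0 = "base_param a b"
    have lb: "lam < b\<^sup>2" using u L by simp
    have "fst (?Q u) \<in> {p_star a b, - p_star a b} \<longleftrightarrow>
        ellipse_point a b t = ellipse_point a b ?t0 \<or> ellipse_point a b t = ellipse_point a b (?t0 + pi)"
      using u by (simp add: Q outer_ccw_def p_star_eq ellipse_point_add_pi)
    also have "\<dots> \<longleftrightarrow> (\<exists>m::int. t = ?t0 + of_int m * pi)"
    proof
      assume "ellipse_point a b t = ellipse_point a b ?t0 \<or> ellipse_point a b t = ellipse_point a b (?t0 + pi)"
      then obtain m :: int where "t = ?t0 + 2 * pi * of_int m \<or> t = ?t0 + pi + 2 * pi * of_int m"
        unfolding ellipse_point_eq_iff[OF a ab(1)] by blast
      then have "t = ?t0 + of_int (2 * m) * pi \<or> t = ?t0 + of_int (2 * m + 1) * pi" by (auto simp: algebra_simps)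
      then show "\<exists>m::int. t = ?t0 + of_int m * pi" by blast
    next
      assume "\<exists>m::int. t = ?t0 + of_int m * pi"
      then obtain m :: int where m: "t = ?t0 + of_int m * pi" by blast
      \<comment> \<open>An even \<open>m\<close> leads to the base point, an odd one to its
        antipode.\<close>
      then have "t = ?t0 + 2 * pi * of_int (m div 2) \<or> t = ?t0 + pi + 2 * pi * of_int (m div 2)"
        by (cases "even m") (auto elim!: evenE oddE simp: algebra_simps)
      then show "ellipse_point a b t = ellipse_point a b ?t0 \<or> ellipse_point a b t = ellipse_point a b (?t0 + pi)"
        unfolding ellipse_point_eq_iff[OF a ab(1)] by blast
    qed
    also have "\<dots> \<longleftrightarrow> (\<exists>m::int. fst u = of_int m * pi)"
    proof -
      have "fst u = of_int m * pi \<longleftrightarrow> t = ?t0 + of_int m * pi" for m :: int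
        using angle_add_of_int_pi[OF ab lb, of ?t0 m] angle_eq_iff[OF ab lb, of t "?t0 + of_int m * pi"]
        by (simp add: u(3) angle_base[OF ab])
      then show ?thesis by simp
    qed
    finally show "fst (?Q u) \<in> {p_star a b, - p_star a b} \<longleftrightarrow> (\<exists>m::int. fst u = of_int m * pi)" .
  qed
qed

section \<open>Gluing two boundary charts\<close>

context boundary_chart
begin

text \<open>Local sections make the image open; it is invariant because
  \<open>(x, r) -> (x + r, r)\<close> is a bijection of \<open>D\<close>.\<close>

lemma invariant_chart_image: "\<exists>\<theta>>0. invariant_nbhd a b \<theta> (Q ` D)"
proof -
  obtain \<theta> where "\<theta> > 0" "ellipse a b \<times> {0<..<\<theta>} \<subseteq> Q ` D" using chart_strip by blast
  moreover have "openin (top_of_set (phase_space a b)) (Q ` D)"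
  proof (subst openin_subopen, intro ballI)
    fix z assume "z \<in> Q ` D"
    then obtain u where u: "u \<in> D" "z = Q u" by blast
    then obtain U F where UF: "z \<in> U" "smooth U F" "F ` U \<subseteq> D" "\<forall>y\<in>U \<inter> phase_space a b. Q (F y) = y"
      using local_section by metis
    have "U \<inter> phase_space a b \<subseteq> Q ` D"
    proof
      fix y assume "y \<in> U \<inter> phase_space a b"
      then have "F y \<in> D" "Q (F y) = y" using UF by auto
      then show "y \<in> Q ` D" by (metis imageI)
    qed
    moreover have "openin (top_of_set (phase_space a b)) (U \<inter> phase_space a b)"
      using smooth_open[OF UF(2)] by (auto simp: openin_open)
    ultimately show "\<exists>T. openin (top_of_set (phase_space a b)) T \<and> z \<in> T \<and> T \<subseteq> Q ` D"
      using UF u chart_in by blast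
  qed
  moreover have "billiard_map a b ` Q ` D = Q ` D"
  proof -
    have "billiard_map a b (Q u) \<in> Q ` D" if "u \<in> D" for u
    proof -
      obtain x r where "u = (x, r)" by fastforce
      then show ?thesis using that chart_step[of x r] by (auto simp: D_def)
    qed
    moreover have "Q u \<in> billiard_map a b ` Q ` D" if "u \<in> D" for u
    proof -
      obtain x r where u: "u = (x, r)" by fastforce
      then have "(x - r, r) \<in> D" using that by (auto simp: D_def)
      then show ?thesis using chart_step[of "x - r" r] by (force simp: u)
    qed
    ultimately show ?thesis by blast
  qed
  ultimately show ?thesis unfolding invariant_nbhd_def by blast
qed

definition transition :: "(real \<times> real \<Rightarrow> phase_point) \<Rightarrow> phase_point \<Rightarrow> phase_point" where
  "transition Q' z = Q' (inv_into D Q z)"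

end

locale boundary_chart_pair =
  C1: boundary_chart a1 b1 R Q1 D + C2: boundary_chart a2 b2 R Q2 D for a1 b1 a2 b2 R Q1 Q2 D
begin

text \<open>\<open>inv_into\<close> picks an arbitrary preimage under \<open>Q1\<close>; by
  \<open>chart_eq_iff\<close> both charts identify the same points of \<open>D\<close>, so the
  choice does not affect the value under \<open>Q2\<close>.\<close>

lemma transition_chart: "u \<in> D \<Longrightarrow> C1.transition Q2 (Q1 u) = Q2 u"
proof -
  assume u: "u \<in> D"
  let ?v = "inv_into D Q1 (Q1 u)"
  have v: "?v \<in> D" "Q1 ?v = Q1 u" using u by (auto intro: inv_into_into f_inv_into_f)
  then have "snd ?v = snd u \<and> (\<exists>m::int. fst ?v = fst u + 2 * pi * of_int m)"
    using C1.chart_eq_iff[OF v(1) u] by blast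
  then show ?thesis using C2.chart_eq_iff[OF v(1) u] by (simp add: C1.transition_def)
qed

lemma smooth_on_transition: "smooth_on (Q1 ` D) (C1.transition Q2)"
proof (rule smooth_imp_smooth_on)
  fix z assume "z \<in> Q1 ` D"
  then obtain u where u: "u \<in> D" "z = Q1 u" by blast
  then obtain U F where UF: "z \<in> U" "smooth U F" "F ` U \<subseteq> D" "\<forall>y\<in>U \<inter> phase_space a1 b1. Q1 (F y) = y"
    using C1.local_section by metis
  have "smooth U (\<lambda>y. Q2 (F y))"
    by (rule smooth_compose[OF C2.smooth_chart UF(2)]) (use UF(3) in blast)
  moreover have "Q2 (F y) = C1.transition Q2 y" if "y \<in> U \<inter> Q1 ` D" for y
  proof -
    have "y \<in> U \<inter> phase_space a1 b1" using that C1.chart_in by blast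
    then show ?thesis using UF transition_chart[of "F y"] by force
  qed
  ultimately show "\<exists>U F. z \<in> U \<and> smooth U F \<and> (\<forall>y\<in>U \<inter> Q1 ` D. F y = C1.transition Q2 y)"
    using UF(1) by blast
qed

lemma respects_boundary_transition: "respects_boundary (Q1 ` D) (C1.transition Q2)"
  unfolding respects_boundary_def
proof (intro allI impI)
  fix e :: real assume "e > 0"
  then obtain d where d: "d > 0" "\<forall>u\<in>D. snd u < d \<longrightarrow> snd (Q2 u) < e" using C2.chart_boundary(1) by blast
  then obtain d' where "d' > 0" "\<forall>u\<in>D. snd (Q1 u) < d' \<longrightarrow> snd u < d" using C1.chart_boundary(2) by blast
  then show "\<exists>d>0. \<forall>z\<in>Q1 ` D. snd z < d \<longrightarrow> snd (C1.transition Q2 z) < e"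
    using d transition_chart by (intro exI[of _ d']) auto
qed

text \<open>In either chart the exceptional fibres consist of the points whose angle is a multiple
  of \<open>pi\<close>, a description in which the ellipse no longer occurs.\<close>

lemma star_iff:
  assumes "u \<in> D"
  shows "Q1 u \<in> ellipse_star a1 b1 \<times> UNIV \<longleftrightarrow> Q2 u \<in> ellipse_star a2 b2 \<times> UNIV"
proof -
  have "fst (Q1 u) \<in> ellipse a1 b1" "fst (Q2 u) \<in> ellipse a2 b2"
    using C1.chart_in[OF assms] C2.chart_in[OF assms] by (auto simp: phase_space_def)
  then show ?thesis
    using C1.chart_base[OF assms] C2.chart_base[OF assms]
    by (cases "Q1 u"; cases "Q2 u") (auto simp: ellipse_star_def)
qed

end

text \<open>The transition map is smooth on all of \<open>V1\<close>; for the restricted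
  diffeomorphism it remains to see that \<open>h\<close> matches the two punctured regions, which is
  \<open>star_iff\<close>.\<close>

lemma boundary_conjugacy:
  assumes "boundary_chart a1 b1 R Q1" "boundary_chart a2 b2 R Q2"
  shows "\<exists>\<theta>1>0. \<exists>\<theta>2>0. \<exists>V1 V2 h k.
        invariant_nbhd a1 b1 \<theta>1 V1 \<and> invariant_nbhd a2 b2 \<theta>2 V2 \<and>
        C0_conjugacy V1 (billiard_map a1 b1) V2 (billiard_map a2 b2) h k \<and>
        respects_boundary V1 h \<and> respects_boundary V2 k \<and>
        smooth_diffeomorphism
          (V1 \<inter> (ellipse_star a1 b1 \<times> UNIV)) (V2 \<inter> (ellipse_star a2 b2 \<times> UNIV)) h k"
proof -
  define D where "D = (UNIV :: real set) \<times> {0<..<R}"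
  interpret P: boundary_chart_pair a1 b1 a2 b2 R Q1 Q2 D
    using assms by (simp add: boundary_chart_pair_def D_def) (rule eq_reflection, rule D_def)
  interpret P': boundary_chart_pair a2 b2 a1 b1 R Q2 Q1 D
    using assms by (simp add: boundary_chart_pair_def D_def) (rule eq_reflection, rule D_def)
  define h k where hk: "h = P.C1.transition Q2" "k = P.C2.transition Q1"
  let ?V1 = "Q1 ` D" and ?V2 = "Q2 ` D"
  have h: "h (Q1 u) = Q2 u" and k: "k (Q2 u) = Q1 u" if "u \<in> D" for u
    using that P.transition_chart P'.transition_chart by (simp_all add: hk)
  have sh: "smooth_on ?V1 h" and sk: "smooth_on ?V2 k"
    using P.smooth_on_transition P'.smooth_on_transition by (simp_all add: hk)
  have hom: "homeomorphism ?V1 ?V2 h k"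
    unfolding homeomorphism_def
    using h k smooth_on_imp_continuous_on[OF sh] smooth_on_imp_continuous_on[OF sk]
    by (auto simp: image_image)
  have "billiard_map a1 b1 z = k (billiard_map a2 b2 (h z))" if "z \<in> ?V1" for z
  proof -
    obtain x r where xr: "(x, r) \<in> D" "z = Q1 (x, r)" using \<open>z \<in> ?V1\<close> by auto
    then have "(x + r, r) \<in> D" by (auto simp: D_def)
    then show ?thesis using xr h k P.C1.chart_step P.C2.chart_step by simp
  qed
  then have conj: "C0_conjugacy ?V1 (billiard_map a1 b1) ?V2 (billiard_map a2 b2) h k"
    using hom by (simp add: C0_conjugacy_def)
  let ?W1 = "?V1 \<inter> (ellipse_star a1 b1 \<times> UNIV)" and ?W2 = "?V2 \<inter> (ellipse_star a2 b2 \<times> UNIV)"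
  have "h ` (Q1 ` D \<inter> S1) = Q2 ` D \<inter> S2" if "\<And>u. u \<in> D \<Longrightarrow> Q1 u \<in> S1 \<longleftrightarrow> Q2 u \<in> S2" for S1 S2
  proof -
    have "Q1 ` D \<inter> S1 = Q1 ` {u \<in> D. Q1 u \<in> S1}" "Q2 ` D \<inter> S2 = Q2 ` {u \<in> D. Q1 u \<in> S1}"
      using that by blast+
    then show ?thesis using h by (simp add: image_image)
  qed
  from this[OF P.star_iff] have "h ` ?W1 = ?W2" .
  then have "homeomorphism ?W1 ?W2 h k"
    by (intro homeomorphism_of_subsets[OF hom]) auto
  then have "smooth_diffeomorphism ?W1 ?W2 h k"
    unfolding smooth_diffeomorphism_def
    using sh sk smooth_on_subset by (metis inf_le1)
  then show ?thesis
    using P.C1.invariant_chart_image P.C2.invariant_chart_image conj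
      P.respects_boundary_transition P'.respects_boundary_transition unfolding hk by blast
qed

text \<open>A common bound \<open>R\<close> on the rotation gives the charts of both ellipses the
  same domain \<open>D\<close>.\<close>

lemma common_rotation:
  assumes "0 < b1" "b1 \<le> a1" "0 < b2" "b2 \<le> a2"
  obtains L1 L2 where "0 < L1" "L1 < b1\<^sup>2" "0 < L2" "L2 < b2\<^sup>2" "rotation a1 b1 L1 = rotation a2 b2 L2"
proof -
  have pos: "0 < b\<^sup>2 / 2" "b\<^sup>2 / 2 < b\<^sup>2" "0 < rotation a b (b\<^sup>2 / 2)" if "0 < b" "b \<le> a" for a b
    using that rotation_less[OF that, of 0 "b\<^sup>2 / 2"] rotation_0[OF that] by auto
  define r where "r = min (rotation a1 b1 (b1\<^sup>2 / 2)) (rotation a2 b2 (b2\<^sup>2 / 2)) / 2"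
  have r: "0 < r" "r < rotation a1 b1 (b1\<^sup>2 / 2)" "r < rotation a2 b2 (b2\<^sup>2 / 2)"
    using pos(3)[OF assms(1,2)] pos(3)[OF assms(3,4)] by (auto simp: r_def min_def)
  obtain L1 where "0 < L1" "L1 < b1\<^sup>2 / 2" "rotation a1 b1 L1 = r"
    using rotation_surj[OF assms(1,2) pos(1,2)[OF assms(1,2)] r(1,2)] by blast
  moreover obtain L2 where "0 < L2" "L2 < b2\<^sup>2 / 2" "rotation a2 b2 L2 = r"
    using rotation_surj[OF assms(3,4) pos(1,2)[OF assms(3,4)] r(1,3)] by blast
  ultimately show ?thesis using that[of L1 L2] by simp
qed

section \<open>A conjugacy invariant: periodic curves not preserved by the map\<close>

definition periodic_points :: "'a set \<Rightarrow> ('a \<Rightarrow> 'a) \<Rightarrow> nat \<Rightarrow> 'a set" where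
  "periodic_points X f n = {x \<in> X. (f ^^ n) x = x}"

text \<open>\<open>Z\<close> has one point on each of several components of periodic points that
  \<open>f\<close> moves off themselves. The condition \<open>f (f z) \<noteq> z\<close> excludes
  the centres of the islands and the normal chords. All clauses are topological, so cardinalities of
  such families are conjugacy invariants.\<close>

definition separated_family :: "'a::topological_space set \<Rightarrow> ('a \<Rightarrow> 'a) \<Rightarrow> nat \<Rightarrow> 'a set \<Rightarrow> bool" where
  "separated_family X f n Z \<longleftrightarrow> finite Z \<and> Z \<subseteq> periodic_points X f n \<and>
    (\<forall>z\<in>Z. f (f z) \<noteq> z \<and> \<not> connected_component (periodic_points X f n) z (f z) \<and>
      (\<forall>w\<in>Z. w \<noteq> z \<longrightarrow> \<not> connected_component (periodic_points X f n) z w))"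

lemma C0_conjugacy_sym:
  assumes "C0_conjugacy X f Y g h k" "f ` X \<subseteq> X" "g ` Y \<subseteq> Y"
  shows "C0_conjugacy Y g X f k h"
proof -
  have hom: "homeomorphism X Y h k" and c: "\<And>x. x \<in> X \<Longrightarrow> f x = k (g (h x))"
    using assms by (auto simp: C0_conjugacy_def)
  have "g y = h (f (k y))" if y: "y \<in> Y" for y
  proof -
    have "k y \<in> X" "h (k y) = y" "g y \<in> Y" using y hom assms(3) by (auto simp: homeomorphism_def)
    then show ?thesis using c[of "k y"] hom by (auto simp: homeomorphism_def)
  qed
  then show ?thesis using homeomorphism_symD[OF hom] by (simp add: C0_conjugacy_def)
qed

lemma separated_family_conjugacy:
  assumes conj: "C0_conjugacy X f Y g h k" and f: "f ` X \<subseteq> X" and g: "g ` Y \<subseteq> Y"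
    and Z: "separated_family X f n Z"
  shows "\<exists>W. separated_family Y g n W \<and> card W = card Z"
proof -
  have hom: "homeomorphism X Y h k" and c: "\<And>x. x \<in> X \<Longrightarrow> f x = k (g (h x))"
    using conj by (auto simp: C0_conjugacy_def)
  have hX: "h x \<in> Y" "k (h x) = x" if "x \<in> X" for x using that hom by (auto simp: homeomorphism_def)
  have kY: "k y \<in> X" "h (k y) = y" if "y \<in> Y" for y using that hom by (auto simp: homeomorphism_def)
  have hf: "h (f x) = g (h x)" if "x \<in> X" for x
    using c[OF that] kY(2)[of "g (h x)"] g hX(1)[OF that] by auto
  have iter: "(f ^^ m) x \<in> X \<and> h ((f ^^ m) x) = (g ^^ m) (h x)" if "x \<in> X" for x m
    by (induction m) (use that hf f in auto)
  let ?F = "periodic_points X f n" and ?G = "periodic_points Y g n"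
  have hF: "h x \<in> ?G" if "x \<in> ?F" for x
    using that iter[of x n] hX by (auto simp: periodic_points_def)
  have kG: "k y \<in> ?F" if "y \<in> ?G" for y
  proof -
    have y: "y \<in> Y" "(g ^^ n) y = y" using that by (auto simp: periodic_points_def)
    have w: "(f ^^ n) (k y) \<in> X" "h ((f ^^ n) (k y)) = y"
      using y iter[of "k y" n] kY by simp_all
    then show ?thesis using kY(1)[OF y(1)] hX(2)[OF w(1)] by (simp add: periodic_points_def)
  qed
  have comp: "connected_component ?F x y" if "connected_component ?G (h x) (h y)" "x \<in> X" "y \<in> X" for x y
  proof -
    obtain T where T: "connected T" "T \<subseteq> ?G" "h x \<in> T" "h y \<in> T"
      using \<open>connected_component ?G (h x) (h y)\<close> by (auto simp: connected_component_def)
    have "continuous_on T k"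
      using hom T(2) by (auto simp: homeomorphism_def periodic_points_def intro: continuous_on_subset)
    then have "connected (k ` T)" using T(1) by (rule connected_continuous_image)
    moreover have "k ` T \<subseteq> ?F" using T(2) kG by blast
    moreover have "x \<in> k ` T" "y \<in> k ` T" using T that hX by force+
    ultimately show ?thesis by (auto simp: connected_component_def)
  qed
  have ZX: "z \<in> X" "z \<in> ?F" if "z \<in> Z" for z
    using Z that by (auto simp: separated_family_def periodic_points_def)
  have inj: "inj_on h X" using hX(2) by (rule inj_on_inverseI)
  have "separated_family Y g n (h ` Z)"
    unfolding separated_family_def
  proof (intro conjI ballI impI)
    show "finite (h ` Z)" using Z by (simp add: separated_family_def)
    show "h ` Z \<subseteq> ?G" using ZX hF by blast
    fix w assume "w \<in> h ` Z"
    then obtain z where z: "z \<in> Z" "w = h z" by blast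
    have fz: "f z \<in> X" "f (f z) \<in> X" using ZX(1)[OF z(1)] f by auto
    have ff: "h (f z) = g w" "h (f (f z)) = g (g w)"
      using ZX(1)[OF z(1)] fz hf z by simp_all
    have "f (f z) \<noteq> z" using Z z by (auto simp: separated_family_def)
    then show "g (g w) \<noteq> w"
      using inj_onD[OF inj, of "f (f z)" z] fz ZX(1)[OF z(1)] ff z by auto
    show "\<not> connected_component ?G w (g w)"
      using comp[of z "f z"] fz ZX(1)[OF z(1)] ff z Z by (auto simp: separated_family_def)
    fix v assume "v \<in> h ` Z" "v \<noteq> w"
    then obtain z' where "z' \<in> Z" "v = h z'" "z' \<noteq> z" using z by blast
    then show "\<not> connected_component ?G w v"
      using comp[of z z'] ZX z Z by (auto simp: separated_family_def)
  qed
  moreover have "card (h ` Z) = card Z"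
    using inj ZX by (intro card_image inj_on_subset[OF inj]) auto
  ultimately show ?thesis by blast
qed

section \<open>Periodic points up to the focal level\<close>

lemma billiard_map_in:
  "a > 0 \<Longrightarrow> b > 0 \<Longrightarrow> billiard_map a b ` phase_space a b \<subseteq> phase_space a b"
  using billiard_step_billiard_map by (force simp: billiard_step_def)

text \<open>A circle on which the map acts as a rotation consists of \<open>n\<close>-periodic
  points or contains none; in the first case it is itself a connected set of periodic
  points.\<close>

lemma rotation_orbit:
  fixes Q :: "real \<Rightarrow> 'a::topological_space"
  assumes step: "\<And>u. f (Q u) = Q (u + r)"
    and eq: "\<And>u v. Q u = Q v \<longleftrightarrow> (\<exists>m::int. u = v + 2 * pi * of_int m)"
    and conn: "connected (range Q)" and X: "\<And>u. Q u \<in> X"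
  shows "(f ^^ n) (Q u) = Q u \<longleftrightarrow> (\<exists>m::int. real n * r = 2 * pi * of_int m)"
    and "(f ^^ n) (Q u) = Q u \<Longrightarrow> connected_component (periodic_points X f n) (Q v) (Q w)"
proof -
  have iter: "(f ^^ n) (Q u) = Q (u + real n * r)" for u
    by (induction n) (simp_all add: step algebra_simps)
  show iff: "(f ^^ n) (Q u) = Q u \<longleftrightarrow> (\<exists>m::int. real n * r = 2 * pi * of_int m)" for u
    unfolding iter eq by simp
  assume "(f ^^ n) (Q u) = Q u"
  then have "range Q \<subseteq> periodic_points X f n" using X iff by (auto simp: periodic_points_def)
  then show "connected_component (periodic_points X f n) (Q v) (Q w)"
    using conn by (auto simp: connected_component_def)
qed

lemma outer_periodic_component:
  assumes ab: "0 < b" "b \<le> a" and z: "z \<in> phase_space a b" "caustic a b z < b\<^sup>2"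
    and per: "(billiard_map a b ^^ n) z = z"
  shows "connected_component (periodic_points (phase_space a b) (billiard_map a b) n) z (billiard_map a b z)"
proof -
  have a: "a > 0" using ab by simp
  define lam where "lam = caustic a b z"
  obtain p \<theta> where zp: "z = (p, \<theta>)" by fastforce
  have p: "p \<in> ellipse a b" and th: "0 < \<theta>" "\<theta> < pi" using z by (auto simp: zp phase_space_def)
  obtain t where t: "p = ellipse_point a b t" using p by (rule ellipse_pointE[OF a ab(1)])
  have lam_eq: "lam = (sin \<theta>)\<^sup>2 * (speed a b t)\<^sup>2"
    unfolding lam_def zp t using a ab by (simp add: caustic_ellipse_point)
  have "lam > 0" unfolding lam_eq using sin_gt_zero[OF th] speed_pos[OF a ab(1), of t] by simp
  then have lam: "0 < lam" "lam < b\<^sup>2" using z by (auto simp: lam_def)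
  \<comment> \<open>At a right angle the caustic parameter would be \<open>speed\<close> squared,
    hence at least \<open>b^2\<close>.\<close>
  have "\<theta> \<noteq> pi / 2"
  proof
    assume "\<theta> = pi / 2"
    then have "lam = (speed a b t)\<^sup>2" using lam_eq by (simp only: sin_pi_half power_one mult_1)
    then show False using lam power_mono[OF speed_ge[OF ab, of t], of 2] ab by simp
  qed
  then consider "\<theta> < pi / 2" | "pi / 2 < \<theta>" by linarith
  then have cases: "z = outer_ccw a b t lam \<or> z = outer_cw a b (- t) lam"
  proof cases
    case 1
    then have "outer_angle a b t lam = \<theta>" using th a ab lam_eq by (intro outer_angle_unique) auto
    then show ?thesis by (simp add: zp t outer_ccw_def)
  next
    case 2
    have "outer_angle a b (- t) lam = pi - \<theta>"
      using 2 th a ab lam_eq by (intro outer_angle_unique) (auto simp: speed_def)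
    then show ?thesis by (simp add: zp t outer_cw_def)
  qed
  define T where "T u = fst (angle_inv a b (u, lam))" for u
  have T: "angle a b lam (T u) = u" for u using angle_angle_inv[OF ab, of "(u, lam)"] lam by (simp add: T_def)
  have T': "T (angle a b lam s) = s" for s using angle_eq_iff[OF ab lam(2)] T by blast
  have contT: "continuous_on UNIV T"
    unfolding T_def
    by (intro continuous_intros continuous_on_compose2[OF smooth_continuous_on[OF smooth_angle_inv[OF ab]]])
      (use lam in auto)
  have "continuous_on UNIV (\<lambda>u. (T u, lam))" by (intro continuous_intros contT)
  moreover have "range (\<lambda>u. (T u, lam)) \<subseteq> UNIV \<times> {0<..<b\<^sup>2}" using lam by auto
  ultimately have cont: "continuous_on UNIV (\<lambda>u. outer_ccw a b (T u) lam)"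
    using continuous_on_compose2[OF smooth_continuous_on[OF smooth_outer_ccw[OF ab]],
        of UNIV "\<lambda>u. (T u, lam)"] by simp
  have T_eq: "(\<exists>m::int. T u = T v + 2 * pi * of_int m) \<longleftrightarrow> (\<exists>m::int. u = v + 2 * pi * of_int m)" for u v
  proof -
    have "T u = T v + 2 * pi * of_int m \<longleftrightarrow> u = v + 2 * pi * of_int m" for m :: int
      using angle_add_of_int_pi[OF ab lam(2), of "T v" "2 * m"] T[of v] T[of u]
        angle_eq_iff[OF ab lam(2), of "T u" "T v + 2 * pi * of_int m"] by (simp add: mult_ac)
    then show ?thesis by simp
  qed
  let ?C = "connected_component (periodic_points (phase_space a b) (billiard_map a b) n)"
  define ccw cw where "ccw u = outer_ccw a b (T u) lam" and "cw u = outer_cw a b (T u) lam" for u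
  \<comment> \<open>Clockwise orbits are images of counterclockwise ones under the reflection in the
    major axis, which transports continuity, injectivity modulo \<open>2 pi\<close> and membership
    in the phase space.\<close>
  have cw_eq: "cw u = ((fst (fst (ccw u)), - snd (fst (ccw u))), pi - snd (ccw u))" for u
    by (simp add: cw_def ccw_def outer_cw_def outer_ccw_def ellipse_point_def)
  have eq1: "ccw u = ccw v \<longleftrightarrow> (\<exists>m::int. u = v + 2 * pi * of_int m)" for u v
    unfolding ccw_def outer_ccw_eq_iff[OF ab lam lam] T_eq by simp
  have eq2: "cw u = cw v \<longleftrightarrow> (\<exists>m::int. u = v + 2 * pi * of_int m)" for u v
    unfolding eq1[symmetric] cw_eq by (auto simp: prod_eq_iff)
  have step: "billiard_map a b (ccw u) = ccw (u + rotation a b lam)"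
    "billiard_map a b (cw u) = cw (u + rotation a b lam)" for u
    unfolding ccw_def cw_def by (intro billiard_map_outer_ccw[OF ab lam]; simp add: T)+
  have in1: "ccw u \<in> phase_space a b" for u unfolding ccw_def by (rule outer_ccw_in(1)[OF ab lam])
  have in2: "cw u \<in> phase_space a b" for u
    using in1[of u] by (auto simp: cw_eq phase_space_def ellipse_def case_prod_unfold)
  have cont1: "continuous_on UNIV ccw" using cont by (simp add: ccw_def[abs_def])
  then have "continuous_on UNIV cw" unfolding cw_eq[abs_def] by (intro continuous_intros)
  with cont1 have conn: "connected (range ccw)" "connected (range cw)"
    by (auto intro: connected_continuous_image)
  from cases show ?thesis
  proof
    assume "z = outer_ccw a b t lam"
    then have "z = ccw (angle a b lam t)" by (simp add: ccw_def T')
    then show ?thesis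
      using rotation_orbit(2)[where f="billiard_map a b" and Q=ccw, OF step(1) eq1 conn(1) in1] per step(1) by metis
  next
    assume "z = outer_cw a b (- t) lam"
    then have "z = cw (angle a b lam (- t))" by (simp add: cw_def T')
    then show ?thesis
      using rotation_orbit(2)[where f="billiard_map a b" and Q=cw, OF step(2) eq2 conn(2) in2] per step(2) by metis
  qed
qed

text \<open>The hypothesis holds at the vertices, and everywhere on a circle: there the normal
  passes through the centre, meets the antipode at a right angle, and is retraced.\<close>

lemma billiard_map_normal_chord:
  assumes ab: "a > 0" "b > 0" and axis: "(a\<^sup>2 - b\<^sup>2) * (sin t * cos t) = 0"
  shows "billiard_map a b (billiard_map a b (ellipse_point a b t, pi / 2)) = (ellipse_point a b t, pi / 2)"
proof -
  have step: "billiard_map a b (ellipse_point a b t, pi / 2) = (ellipse_point a b (t + pi), pi / 2)"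
    if "(a\<^sup>2 - b\<^sup>2) * (sin t * cos t) = 0" for t
  proof -
    have "a\<^sup>2 * (sin t * cos t) = b\<^sup>2 * (sin t * cos t)" using that by (simp add: algebra_simps)
    then have "billiard_map a b (ellipse_point a b (t + pi / 2 - pi / 2), pi / 2) =
        (ellipse_point a b (t + pi / 2 + pi / 2), pi / 2)"
      by (intro billiard_map_chord ab) (auto simp: sin_add cos_add)
    then show ?thesis by (simp add: add.assoc)
  qed
  have "billiard_map a b (ellipse_point a b (t + pi), pi / 2) = (ellipse_point a b (t + pi + pi), pi / 2)"
    using axis by (intro step) simp
  moreover have "ellipse_point a b (t + pi + pi) = ellipse_point a b t"
    by (simp only: ellipse_point_add_pi minus_minus)
  ultimately show ?thesis using step[OF axis] by (simp only:)
qed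

text \<open>Converse of \<open>billiard_map_chord\<close>: the midpoint parameter \<open>s\<close>
  is found as the place where the tangent is parallel to the direction of \<open>z\<close>.\<close>

lemma billiard_map_chordE:
  assumes ab: "a > 0" "b > 0" and z: "z \<in> phase_space a b"
  obtains s d \<theta> \<theta>' where "0 < d" "d < pi" "0 < \<theta>" "\<theta> < pi" "0 < \<theta>'" "\<theta>' < pi"
    "z = (ellipse_point a b (s - d), \<theta>)" "billiard_map a b z = (ellipse_point a b (s + d), \<theta>')"
    "cos \<theta> * speed a b (s - d) * speed a b s = a\<^sup>2 * sin (s - d) * sin s + b\<^sup>2 * cos (s - d) * cos s"
    "cos \<theta>' * speed a b (s + d) * speed a b s = a\<^sup>2 * sin (s + d) * sin s + b\<^sup>2 * cos (s + d) * cos s"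
proof -
  obtain p \<theta> where zp: "z = (p, \<theta>)" by fastforce
  have p: "p \<in> ellipse a b" and th: "0 < \<theta>" "\<theta> < pi" using z by (auto simp: zp phase_space_def)
  obtain t where t: "p = ellipse_point a b t" using p by (rule ellipse_pointE[OF ab])
  define n where "n = speed a b t"
  have n: "n > 0" "n\<^sup>2 = a\<^sup>2 * (sin t)\<^sup>2 + b\<^sup>2 * (cos t)\<^sup>2" using ab by (auto simp: n_def speed_pos, simp add: speed_def)
  text \<open>\<open>(P, Q)\<close> is a multiple of the direction of \<open>z\<close>.\<close>
  define P Q where "P = - (cos \<theta> * (a * sin t)) - sin \<theta> * (b * cos t)"
    and "Q = cos \<theta> * (b * cos t) - sin \<theta> * (a * sin t)"
  have PQ: "P\<^sup>2 + Q\<^sup>2 = n\<^sup>2" unfolding n P_def Q_def using sin_cos_squared_add[of \<theta>] by algebra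
  \<comment> \<open>Dividing by \<open>m\<close> makes \<open>(Q / b, - P / a)\<close> a unit
    vector, taken as \<open>(cos s, sin s)\<close>; the velocity at \<open>s\<close> is then
    \<open>(P, Q) / m\<close>.\<close>
  define m where "m = sqrt ((P / a)\<^sup>2 + (Q / b)\<^sup>2)"
  have "P \<noteq> 0 \<or> Q \<noteq> 0" using PQ n by auto
  then have "(P / a)\<^sup>2 + (Q / b)\<^sup>2 > 0" using ab by (auto simp: sum_power2_gt_zero_iff)
  then have m: "m > 0" "m\<^sup>2 = (P / a)\<^sup>2 + (Q / b)\<^sup>2" by (auto simp: m_def)
  have "(Q / (b * m))\<^sup>2 + (- P / (a * m))\<^sup>2 = ((P / a)\<^sup>2 + (Q / b)\<^sup>2) / m\<^sup>2"
    by (simp add: power_divide power_mult_distrib add_divide_distrib)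
  then have "(Q / (b * m))\<^sup>2 + (- P / (a * m))\<^sup>2 = 1"
    unfolding m(2)[symmetric] using m(1) by simp
  from sincos_total_2pi[OF this] obtain s0 where s0: "cos s0 = Q / (b * m)" "sin s0 = - P / (a * m)" by metis
  \<comment> \<open>Modulo \<open>2 pi\<close>, \<open>s\<close> is moved to within one turn after
    \<open>t\<close>; the positive sine found below then puts \<open>s - t\<close> between 0 and
    \<open>pi\<close>.\<close>
  define j :: int where "j = \<lfloor>(s0 - t) / (2 * pi)\<rfloor>"
  define s where "s = s0 - 2 * pi * of_int j"
  have "of_int j \<le> (s0 - t) / (2 * pi)" "(s0 - t) / (2 * pi) < of_int j + 1" unfolding j_def by linarith+
  then have st: "0 \<le> s - t" "s - t < 2 * pi" by (auto simp: s_def field_simps)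
  have sc: "cos s = Q / (b * m)" "sin s = - P / (a * m)"
    using s0 sin_cos_eq_iff[of s0 s] by (auto simp: s_def)
  then have as: "a * sin s = - P / m" "b * cos s = Q / m" using ab m by (auto simp: field_simps)
  have ns: "speed a b s = n / m"
  proof -
    have "(speed a b s)\<^sup>2 = (a * sin s)\<^sup>2 + (b * cos s)\<^sup>2" by (simp add: speed_def power_mult_distrib)
    also have "\<dots> = (P\<^sup>2 + Q\<^sup>2) / m\<^sup>2" unfolding as by (simp add: power_divide add_divide_distrib)
    also have "\<dots> = (n / m)\<^sup>2" by (simp add: PQ power_divide)
    finally show ?thesis using n m speed_pos[OF ab, of s] by (simp add: power2_eq_iff_nonneg less_imp_le)
  qed
  have cos1: "cos \<theta> * n * speed a b s = a\<^sup>2 * sin t * sin s + b\<^sup>2 * cos t * cos s"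
  proof -
    have "a\<^sup>2 * sin t * sin s + b\<^sup>2 * cos t * cos s = (a * sin t) * (a * sin s) + (b * cos t) * (b * cos s)"
      by (simp add: power2_eq_square mult_ac)
    also have "\<dots> = (- (a * sin t) * P + b * cos t * Q) / m" unfolding as by (simp add: add_divide_distrib diff_divide_distrib)
    also have "- (a * sin t) * P + b * cos t * Q = cos \<theta> * n\<^sup>2" unfolding P_def Q_def n by algebra
    finally show ?thesis by (simp add: ns power2_eq_square)
  qed
  have "a * b * sin (s - t) = (a * sin s) * (b * cos t) - (b * cos s) * (a * sin t)"
    by (simp add: sin_diff algebra_simps)
  also have "\<dots> = (- P * (b * cos t) - Q * (a * sin t)) / m" unfolding as by (simp add: diff_divide_distrib)
  also have "- P * (b * cos t) - Q * (a * sin t) = sin \<theta> * n\<^sup>2" unfolding P_def Q_def n by algebra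
  finally have "a * b * sin (s - t) > 0" using sin_gt_zero[OF th] n(1) m(1) by simp
  then have sd: "sin (s - t) > 0" using mult_pos_pos[OF ab] by (rule zero_less_mult_pos)
  define d where "d = s - t"
  have sd': "sin d > 0" and d2: "0 \<le> d" "d < 2 * pi" using sd st by (simp_all add: d_def)
  have d: "0 < d" "d < pi"
  proof -
    show "0 < d" using sd' d2 by (cases "d = 0") auto
    show "d < pi"
    proof (rule ccontr)
      assume "\<not> d < pi"
      then have "sin (d - pi) \<ge> 0" using d2 by (intro sin_ge_zero) auto
      then show False using sd' by (simp add: sin_diff)
    qed
  qed
  \<comment> \<open>The cosine that \<open>billiard_map_chord\<close> prescribes at the far end;
    that it is below 1 in absolute value is Lagrange's identity with
    \<open>sin d > 0\<close>.\<close>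
  define R where "R = (a\<^sup>2 * sin (s + d) * sin s + b\<^sup>2 * cos (s + d) * cos s) / (speed a b (s + d) * speed a b s)"
  have np: "speed a b (s + d) > 0" "speed a b s > 0" using speed_pos[OF ab] by auto
  have R1: "\<bar>R\<bar> < 1"
  proof -
    have sd': "sin d = sin (s + d) * cos s - cos (s + d) * sin s" using sin_diff[of "s + d" s] by simp
    have "(a\<^sup>2 * sin (s + d) * sin s + b\<^sup>2 * cos (s + d) * cos s)\<^sup>2 + (a * b * sin d)\<^sup>2 =
      (a\<^sup>2 * (sin (s + d))\<^sup>2 + b\<^sup>2 * (cos (s + d))\<^sup>2) * (a\<^sup>2 * (sin s)\<^sup>2 + b\<^sup>2 * (cos s)\<^sup>2)"
      unfolding sd' by algebra
    moreover have "(a * b * sin d)\<^sup>2 > 0" using ab sd by (simp add: d_def)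
    ultimately have "(a\<^sup>2 * sin (s + d) * sin s + b\<^sup>2 * cos (s + d) * cos s)\<^sup>2 < (speed a b (s + d) * speed a b s)\<^sup>2"
      by (simp add: speed_def power_mult_distrib)
    then have "R\<^sup>2 < 1" using np by (simp add: R_def power_divide)
    then show ?thesis by (simp add: abs_square_less_1)
  qed
  define \<theta>' where "\<theta>' = arccos R"
  have th': "0 < \<theta>'" "\<theta>' < pi" "cos \<theta>' = R"
    using R1 arccos_lt_bounded[of R] by (auto simp: \<theta>'_def abs_less_iff)
  have cos2: "cos \<theta>' * speed a b (s + d) * speed a b s = a\<^sup>2 * sin (s + d) * sin s + b\<^sup>2 * cos (s + d) * cos s"
    using np by (simp add: th' R_def)
  have tsd: "t = s - d" by (simp add: d_def)
  have "billiard_map a b z = (ellipse_point a b (s + d), \<theta>')"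
    unfolding zp t tsd using cos1 cos2 by (intro billiard_map_chord[OF ab d th th'(1,2)]) (auto simp: n_def tsd)
  then show ?thesis
    using that[OF d th th'(1,2), of s] cos1 cos2 by (simp add: zp t n_def tsd)
qed

text \<open>The vectors pointing at a focus, except those along the major axis. The sign \<open>e\<close> tells which
  focus is hit first.\<close>

definition focal_vector :: "real \<Rightarrow> real \<Rightarrow> real \<Rightarrow> phase_point \<Rightarrow> bool" where
  "focal_vector a b e z \<longleftrightarrow> (\<exists>t \<theta>. z = (ellipse_point a b t, \<theta>) \<and> 0 < \<theta> \<and> \<theta> < pi \<and>
    cos \<theta> * speed a b t = - (e * focal_dist a b * sin t) \<and> sin t \<noteq> 0)"

lemma focal_dist_squared: "0 < b \<Longrightarrow> b \<le> a \<Longrightarrow> (focal_dist a b)\<^sup>2 = a\<^sup>2 - b\<^sup>2"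
  by (simp add: focal_dist_def power_mono)

lemma focal_dist_pos: "0 < b \<Longrightarrow> b < a \<Longrightarrow> focal_dist a b > 0"
  by (simp add: focal_dist_def power_strict_mono)

text \<open>The optical property of the ellipse: after reflection the ray aims at the other focus,
  so \<open>e\<close> changes sign. The second claim says that the midpoint of a chord through a
  focus lies on the side of that focus.\<close>

lemma focal_vector_step:
  assumes ab: "0 < b" "b < a" and e: "e = 1 \<or> e = - 1" and z: "focal_vector a b e z"
  shows "focal_vector a b (- e) (billiard_map a b z)"
    and "0 < e * (fst (fst z) + fst (fst (billiard_map a b z)))"
proof -
  define c where "c = focal_dist a b"
  have c: "c > 0" "c\<^sup>2 = a\<^sup>2 - b\<^sup>2" using ab focal_dist_pos focal_dist_squared by (auto simp: c_def)
  have a: "a > 0" using ab by simp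
  obtain t \<theta> where t: "z = (ellipse_point a b t, \<theta>)" "0 < \<theta>" "\<theta> < pi"
    "cos \<theta> * speed a b t = - (e * c * sin t)" "sin t \<noteq> 0"
    using z by (auto simp: focal_vector_def c_def)
  then have "z \<in> phase_space a b" using a ab by (simp add: phase_space_def ellipse_point_in)
  then obtain s d \<theta>2 \<theta>' where d: "0 < d" "d < pi" and th: "0 < \<theta>2" "\<theta>2 < pi" "0 < \<theta>'" "\<theta>' < pi"
    and zs: "z = (ellipse_point a b (s - d), \<theta>2)" and fz: "billiard_map a b z = (ellipse_point a b (s + d), \<theta>')"
    and cos0: "cos \<theta>2 * speed a b (s - d) * speed a b s = a\<^sup>2 * sin (s - d) * sin s + b\<^sup>2 * cos (s - d) * cos s"
    and cos1: "cos \<theta>' * speed a b (s + d) * speed a b s = a\<^sup>2 * sin (s + d) * sin s + b\<^sup>2 * cos (s + d) * cos s"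
    by (rule billiard_map_chordE[OF a ab(1)])
  have "\<theta>2 = \<theta>" and st: "ellipse_point a b t = ellipse_point a b (s - d)" using zs t(1) by auto
  then have sin_t: "sin t = sin (s - d)" "speed a b t = speed a b (s - d)"
    using a ab by (auto simp: ellipse_point_def speed_def)
  define n n0 n1 where n: "n = speed a b s" "n0 = speed a b (s - d)" "n1 = speed a b (s + d)"
  have npos: "n > 0" "n0 > 0" "n1 > 0" using speed_pos[OF a ab(1)] by (auto simp: n)
  have sd: "sin d > 0" using d by (rule sin_gt_zero)
  have Y0: "cos \<theta> * n0 = - (e * c * sin (s - d))" using t(4) sin_t by (simp add: n)
  have e2: "e\<^sup>2 = 1" using e by auto
  have n2: "n\<^sup>2 = b\<^sup>2 + c\<^sup>2 * (sin s)\<^sup>2" "n0\<^sup>2 = b\<^sup>2 + c\<^sup>2 * (sin (s - d))\<^sup>2"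
    by (simp_all add: n speed_squared c)
  have "(sin \<theta> * n0)\<^sup>2 = n0\<^sup>2 - (cos \<theta> * n0)\<^sup>2" using sin_cos_squared_add[of \<theta>] by algebra
  also have "\<dots> = b\<^sup>2" unfolding Y0 n2 using e2 by algebra
  finally have "sin \<theta> * n0 = b"
    using sin_gt_zero[OF t(2,3)] npos ab by (simp add: power2_eq_iff_nonneg less_imp_le)
  moreover have "sin \<theta> * n0 * n = a * b * sin d"
    using chord_angle[OF a ab(1) t(2,3), of d "s - d" s] cos0 sd \<open>\<theta>2 = \<theta>\<close> by (simp add: n)
  ultimately have nd: "n = a * sin d" using ab by simp
  have cd2: "(a * cos d)\<^sup>2 = (c * cos s)\<^sup>2"
    using n2(1) nd c(2) sin_cos_squared_add[of d] sin_cos_squared_add[of s] by algebra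
  \<comment> \<open>The sign is first defined through the chord; comparing the two formulas for
    \<open>cos \<theta>\<close> at the starting point identifies it with \<open>e\<close>.\<close>
  define e' where "e' = (if a * cos d = c * cos s then 1 else - 1 :: real)"
  have e'2: "e'\<^sup>2 = 1" by (simp add: e'_def)
  have cd: "a * cos d = e' * c * cos s" using cd2 by (auto simp: e'_def power2_eq_iff)
  have as0: "a * sin (s - d) = - (e' * cos s * (e' * a * sin d - c * sin s))"
    using cd e'2 unfolding sin_diff by algebra
  have as1: "a * sin (s + d) = e' * cos s * (e' * a * sin d + c * sin s)"
    using cd e'2 unfolding sin_add by algebra
  have "a * (cos \<theta> * n0) * n = a * (- (e' * c * sin (s - d))) * n"
  proof -
    have "cos \<theta> * n0 * n = cos d * n\<^sup>2 - c\<^sup>2 * sin d * sin s * cos s"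
      using cos0 \<open>\<theta>2 = \<theta>\<close> sin_cos_squared_add[of s] unfolding n2(1) n[symmetric] sin_diff cos_diff c(2) by algebra
    then have "a * (cos \<theta> * n0) * n = (a * cos d * a * sin d - c\<^sup>2 * sin s * cos s) * n"
      unfolding nd by algebra
    also have "a * cos d * a * sin d - c\<^sup>2 * sin s * cos s = - (e' * c) * (a * sin (s - d))"
      unfolding as0 cd using e'2 by algebra
    finally show ?thesis by (simp add: mult_ac)
  qed
  then have Y0': "cos \<theta> * n0 = - (e' * c * sin (s - d))"
    using npos a by (metis mult_left_cancel mult_right_cancel less_irrefl)
  then have "e * c * sin (s - d) = e' * c * sin (s - d)" using Y0 by linarith
  then have ee: "e' = e" using c t(5) sin_t by simp
  have cs: "cos s \<noteq> 0" using as0 t(5) sin_t a by auto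
  have Y1: "cos \<theta>' * n1 = e * c * sin (s + d)"
  proof -
    have "cos \<theta>' * n1 * n = cos d * n\<^sup>2 + c\<^sup>2 * sin d * sin s * cos s"
      using cos1 sin_cos_squared_add[of s] unfolding n2(1) n[symmetric] sin_add cos_add c(2) by algebra
    then have "a * (cos \<theta>' * n1) * n = (a * cos d * a * sin d + c\<^sup>2 * sin s * cos s) * n"
      unfolding nd by algebra
    also have "a * cos d * a * sin d + c\<^sup>2 * sin s * cos s = (e' * c) * (a * sin (s + d))"
      unfolding as1 cd using e'2 by algebra
    finally have "a * (cos \<theta>' * n1) * n = a * (e * c * sin (s + d)) * n" by (simp add: mult_ac ee)
    then show ?thesis using npos a by (metis mult_left_cancel mult_right_cancel less_irrefl)
  qed
  \<comment> \<open>Neither factor of this difference of squares can vanish, so the next point of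
    impact is again off the major axis.\<close>
  have "(e' * a * sin d)\<^sup>2 - (c * sin s)\<^sup>2 = b\<^sup>2" using n2(1) e'2 unfolding nd by algebra
  then have "e' * a * sin d + c * sin s \<noteq> 0" using ab
    by (metis add.inverse_inverse add_eq_0_iff diff_self less_irrefl power2_minus zero_less_power2)
  then have "a * sin (s + d) \<noteq> 0" unfolding as1 using cs e'2 by auto
  then have "sin (s + d) \<noteq> 0" by auto
  then show "focal_vector a b (- e) (billiard_map a b z)"
    unfolding focal_vector_def fz using th Y1 by (auto simp: n c_def)
  have "e * (fst (fst z) + fst (fst (billiard_map a b z))) = 2 * e * cos s * (a * cos d)"
    unfolding zs fz[unfolded zs] by (simp add: ellipse_point_def cos_add cos_diff algebra_simps)
  also have "\<dots> = 2 * c * (cos s)\<^sup>2" unfolding cd ee using e2 by algebra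
  also have "\<dots> > 0" using c cs by simp
  finally show "0 < e * (fst (fst z) + fst (fst (billiard_map a b z)))" .
qed

text \<open>Each step makes \<open>(- 1) ^ n * e\<close> times the abscissa strictly smaller. After
  an even number of steps the sign is back to \<open>e\<close>, so the abscissa cannot be the
  initial one.\<close>

lemma focal_vector_iterate:
  assumes ab: "0 < b" "b < a" and e: "e = 1 \<or> e = - 1" and z: "focal_vector a b e z"
  shows "focal_vector a b ((- 1) ^ n * e) ((billiard_map a b ^^ n) z) \<and>
    (n > 0 \<longrightarrow> (- 1) ^ n * e * fst (fst ((billiard_map a b ^^ n) z)) < e * fst (fst z))"
proof (induction n)
  case 0
  then show ?case using z by simp
next
  case (Suc n)
  let ?e = "(- 1) ^ n * e" and ?w = "(billiard_map a b ^^ n) z"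
  have e': "?e = 1 \<or> ?e = - 1" using e by (cases "even n") auto
  note step = focal_vector_step[OF ab e', of ?w]
  have w: "focal_vector a b ?e ?w" using Suc by simp
  have "(- 1) ^ Suc n * e * fst (fst (billiard_map a b ?w)) < ?e * fst (fst ?w)"
    using step(2)[OF w] by (simp add: algebra_simps)
  moreover have "?e * fst (fst ?w) \<le> e * fst (fst z)" using Suc by (cases "n = 0") auto
  ultimately have "(- 1) ^ Suc n * e * fst (fst (billiard_map a b ?w)) < e * fst (fst z)"
    by (rule less_le_trans)
  then show ?case using step(1)[OF w] by simp
qed

text \<open>By \<open>focal_vector_iterate\<close> no focal vector returns after \<open>2 q\<close>
  steps. The other vectors of this level have \<open>c sin t = 0\<close>: they are normal to the
  ellipse at an end of the major axis or on a circle, and retrace their chord.\<close>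

lemma focal_periodic:
  assumes ab: "0 < b" "b \<le> a" and z: "z \<in> phase_space a b" "caustic a b z = b\<^sup>2"
    and q: "q > 0" and per: "(billiard_map a b ^^ (2 * q)) z = z"
  shows "billiard_map a b (billiard_map a b z) = z"
proof -
  have a: "a > 0" using ab by simp
  obtain p \<theta> where zp: "z = (p, \<theta>)" by fastforce
  have p: "p \<in> ellipse a b" and th: "0 < \<theta>" "\<theta> < pi" using z by (auto simp: zp phase_space_def)
  obtain t where t: "p = ellipse_point a b t" using p by (rule ellipse_pointE[OF a ab(1)])
  define c where "c = focal_dist a b"
  have c2: "c\<^sup>2 = a\<^sup>2 - b\<^sup>2" using focal_dist_squared[OF ab] by (simp add: c_def)
  have "(sin \<theta>)\<^sup>2 * (speed a b t)\<^sup>2 = b\<^sup>2" using z(2) a ab by (simp add: zp t caustic_ellipse_point)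
  then have "(cos \<theta> * speed a b t)\<^sup>2 = (c * sin t)\<^sup>2"
    using sin_cos_squared_add[of \<theta>] speed_squared[of a b t] c2 by algebra
  then have Y: "cos \<theta> * speed a b t = c * sin t \<or> cos \<theta> * speed a b t = - (c * sin t)"
    by (simp add: power2_eq_iff)
  show ?thesis
  proof (cases "c * sin t = 0")
    case True
    then have "cos \<theta> = 0" using Y speed_pos[OF a ab(1), of t] by auto
    then have "\<theta> = pi / 2" using th cos_zero_iff by (metis arccos_0 arccos_cos less_imp_le)
    moreover have "(a\<^sup>2 - b\<^sup>2) * (sin t * cos t) = 0" using True by (auto simp flip: c2)
    ultimately show ?thesis
      unfolding zp t by (simp only: billiard_map_normal_chord[OF a ab(1)])
  next
    case False
    then have "a \<noteq> b" by (auto simp: c_def focal_dist_def)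
    then have ab': "b < a" using ab by simp
    obtain e where e: "e = 1 \<or> e = - 1" "cos \<theta> * speed a b t = - (e * c * sin t)"
    proof (cases "cos \<theta> * speed a b t = c * sin t")
      case True
      then show ?thesis using that[of "-1"] by simp
    next
      case False
      then show ?thesis using that[of 1] Y by simp
    qed
    have "focal_vector a b e z"
      unfolding focal_vector_def zp t using th e False by (auto simp: c_def)
    from focal_vector_iterate[OF ab(1) ab' e(1) this, of "2 * q"] show ?thesis using per q by simp
  qed
qed

section \<open>The librational islands\<close>

lemma caustic_inner:
  assumes "0 < b" "b \<le> a" "0 \<le> r" "r < 1"
  shows "caustic a b (inner_orbit a b k r \<psi>) = a\<^sup>2 - (a\<^sup>2 - b\<^sup>2) * r\<^sup>2"
proof -
  have a: "a > 0" using assms by simp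
  define t \<theta> where "t = inner_param k r \<psi>" and "\<theta> = snd (inner_orbit a b k r \<psi>)"
  note n2 = inner_coords(3)[OF assms, of k \<psi>, folded t_def]
    and Y = inner_coords(7)[OF assms, of k \<psi>, folded t_def \<theta>_def]
  have "inner_orbit a b k r \<psi> = (ellipse_point a b t, \<theta>)" by (simp add: inner_orbit_def t_def \<theta>_def)
  then have "caustic a b (inner_orbit a b k r \<psi>) = (sin \<theta>)\<^sup>2 * (speed a b t)\<^sup>2"
    using caustic_ellipse_point[OF a assms(1)] by simp
  also have "\<dots> = (speed a b t)\<^sup>2 - (cos \<theta> * speed a b t)\<^sup>2"
    using sin_cos_squared_add[of \<theta>] by algebra
  also have "\<dots> = a\<^sup>2 - (a\<^sup>2 - b\<^sup>2) * r\<^sup>2"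
    unfolding n2 Y power_mult_distrib focal_dist_squared[OF assms(1,2)]
    using sin_cos_squared_add[of \<psi>] by algebra
  finally show ?thesis .
qed

lemma inner_in:
  assumes "0 < b" "b \<le> a" "0 \<le> r" "r < 1"
  shows "inner_orbit a b k r \<psi> \<in> phase_space a b"
  using inner_coords(5,6)[OF assms, of k \<psi>] assms
  by (simp add: phase_space_def inner_orbit_def ellipse_point_in)

lemma inner_height:
  assumes "0 < b" "b \<le> a" "0 \<le> r" "r < 1"
  shows "0 < snd (fst (inner_orbit a b k r \<psi>)) \<longleftrightarrow> even k"
proof -
  define h where "h = b * sin (arccos (r * sin \<psi>))"
  have h: "h > 0" unfolding h_def using assms by (intro mult_pos_pos inner_coords(2))
  have "snd (fst (inner_orbit a b k r \<psi>)) = (- 1) ^ k * h"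
    by (simp add: inner_orbit_def ellipse_point_def inner_param_def sin_add_nat_pi h_def)
  then show ?thesis using h by (cases "even k") auto
qed

text \<open>\<open>b < a\<close> comes out as well because on a circle the caustic parameter never
  exceeds \<open>b^2\<close>.\<close>

lemma inner_surj:
  assumes ab: "0 < b" "b \<le> a" and z: "z \<in> phase_space a b" "caustic a b z > b\<^sup>2"
  obtains k r \<psi> where "k < 2" "0 \<le> r" "r < 1" "z = inner_orbit a b k r \<psi>" "b < a"
proof -
  have a: "a > 0" using ab by simp
  obtain p \<theta> where zp: "z = (p, \<theta>)" by fastforce
  have p: "p \<in> ellipse a b" and th: "0 < \<theta>" "\<theta> < pi" using z by (auto simp: zp phase_space_def)
  obtain t where t: "0 \<le> t" "t < 2 * pi" "p = ellipse_point a b t" using p by (rule ellipse_pointE[OF a ab(1)])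
  define c n where "c = focal_dist a b" and "n = speed a b t"
  have c2: "c\<^sup>2 = a\<^sup>2 - b\<^sup>2" using focal_dist_squared[OF ab] by (simp add: c_def)
  have n: "n > 0" "n\<^sup>2 = b\<^sup>2 + c\<^sup>2 * (sin t)\<^sup>2" using a ab c2 by (auto simp: n_def speed_pos speed_squared)
  have cz: "caustic a b z = (sin \<theta>)\<^sup>2 * n\<^sup>2" using a ab by (simp add: zp t caustic_ellipse_point n_def)
  also have "\<dots> \<le> 1 * n\<^sup>2" by (intro mult_right_mono) (auto simp: abs_square_le_1)
  finally have pos: "c\<^sup>2 * (sin t)\<^sup>2 > 0" using z(2) n(2) by simp
  then have c0: "c\<^sup>2 > 0" and st: "sin t \<noteq> 0" by (auto simp: zero_less_mult_iff)
  then have ba: "b < a" using c2 ab by (cases "a = b") auto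
  have c: "c > 0" using focal_dist_pos[OF ab(1) ba] by (simp add: c_def)
  define k :: nat where "k = (if sin t > 0 then 0 else 1)"
  have t': "0 \<le> t - real k * pi" "t - real k * pi \<le> pi"
  proof -
    have "t \<le> pi" if "sin t > 0"
      using that t sin_ge_zero[of "t - pi"] by (cases "t \<le> pi") (auto simp: sin_diff)
    moreover have "pi \<le> t" if "\<not> sin t > 0"
      using that t st sin_ge_zero[of t] by (cases "t \<le> pi") auto
    ultimately show "0 \<le> t - real k * pi" "t - real k * pi \<le> pi" using t by (auto simp: k_def)
  qed
  \<comment> \<open>\<open>X^2 + Y^2 = (a^2 - lam) / c^2\<close> for the caustic parameter
    \<open>lam\<close>, and this is below 1 because \<open>lam > b^2\<close>.\<close>
  define X Y where "X = cos (t - real k * pi)" and "Y = cos \<theta> * n / c"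
  define r where "r = sqrt (X\<^sup>2 + Y\<^sup>2)"
  have X2: "X\<^sup>2 = 1 - (sin t)\<^sup>2" by (simp add: X_def k_def cos_diff cos_squared_eq)
  have "c\<^sup>2 * (X\<^sup>2 + Y\<^sup>2) = c\<^sup>2 * X\<^sup>2 + (cos \<theta> * n)\<^sup>2"
    using c by (simp add: Y_def power_divide distrib_left)
  also have "\<dots> = a\<^sup>2 - caustic a b z"
    unfolding X2 cz using c2 n(2) sin_cos_squared_add[of \<theta>] by algebra
  also have "\<dots> < c\<^sup>2 * 1" using z c2 by simp
  finally have "X\<^sup>2 + Y\<^sup>2 < 1" using c0 by (simp only: mult_less_cancel_left_pos)
  then have r: "0 \<le> r" "r < 1" using sum_power2_ge_zero[of X Y] by (auto simp: r_def)
  obtain \<psi> where psi: "X = r * sin \<psi>" "Y = r * cos \<psi>"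
  proof (cases "r = 0")
    case True
    then have "X = 0" "Y = 0" by (auto simp: r_def sum_power2_eq_zero_iff)
    then show ?thesis using that True by simp
  next
    case False
    have r2: "r\<^sup>2 = X\<^sup>2 + Y\<^sup>2" by (simp add: r_def)
    have "(Y / r)\<^sup>2 + (X / r)\<^sup>2 = (X\<^sup>2 + Y\<^sup>2) / r\<^sup>2" by (simp add: power_divide add_divide_distrib)
    then have "(Y / r)\<^sup>2 + (X / r)\<^sup>2 = 1" unfolding r2[symmetric] using False by simp
    then obtain \<psi> where "Y / r = cos \<psi>" "X / r = sin \<psi>" using sincos_total_2pi by metis
    then show ?thesis using that[of \<psi>] False by (simp add: field_simps)
  qed
  have par: "inner_param k r \<psi> = t"
    using arccos_cos[OF t'] by (simp add: inner_param_def X_def flip: psi)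
  have "cos \<theta> = focal_dist a b * r * cos \<psi> / speed a b t"
    using psi(2) c n by (simp add: Y_def c_def[symmetric] n_def[symmetric] field_simps)
  then have "\<theta> = arccos (focal_dist a b * r * cos \<psi> / speed a b t)" using th by (metis arccos_cos less_imp_le)
  then have "z = inner_orbit a b k r \<psi>" by (simp add: zp t inner_orbit_def par)
  moreover have "k < 2" by (simp add: k_def)
  ultimately show ?thesis using that r ba by blast
qed

lemma inner_center:
  assumes "0 < b" "b \<le> a"
  shows "billiard_map a b (billiard_map a b (inner_orbit a b k 0 \<psi>)) = inner_orbit a b k 0 \<psi>"
proof -
  have "inner_orbit a b k 0 \<psi> = (ellipse_point a b (inner_param k 0 \<psi>), pi / 2)" by (simp add: inner_orbit_def)
  moreover have "cos (inner_param k 0 \<psi>) = 0" using inner_coords(1)[OF assms, of 0 k \<psi>] by simp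
  ultimately show ?thesis using assms billiard_map_normal_chord[of a b "inner_param k 0 \<psi>"] by simp
qed

lemma inner_eq_iff:
  assumes ab: "0 < b" "b < a" and r: "0 < r" "r < 1"
  shows "inner_orbit a b k r \<psi> = inner_orbit a b k r \<psi>' \<longleftrightarrow> (\<exists>m::int. \<psi> = \<psi>' + 2 * pi * of_int m)"
proof -
  have a: "a > 0" using ab by simp
  note ic = inner_coords[OF ab(1) less_imp_le[OF ab(2)] less_imp_le[OF r(1)] r(2)]
  have "sin \<psi> = sin \<psi>' \<and> cos \<psi> = cos \<psi>'" if e: "inner_orbit a b k r \<psi> = inner_orbit a b k r \<psi>'"
  proof -
    have "ellipse_point a b (inner_param k r \<psi>) = ellipse_point a b (inner_param k r \<psi>')"
      using e by (simp add: inner_orbit_def)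
    then have p: "cos (inner_param k r \<psi>) = cos (inner_param k r \<psi>')" "sin (inner_param k r \<psi>) = sin (inner_param k r \<psi>')"
      using a ab by (auto simp: ellipse_point_def)
    then have s: "sin \<psi> = sin \<psi>'" using ic(1)[of k] r by simp
    have "speed a b (inner_param k r \<psi>) = speed a b (inner_param k r \<psi>')" using p by (simp add: speed_def)
    then have "focal_dist a b * r * cos \<psi> = focal_dist a b * r * cos \<psi>'"
      using ic(7)[of k \<psi>] ic(7)[of k \<psi>'] e by metis
    then show ?thesis using s r focal_dist_pos[OF ab] by simp
  qed
  moreover have "inner_orbit a b k r \<psi> = inner_orbit a b k r \<psi>'" if "sin \<psi> = sin \<psi>'" "cos \<psi> = cos \<psi>'"
    using that by (simp add: inner_orbit_def inner_param_def)
  ultimately show ?thesis unfolding sin_cos_eq_iff[symmetric] by blast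
qed

lemma inner_add_2: "inner_orbit a b (Suc (Suc k)) r \<psi> = inner_orbit a b k r \<psi>"
proof -
  have "inner_param (Suc (Suc k)) r \<psi> = inner_param k r \<psi> + real 2 * pi"
    by (simp add: inner_param_def algebra_simps)
  then show ?thesis
    unfolding inner_orbit_def by (simp only: speed_add_nat_pi) (simp add: ellipse_point_def)
qed

lemma continuous_on_inner:
  assumes "0 < b" "b \<le> a" "0 \<le> r" "r < 1"
  shows "continuous_on UNIV (inner_orbit a b k r)"
proof -
  have a: "a > 0" using assms by simp
  note ic = inner_coords[OF assms]
  have "- 1 \<le> r * sin \<psi> \<and> r * sin \<psi> \<le> 1" for \<psi>
  proof -
    have "\<bar>r * sin \<psi>\<bar> \<le> 1 * 1" unfolding abs_mult using assms by (intro mult_mono) auto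
    then show ?thesis by (simp add: abs_le_iff)
  qed
  then have p: "continuous_on UNIV (\<lambda>\<psi>. inner_param k r \<psi>)"
    unfolding inner_param_def by (intro continuous_intros) auto
  have n: "speed a b t \<noteq> 0" for t using speed_pos[OF a assms(1), of t] by simp
  have "\<bar>focal_dist a b * r * cos \<psi> / speed a b (inner_param k r \<psi>)\<bar> \<le> 1" for \<psi>
    using ic(4)[of \<psi> k] speed_pos[OF a assms(1), of "inner_param k r \<psi>"] by (simp add: abs_divide)
  then have "- 1 \<le> focal_dist a b * r * cos \<psi> / speed a b (inner_param k r \<psi>) \<and>
      focal_dist a b * r * cos \<psi> / speed a b (inner_param k r \<psi>) \<le> 1" for \<psi>
    by (metis abs_le_iff minus_le_iff)
  then show ?thesis
    using n p unfolding inner_orbit_def[abs_def] ellipse_point_def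
    by (intro continuous_intros continuous_on_arccos) (auto simp: speed_def intro!: continuous_intros)
qed

text \<open>Two bounces shift the elliptic integral by four times the numerator, and a full turn is
  four times the denominator: the quotient is the rotation number of the second iterate.\<close>

definition libration :: "real \<Rightarrow> real \<Rightarrow> real \<Rightarrow> real" where
  "libration a b r = ell 0 (- r\<^sup>2) 1 (arcsin (focal_dist a b / a)) / ell 0 (- r\<^sup>2) 1 (pi / 2)"

lemma island_domain: "0 \<le> r \<Longrightarrow> r < 1 \<Longrightarrow> 1 \<in> ell_domain (- r\<^sup>2)"
  by (simp add: ell_domain_def power_less_one_iff abs_square_less_1)

text \<open>\<open>rotation_orbit\<close> is applied to the second iterate, because a single bounce
  moves to the other island.\<close>

lemma inner_periodic:
  assumes ab: "0 < b" "b < a" and r: "0 < r" "r < 1"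
  defines "F \<equiv> periodic_points (phase_space a b) (billiard_map a b)"
  shows "(billiard_map a b ^^ (2 * q)) (inner_orbit a b k r \<psi>) = inner_orbit a b k r \<psi> \<longleftrightarrow>
      (\<exists>m::int. real q * libration a b r = of_int m)"
    and "(billiard_map a b ^^ (2 * q)) (inner_orbit a b k r \<psi>) = inner_orbit a b k r \<psi> \<Longrightarrow>
      connected_component (F (2 * q)) (inner_orbit a b k r \<psi>) (inner_orbit a b k r \<psi>')"
proof -
  let ?f = "billiard_map a b" and ?l = "ell 0 (- r\<^sup>2) 1"
  define \<beta> where "\<beta> = arcsin (focal_dist a b / a)"
  have D: "1 \<in> ell_domain (- r\<^sup>2)" using r by (intro island_domain) auto
  have K: "?l pi > 0" "?l pi = 2 * ?l (pi / 2)" using ell_pos[OF D] ell_pi[OF D] by auto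
  \<comment> \<open>The elliptic integral is rescaled so that a turn of \<open>\<psi>\<close> is a
    turn of \<open>u\<close> and two bounces rotate \<open>u\<close> by \<open>2 pi\<close> times
    the libration.\<close>
  define T where "T u = inv ?l (u * ?l pi / pi)" for u
  have T: "?l (T u) = u * ?l pi / pi" for u
    unfolding T_def using bij_ell[OF D] by (simp add: bij_is_surj surj_f_inv_f)
  have T': "T (?l x * pi / ?l pi) = x" for x
    using ell_eq_iff[OF D, of 0 "T (?l x * pi / ?l pi)" x] K by (simp add: T)
  define Q where "Q u = inner_orbit a b k r (T u)" for u
  have step: "?f (?f (Q u)) = Q (u + 2 * pi * libration a b r)" for u
  proof -
    obtain y where y: "?l y = ?l (T u) + 2 * ?l \<beta>" "?f (Q u) = inner_orbit a b (Suc k) r y"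
      unfolding Q_def \<beta>_def by (rule inner_step[OF ab r])
    obtain y' where y': "?l y' = ?l y + 2 * ?l \<beta>" "?f (inner_orbit a b (Suc k) r y) = inner_orbit a b (Suc (Suc k)) r y'"
      unfolding \<beta>_def by (rule inner_step[OF ab r])
    have "?l y' = ?l (T (u + 2 * pi * libration a b r))"
      unfolding T y'(1) y(1) libration_def \<beta>_def[symmetric] using K by (simp add: field_simps)
    then have "y' = T (u + 2 * pi * libration a b r)" using ell_eq_iff[OF D] by blast
    then show ?thesis using y y' by (simp add: Q_def inner_add_2)
  qed
  have T_add: "T (v + 2 * pi * of_int m) = T v + 2 * pi * of_int m" for v and m :: int
  proof -
    have "?l (T v + 2 * pi * of_int m) = ?l (T (v + 2 * pi * of_int m))"
      using ell_add_of_int_pi[OF D, of 0 "T v" "2 * m"] by (simp add: T field_simps)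
    then show ?thesis using ell_eq_iff[OF D] by metis
  qed
  have T_inj: "T u = T v \<longleftrightarrow> u = v" for u v
  proof
    assume "T u = T v"
    then have "u * ?l pi / pi = v * ?l pi / pi" unfolding T[symmetric] by (rule arg_cong)
    then show "u = v" using K(1) by simp
  qed simp
  have eq: "Q u = Q v \<longleftrightarrow> (\<exists>m::int. u = v + 2 * pi * of_int m)" for u v
    unfolding Q_def inner_eq_iff[OF ab r] by (metis T_add T_inj)
  have "range Q = range (inner_orbit a b k r)"
  proof
    show "range (inner_orbit a b k r) \<subseteq> range Q"
    proof
      fix z assume "z \<in> range (inner_orbit a b k r)"
      then obtain x where "z = inner_orbit a b k r x" by blast
      then have "z = Q (?l x * pi / ?l pi)" by (simp add: Q_def T')
      then show "z \<in> range Q" by blast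
    qed
  qed (auto simp: Q_def)
  moreover have "connected (range (inner_orbit a b k r))"
    using ab r by (intro connected_continuous_image continuous_on_inner) auto
  ultimately have conn: "connected (range Q)" by simp
  have X: "Q u \<in> phase_space a b" for u
    unfolding Q_def using ab r by (intro inner_in) auto
  have pow: "((\<lambda>z. ?f (?f z)) ^^ n) = ?f ^^ (2 * n)" for n
  proof -
    have "?f ^^ 2 = (\<lambda>z. ?f (?f z))" by (simp add: numeral_2_eq_2 fun_eq_iff)
    then show ?thesis using funpow_mult[where f="?f" and m=2 and n=n] by simp
  qed
  have QT: "inner_orbit a b k r x = Q (?l x * pi / ?l pi)" for x by (simp add: Q_def T')
  note orbit = rotation_orbit[where f="\<lambda>z. ?f (?f z)" and Q=Q and n=q, OF step eq conn X, unfolded pow, folded QT]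
  show "(?f ^^ (2 * q)) (inner_orbit a b k r \<psi>) = inner_orbit a b k r \<psi> \<longleftrightarrow>
      (\<exists>m::int. real q * libration a b r = of_int m)"
  proof -
    have "real q * (2 * pi * x) = 2 * pi * y \<longleftrightarrow> real q * x = y" for x y
      using mult_left_cancel[of "2 * pi" "real q * x" y] by (simp add: mult_ac)
    then show ?thesis unfolding QT[of \<psi>] orbit(1) by simp
  qed
  assume "(?f ^^ (2 * q)) (inner_orbit a b k r \<psi>) = inner_orbit a b k r \<psi>"
  then show "connected_component (F (2 * q)) (inner_orbit a b k r \<psi>) (inner_orbit a b k r \<psi>')"
    unfolding QT using orbit(2) by (simp add: F_def periodic_points_def pow)
qed

text \<open>The argument \<open>focal_dist a b / a\<close> is the eccentricity, so equal
  half-apertures mean equal eccentricities.\<close>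

definition half_aperture :: "real \<Rightarrow> real \<Rightarrow> real" where
  "half_aperture a b = arcsin (focal_dist a b / a)"

lemma half_aperture:
  assumes "0 < b" "b < a"
  shows "0 < half_aperture a b" "half_aperture a b < pi / 2"
proof -
  have "b\<^sup>2 > 0" using assms by simp
  then have "(focal_dist a b)\<^sup>2 < a\<^sup>2"
    using focal_dist_squared[OF assms(1) less_imp_le[OF assms(2)]] by linarith
  then have "focal_dist a b < a" by (rule power2_less_imp_less) (use assms in linarith)
  then have x: "0 < focal_dist a b / a" "focal_dist a b / a < 1" using focal_dist_pos[OF assms] assms by auto
  then have "- 1 < focal_dist a b / a" by linarith
  then show "0 < half_aperture a b" "half_aperture a b < pi / 2"
    unfolding half_aperture_def
    using arcsin_less_mono[of 0 "focal_dist a b / a"] arcsin_less_mono[of "focal_dist a b / a" 1] x by auto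
qed

section \<open>Rotation numbers and periodic curves of the islands\<close>

context
  fixes a b :: real
  assumes ab: "0 < b" "b < a"
begin

lemma libration_eq: "libration a b r = ell 0 (- r\<^sup>2) 1 (half_aperture a b) / ell 0 (- r\<^sup>2) 1 (pi / 2)"
  by (simp add: libration_def half_aperture_def)

lemma libration_bounds:
  assumes "0 \<le> r" "r < 1"
  shows "0 < libration a b r" "libration a b r < 1"
  using ell_less_iff[OF island_domain[OF assms], of 0 "half_aperture a b" "pi / 2"]
    ell_pos[OF island_domain[OF assms]] half_aperture[OF ab]
  by (auto simp: libration_eq)

lemma libration_0: "libration a b 0 = 2 * half_aperture a b / pi"
proof -
  have "((\<lambda>x. x) has_real_derivative ell_weight 0 1 x ^ (2 * 0 + 1)) (at x)" for x
    by (simp add: ell_weight_def)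
  moreover have "1 \<in> ell_domain 0" by (simp add: ell_domain_def)
  ultimately have "ell 0 0 1 x = x" for x
    using const_if_derivs_eq[OF ell_has_derivative, of 1 0 "\<lambda>x. x" 0 x 0] by simp
  then show ?thesis by (simp add: libration_eq)
qed

lemma libration_less:
  assumes "0 \<le> r" "r < s" "s < 1"
  shows "libration a b s < libration a b r"
proof -
  have "r\<^sup>2 < s\<^sup>2" "s\<^sup>2 < 1" using assms by (auto simp: power_strict_mono power_less_one_iff abs_square_less_1)
  then have "ell 0 (- s\<^sup>2) 1 (half_aperture a b) * ell 0 (- r\<^sup>2) 1 (pi / 2)
      < ell 0 (- r\<^sup>2) 1 (half_aperture a b) * ell 0 (- s\<^sup>2) 1 (pi / 2)"
    using half_aperture[OF ab] by (intro ell_ratio_modulus) auto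
  moreover have "ell 0 (- s\<^sup>2) 1 (pi / 2) > 0" "ell 0 (- r\<^sup>2) 1 (pi / 2) > 0"
    using assms by (auto intro!: ell_pos island_domain)
  ultimately show ?thesis by (simp add: libration_eq field_simps)
qed

lemma libration_inj: "inj_on (libration a b) {0..<1}"
proof (rule inj_onI)
  fix r s assume "r \<in> {0..<1}" "s \<in> {0..<1}" "libration a b r = libration a b s"
  then show "r = s" using libration_less[of r s] libration_less[of s r] by (cases r s rule: linorder_cases) auto
qed

text \<open>As \<open>r\<close> tends to 1 the incomplete integral stays below
  \<open>\<beta> / cos \<beta>\<close> with \<open>\<beta>\<close> the half-aperture, while the
  complete one is unbounded.\<close>

lemma libration_small:
  assumes "e > 0"
  obtains r where "0 < r" "r < 1" "libration a b r < e"
proof -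
  let ?\<beta> = "half_aperture a b"
  note \<beta> = half_aperture[OF ab]
  have cos\<beta>: "cos ?\<beta> > 0" using \<beta> by (intro cos_gt_zero_pi) auto
  obtain m where m: "0 < m" "m < 1" "\<And>m'. m \<le> m' \<Longrightarrow> m' < 1 \<Longrightarrow> ?\<beta> / cos ?\<beta> / e < ell 0 (- m') 1 (pi / 2)"
    using complete_ell_unbounded[of "?\<beta> / cos ?\<beta> / e"] \<beta> cos\<beta> assms by (metis divide_pos_pos)
  define r where "r = sqrt m"
  have r: "0 < r" "r < 1" "r\<^sup>2 = m" using m by (auto simp: r_def)
  have D: "1 \<in> ell_domain (- r\<^sup>2)" using r by (intro island_domain) auto
  have "ell 0 (- r\<^sup>2) 1 ?\<beta> \<le> ?\<beta> / cos ?\<beta> - 0 / cos ?\<beta>"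
  proof (rule ell_mono_derivative(2)[OF D, where d="\<lambda>_. 1 / cos ?\<beta>"])
    fix y assume y: "0 \<le> y" "y \<le> ?\<beta>"
    show "((\<lambda>y. y / cos ?\<beta>) has_real_derivative 1 / cos ?\<beta>) (at y)"
      using cos\<beta> by (auto intro!: derivative_eq_intros)
    have "cos ?\<beta> \<le> cos y" using y \<beta> by (intro cos_monotone_0_pi_le) auto
    moreover have "(cos y)\<^sup>2 \<le> 1 - r\<^sup>2 * (sin y)\<^sup>2"
      unfolding cos_squared_eq using r m mult_right_mono[of "r\<^sup>2" 1 "(sin y)\<^sup>2"] by simp
    ultimately have cs: "cos ?\<beta> \<le> sqrt (1 + - r\<^sup>2 * (sin y)\<^sup>2)"
      using cos\<beta> power_mono[of "cos ?\<beta>" "cos y" 2] by (intro real_le_rsqrt) linarith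
    then have "0 < sqrt (1 + - r\<^sup>2 * (sin y)\<^sup>2)" by (rule less_le_trans[OF cos\<beta>])
    with cs show "ell_weight (- r\<^sup>2) 1 y \<le> 1 / cos ?\<beta>"
      unfolding ell_weight_def using cos\<beta> by (intro divide_left_mono mult_pos_pos) (assumption | simp)+
  qed (use \<beta> in auto)
  also have "\<dots> < e * ell 0 (- r\<^sup>2) 1 (pi / 2)"
    using m(3)[OF order_refl m(2)] by (simp add: r(3) pos_divide_less_eq[OF assms] mult.commute del: divide_divide_eq_left)
  finally have "libration a b r < e"
    using ell_pos[OF D, of "pi / 2"] by (simp add: libration_eq field_simps)
  then show ?thesis using that r by blast
qed

lemma continuous_on_libration: "continuous_on {0..<1} (libration a b)"
proof -
  have c: "continuous_on {0..<1} (\<lambda>r. ell 0 (- r\<^sup>2) 1 x)" for x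
    by (rule continuous_on_compose2[OF continuous_on_ell_modulus[of x], of _ "\<lambda>r. r\<^sup>2"])
      (auto intro!: continuous_intros simp: power_less_one_iff abs_square_less_1)
  moreover have "ell 0 (- r\<^sup>2) 1 (pi / 2) \<noteq> 0" if "r \<in> {0..<1}" for r
    using ell_pos[OF island_domain, of r "pi / 2" 0] that by force
  ultimately show ?thesis unfolding libration_eq[abs_def] by (intro continuous_intros) auto
qed

lemma libration_surj:
  assumes "0 < x" "x < 2 * half_aperture a b / pi"
  shows "\<exists>r. 0 < r \<and> r < 1 \<and> libration a b r = x"
proof -
  obtain s where s: "0 < s" "s < 1" "libration a b s < x" using libration_small[OF assms(1)] .
  have "continuous_on {0..s} (libration a b)"
    using continuous_on_libration by (rule continuous_on_subset) (use s in auto)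
  then obtain r where r: "0 \<le> r" "r \<le> s" "libration a b r = x"
    using IVT2'[of "libration a b" s x 0] s assms by (auto simp: libration_0)
  then have "r \<noteq> 0" using assms by (auto simp: libration_0)
  then show ?thesis using r s by (intro exI[of _ r]) auto
qed

text \<open>Off the centre, a level with \<open>2 q\<close>-periodic points has a multiple of
  \<open>1 / q\<close> in the unit interval as libration, and this determines \<open>r\<close>.
  Finiteness keeps connected sets of periodic points from passing between levels.\<close>

lemma finite_island_values:
  assumes "q > 0"
  shows "finite {v. v > b\<^sup>2 \<and> (\<exists>z \<in> periodic_points (phase_space a b) (billiard_map a b) (2 * q). caustic a b z = v)}"
proof -
  let ?R = "{r \<in> {0..<1}. \<exists>m::int. real q * libration a b r = of_int m}"
  have "libration a b ` ?R \<subseteq> (\<lambda>m::int. of_int m / real q) ` {0..int q}"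
  proof
    fix x assume "x \<in> libration a b ` ?R"
    then obtain r and m :: int where r: "0 \<le> r" "r < 1" "x = libration a b r" "real q * libration a b r = of_int m" by auto
    have "0 < real q * libration a b r" "real q * libration a b r < real q * 1"
      using libration_bounds[OF r(1,2)] assms by simp_all
    then have "m \<in> {0..int q}" unfolding r(4) by simp
    moreover have "x = of_int m / real q" using r assms by (simp add: field_simps)
    ultimately show "x \<in> (\<lambda>m::int. of_int m / real q) ` {0..int q}" by blast
  qed
  then have "finite (libration a b ` ?R)" by (rule finite_subset) simp
  then have "finite ?R" by (rule finite_imageD) (rule inj_on_subset[OF libration_inj], auto)
  then have fin: "finite ((\<lambda>r. a\<^sup>2 - (a\<^sup>2 - b\<^sup>2) * r\<^sup>2) ` (insert 0 ?R))" by simp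
  have mem: "v \<in> (\<lambda>r. a\<^sup>2 - (a\<^sup>2 - b\<^sup>2) * r\<^sup>2) ` (insert 0 ?R)"
    if v: "v > b\<^sup>2" "z \<in> periodic_points (phase_space a b) (billiard_map a b) (2 * q)" "caustic a b z = v" for v z
  proof -
    have z: "z \<in> phase_space a b" "(billiard_map a b ^^ (2 * q)) z = z" using v by (auto simp: periodic_points_def)
    obtain k r \<psi> where r: "0 \<le> r" "r < 1" "z = inner_orbit a b k r \<psi>"
      using inner_surj[OF ab(1) less_imp_le[OF ab(2)] z(1)] v(1,3) by metis
    have "v = a\<^sup>2 - (a\<^sup>2 - b\<^sup>2) * r\<^sup>2"
      using caustic_inner[OF ab(1) less_imp_le[OF ab(2)] r(1,2)] v r by simp
    moreover have "r \<in> insert 0 ?R"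
    proof (cases "r = 0")
      case False
      then show ?thesis using inner_periodic(1)[OF ab _ r(2), of q k \<psi>] r z by auto
    qed simp
    ultimately show ?thesis by blast
  qed
  show ?thesis by (rule finite_subset[OF _ fin]) (use mem in blast)
qed

text \<open>The caustic parameter maps a connected set onto an interval, and finitely many island
  values leave no room for a nondegenerate one. The height keeps its sign because on the major axis
  the caustic parameter is at most \<open>b^2\<close>.\<close>

lemma island_component:
  assumes q: "q > 0" and c: "connected_component (periodic_points (phase_space a b) (billiard_map a b) (2 * q)) z w"
    and z: "caustic a b z > b\<^sup>2"
  shows "caustic a b w = caustic a b z" "0 < snd (fst w) \<longleftrightarrow> 0 < snd (fst z)"
proof -
  let ?F = "periodic_points (phase_space a b) (billiard_map a b) (2 * q)"
  have a: "a > 0" using ab by simp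
  obtain T where T: "connected T" "T \<subseteq> ?F" "z \<in> T" "w \<in> T" using c by (auto simp: connected_component_def)
  have "connected (caustic a b ` T)" by (intro connected_continuous_image continuous_on_caustic T)
  then have "is_interval (caustic a b ` T)" by (simp add: is_interval_connected_1)
  have const: "caustic a b v = caustic a b z" if v: "v \<in> T" for v
  proof (rule ccontr)
    assume ne: "caustic a b v \<noteq> caustic a b z"
    \<comment> \<open>Cutting at \<open>b^2\<close> leaves an interval of island values even if the
      caustic parameter of \<open>v\<close> lies below the focal level.\<close>
    define l u where "l = max (b\<^sup>2) (min (caustic a b v) (caustic a b z))" and "u = max (caustic a b v) (caustic a b z)"
    have "l < u" using ne z by (auto simp: l_def u_def)
    moreover have "{l<..<u} \<subseteq> {v. v > b\<^sup>2 \<and> (\<exists>z \<in> ?F. caustic a b z = v)}"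
    proof
      fix x assume x: "x \<in> {l<..<u}"
      then have "b\<^sup>2 < x" "min (caustic a b v) (caustic a b z) \<le> x" "x \<le> max (caustic a b v) (caustic a b z)"
        by (auto simp: l_def u_def)
      moreover have "x \<in> caustic a b ` T"
        using \<open>is_interval (caustic a b ` T)\<close> v T(3) calculation(2,3)
        unfolding is_interval_1 by (auto simp: min_def max_def split: if_splits)
      ultimately show "x \<in> {v. v > b\<^sup>2 \<and> (\<exists>z \<in> ?F. caustic a b z = v)}" using T(2) by auto
    qed
    ultimately show False
      using finite_island_values[OF q] infinite_Ioo[of l u] by (meson finite_subset)
  qed
  then show "caustic a b w = caustic a b z" using T by blast
  have nz: "snd (fst v) \<noteq> 0" if v: "v \<in> T" for v
  proof
    assume 0: "snd (fst v) = 0"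
    have "v \<in> phase_space a b" using v T(2) by (auto simp: periodic_points_def)
    then obtain t \<theta> where v': "v = (ellipse_point a b t, \<theta>)"
      using ellipse_pointE[OF a ab(1)] by (metis mem_Times_iff phase_space_def prod.collapse)
    have "sin t = 0" using 0 ab by (simp add: v' ellipse_point_def)
    moreover have "caustic a b v = (sin \<theta>)\<^sup>2 * (speed a b t)\<^sup>2"
      unfolding v' by (rule caustic_ellipse_point[OF a ab(1)])
    ultimately have "caustic a b v \<le> b\<^sup>2" by (simp add: speed_squared mult_left_le_one_le abs_square_le_1)
    then show False using const[OF v] z by simp
  qed
  have "connected ((\<lambda>v. snd (fst v)) ` T)" by (intro connected_continuous_image T continuous_intros)
  then have I: "is_interval ((\<lambda>v. snd (fst v)) ` T)" by (simp add: is_interval_connected_1)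
  have "0 < snd (fst x)" if xy: "x \<in> T" "y \<in> T" "0 < snd (fst y)" for x y
  proof (rule ccontr)
    assume x: "\<not> 0 < snd (fst x)"
    have "0 \<in> (\<lambda>v. snd (fst v)) ` T"
      by (rule mem_is_interval_1_I[OF I imageI[OF xy(1)] imageI[OF xy(2)]]) (use x xy(3) in simp_all)
    then show False using nz by auto
  qed
  then show "0 < snd (fst w) \<longleftrightarrow> 0 < snd (fst z)" using T by blast
qed

lemma caustic_inner_gt:
  assumes "0 \<le> r" "r < 1"
  shows "caustic a b (inner_orbit a b k r \<psi>) > b\<^sup>2"
proof -
  have "(a\<^sup>2 - b\<^sup>2) * r\<^sup>2 < (a\<^sup>2 - b\<^sup>2) * 1"
    using ab assms by (intro mult_strict_left_mono) (auto simp: power_less_one_iff abs_square_less_1 power_strict_mono)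
  then show ?thesis using caustic_inner[OF ab(1) less_imp_le[OF ab(2)] assms] by simp
qed

lemma inner_component:
  assumes "q > 0" "0 \<le> r" "r < 1" "0 \<le> s" "s < 1"
    and "connected_component (periodic_points (phase_space a b) (billiard_map a b) (2 * q))
      (inner_orbit a b k r x) (inner_orbit a b l s y)"
  shows "r = s" "even k \<longleftrightarrow> even l"
proof -
  note c = island_component[OF assms(1,6) caustic_inner_gt[OF assms(2,3)]]
  have "(a\<^sup>2 - b\<^sup>2) * s\<^sup>2 = (a\<^sup>2 - b\<^sup>2) * r\<^sup>2"
    using c(1) caustic_inner[OF ab(1) less_imp_le[OF ab(2)]] assms by simp
  moreover have "a\<^sup>2 - b\<^sup>2 \<noteq> 0" using ab power_strict_mono[of b a 2] by simp
  ultimately show "r = s" using assms by (simp add: power2_eq_iff_nonneg)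
  show "even k \<longleftrightarrow> even l"
    using c(2) inner_height[OF ab(1) less_imp_le[OF ab(2)]] assms by simp
qed

text \<open>Each libration \<open>m / q\<close> with \<open>1 \<le> m \<le> p\<close> lies below the
  central value and is attained; its level has one curve in each of the two islands.\<close>

lemma separated_family_exists:
  assumes q: "q > 0" and p: "real p / real q < 2 * half_aperture a b / pi"
  shows "\<exists>Z. separated_family (phase_space a b) (billiard_map a b) (2 * q) Z \<and> card Z = 2 * p"
proof -
  let ?F = "periodic_points (phase_space a b) (billiard_map a b) (2 * q)" and ?f = "billiard_map a b"
  have "\<exists>r. 0 < r \<and> r < 1 \<and> libration a b r = real m / real q" if "m \<in> {1..p}" for m
  proof (rule libration_surj)
    show "0 < real m / real q" using that q by simp
    have "real m / real q \<le> real p / real q" using that q by (intro divide_right_mono) auto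
    then show "real m / real q < 2 * half_aperture a b / pi" using p by (rule le_less_trans)
  qed
  then obtain r where r: "\<And>m. m \<in> {1..p} \<Longrightarrow> 0 < r m \<and> r m < 1 \<and> libration a b (r m) = real m / real q"
    by metis
  define g where "g = (\<lambda>(m, k). inner_orbit a b k (r m) 0)"
  let ?I = "{1..p} \<times> {0, 1::nat}"
  have gF: "g i \<in> ?F" if "i \<in> ?I" for i
  proof -
    obtain m k where i: "i = (m, k)" by fastforce
    then have m: "m \<in> {1..p}" using that by auto
    have "real q * libration a b (r m) = of_int (int m)" using r[OF m] q by simp
    then have "(?f ^^ (2 * q)) (g i) = g i"
      unfolding g_def i case_prod_conv using inner_periodic(1)[OF ab, of "r m" q k 0] r[OF m] by blast
    then show ?thesis using r[OF m] inner_in[OF ab(1) less_imp_le[OF ab(2)]] by (simp add: periodic_points_def g_def i)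
  qed
  have sep: "i = j" if ij: "i \<in> ?I" "j \<in> ?I" "connected_component ?F (g i) (g j)" for i j
  proof -
    obtain m k m' k' where i: "i = (m, k)" "j = (m', k')" by fastforce
    then have m: "m \<in> {1..p}" "m' \<in> {1..p}" using ij by auto
    have "r m = r m'" "even k \<longleftrightarrow> even k'"
      using inner_component[OF q _ _ _ _ ij(3)[unfolded g_def i case_prod_conv]] r[OF m(1)] r[OF m(2)] by auto
    moreover from this have "real m / real q = real m' / real q" using r[OF m(1)] r[OF m(2)] by metis
    ultimately show ?thesis using i ij q by auto
  qed
  have inj: "inj_on g ?I"
  proof (rule inj_onI)
    fix i j assume "i \<in> ?I" "j \<in> ?I" "g i = g j"
    then show "i = j" using gF by (intro sep) (auto intro: connected_component_refl)
  qed
  have "separated_family (phase_space a b) ?f (2 * q) (g ` ?I)"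
    unfolding separated_family_def
  proof (intro conjI ballI impI)
    show "finite (g ` ?I)" by simp
    show "g ` ?I \<subseteq> ?F" using gF by blast
    fix z assume "z \<in> g ` ?I"
    then obtain i where zi: "i \<in> ?I" "z = g i" by blast
    then obtain m k where i: "i = (m, k)" "m \<in> {1..p}" by auto
    note rm = r[OF i(2)]
    have z: "z = inner_orbit a b k (r m) 0" by (simp add: zi i g_def)
    \<comment> \<open>With \<open>q = 1\<close> the periodicity criterion would make the libration
      an integer, but it lies strictly between 0 and 1.\<close>
    show "?f (?f z) \<noteq> z"
    proof
      assume "?f (?f z) = z"
      then have "(?f ^^ (2 * 1)) (inner_orbit a b k (r m) 0) = inner_orbit a b k (r m) 0" by (simp add: z numeral_2_eq_2)
      then obtain j :: int where "libration a b (r m) = of_int j"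
        using inner_periodic(1)[OF ab, of "r m" 1 k 0] rm by auto
      then show False using libration_bounds[of "r m"] rm by simp
    qed
    obtain y where y: "?f z = inner_orbit a b (Suc k) (r m) y"
      unfolding z using inner_step[OF ab, of "r m" 0 k] rm by metis
    show "\<not> connected_component ?F z (?f z)"
      using inner_component(2)[OF q, of "r m" "r m" k 0 "Suc k" y] rm unfolding y by (auto simp: z)
    fix w assume w: "w \<in> g ` ?I" "w \<noteq> z"
    then obtain j where "j \<in> ?I" "w = g j" by blast
    then show "\<not> connected_component ?F z w" using sep[OF zi(1), of j] zi(2) w(2) by metis
  qed
  moreover have "card (g ` ?I) = 2 * p" using inj by (simp add: card_image)
  ultimately show ?thesis by blast
qed

end

text \<open>The clauses of \<open>separated_family\<close> rule out all levels up to the focal one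
  and the centres. What remains has libration \<open>m / q\<close> with
  \<open>1 \<le> m < p\<close>, on two islands, which leaves at most \<open>2 (p - 1)\<close>
  curves.\<close>

lemma separated_family_card:
  assumes ab: "0 < b" "b \<le> a" and q: "q > 0" and p: "p > 0" "2 * half_aperture a b / pi \<le> real p / real q"
    and Z: "separated_family (phase_space a b) (billiard_map a b) (2 * q) Z"
  shows "card Z < 2 * p"
proof -
  let ?F = "periodic_points (phase_space a b) (billiard_map a b) (2 * q)" and ?f = "billiard_map a b"
  have "\<exists>i. i \<in> {1..<p} \<times> {..<2::nat} \<and> (\<exists>r \<psi>. b < a \<and> 0 < r \<and> r < 1 \<and> z = inner_orbit a b (snd i) r \<psi> \<and>
      real q * libration a b r = real (fst i))" if "z \<in> Z" for z
  proof -
    have z: "z \<in> phase_space a b" "(?f ^^ (2 * q)) z = z" "?f (?f z) \<noteq> z" "\<not> connected_component ?F z (?f z)"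
      using Z that by (auto simp: separated_family_def periodic_points_def)
    have "\<not> caustic a b z < b\<^sup>2" using outer_periodic_component[OF ab z(1) _ z(2)] z(4) by blast
    moreover have "caustic a b z \<noteq> b\<^sup>2" using focal_periodic[OF ab z(1) _ q z(2)] z(3) by blast
    ultimately have "caustic a b z > b\<^sup>2" by simp
    then obtain k r \<psi> where r: "k < 2" "0 \<le> r" "r < 1" "z = inner_orbit a b k r \<psi>" "b < a"
      using inner_surj[OF ab z(1)] by metis
    have "r \<noteq> 0" using inner_center[OF ab] z(3) r(4) by metis
    then have r0: "0 < r" using r by simp
    obtain m :: int where m: "real q * libration a b r = of_int m"
      using inner_periodic(1)[OF ab(1) r(5) r0 r(3), of q k \<psi>] z(2) r(4) by metis
    have "0 < real q * libration a b r" using libration_bounds[OF ab(1) r(5,2,3)] q by simp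
    then have "0 < m" unfolding m by simp
    have "libration a b r < real p / real q"
      using libration_less[OF ab(1) r(5) _ r0 r(3)] libration_0[OF ab(1) r(5)] p by simp
    then have "real q * libration a b r < real p" using q by (simp add: field_simps)
    then have "m < int p" unfolding m by linarith
    then have "(nat m, k) \<in> {1..<p} \<times> {..<2::nat}" "real (nat m) = of_int m" using \<open>0 < m\<close> r by auto
    then show ?thesis using r r0 m by (intro exI[of _ "(nat m, k)"]) auto
  qed
  then obtain g where g: "\<And>z. z \<in> Z \<Longrightarrow> g z \<in> {1..<p} \<times> {..<2::nat} \<and> (\<exists>r \<psi>. b < a \<and> 0 < r \<and> r < 1 \<and>
      z = inner_orbit a b (snd (g z)) r \<psi> \<and> real q * libration a b r = real (fst (g z)))"
    by metis
  \<comment> \<open>Equal labels mean the same island and, by injectivity of the libration, the same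
    level, hence the same connected curve.\<close>
  have "inj_on g Z"
  proof (rule inj_onI)
    fix z w assume zw: "z \<in> Z" "w \<in> Z" "g z = g w"
    obtain r \<psi> where r: "b < a" "0 < r" "r < 1" "z = inner_orbit a b (snd (g z)) r \<psi>"
      "real q * libration a b r = real (fst (g z))" using g[OF zw(1)] by blast
    obtain s \<psi>' where s: "0 < s" "s < 1" "w = inner_orbit a b (snd (g z)) s \<psi>'"
      "real q * libration a b s = real (fst (g z))" using g[OF zw(2)] zw(3) by metis
    have "real q * libration a b r = real q * libration a b s" using r s by simp
    then have "libration a b r = libration a b s" using q by simp
    then have "r = s" using libration_inj[OF ab(1) r(1)] r s by (auto simp: inj_on_def)
    moreover have "(?f ^^ (2 * q)) z = z" using Z zw by (auto simp: separated_family_def periodic_points_def)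
    ultimately have "connected_component ?F z w"
      using inner_periodic(2)[OF ab(1) r(1-3), of q "snd (g z)" \<psi> \<psi>'] r s by metis
    then show "z = w" using Z zw by (auto simp: separated_family_def)
  qed
  then have "card Z = card (g ` Z)" by (simp add: card_image)
  also have "\<dots> \<le> card ({1..<p} \<times> {..<2::nat})" using g by (intro card_mono image_subsetI) (simp, blast)
  also have "\<dots> < 2 * p" using p by simp
  finally show ?thesis .
qed

text \<open>Otherwise a rational \<open>p / q\<close> lies strictly between the central librations;
  the first billiard has a family of \<open>2 p\<close> points, and its image contradicts
  \<open>separated_family_card\<close> for the second.\<close>

lemma C0_conjugate_half_aperture_le:
  assumes "0 < b1" "b1 \<le> a1" "0 < b2" "b2 \<le> a2"
    and "C0_conjugacy (phase_space a1 b1) (billiard_map a1 b1) (phase_space a2 b2) (billiard_map a2 b2) h k"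
  shows "half_aperture a1 b1 \<le> half_aperture a2 b2"
proof (rule ccontr)
  assume "\<not> half_aperture a1 b1 \<le> half_aperture a2 b2"
  then have "2 * half_aperture a2 b2 / pi < 2 * half_aperture a1 b1 / pi" by (simp add: divide_strict_right_mono)
  then obtain x where x: "x \<in> \<rat>" "2 * half_aperture a2 b2 / pi < x" "x < 2 * half_aperture a1 b1 / pi"
    using Rats_dense_in_real by blast
  have h2: "half_aperture a2 b2 \<ge> 0"
  proof (cases "a2 = b2")
    case False
    then show ?thesis using half_aperture(1)[OF assms(3), of a2] assms(4) by simp
  qed (simp add: half_aperture_def focal_dist_def)
  then have "0 \<le> 2 * half_aperture a2 b2 / pi" by simp
  then have "x > 0" using x by linarith
  obtain p q :: nat where pq: "q \<noteq> 0" "\<bar>x\<bar> = real p / real q" using Rats_abs_nat_div_natE[OF x(1)] by metis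
  then have xq: "x = real p / real q" "q > 0" using \<open>x > 0\<close> by auto
  then have "p > 0" using \<open>x > 0\<close> by (cases "p = 0") auto
  have ne: "b1 < a1"
  proof (rule ccontr)
    assume "\<not> b1 < a1"
    then have "a1 = b1" using assms by simp
    then have "half_aperture a1 b1 = 0" by (simp add: half_aperture_def focal_dist_def)
    then show False using x \<open>x > 0\<close> by simp
  qed
  obtain Z where "separated_family (phase_space a1 b1) (billiard_map a1 b1) (2 * q) Z" "card Z = 2 * p"
    using separated_family_exists[OF assms(1) ne xq(2), of p] x xq by auto
  then obtain W where W: "separated_family (phase_space a2 b2) (billiard_map a2 b2) (2 * q) W" "card W = 2 * p"
    using separated_family_conjugacy[OF assms(5) billiard_map_in billiard_map_in] assms by fastforce
  have "card W < 2 * p"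
    using separated_family_card[OF assms(3,4) xq(2) \<open>p > 0\<close> _ W(1)] x xq by simp
  then show False using W by simp
qed

lemma eccentricity_focal_dist:
  assumes "0 < b" "b \<le> a"
  shows "eccentricity a b = focal_dist a b / a"
proof -
  have "1 - (b / a)\<^sup>2 = (a\<^sup>2 - b\<^sup>2) / a\<^sup>2" using assms by (simp add: power_divide field_simps)
  then show ?thesis using assms by (simp add: eccentricity_def focal_dist_def real_sqrt_divide)
qed

lemma C0_conjugate_eccentricity:
  assumes ab: "0 < b1" "b1 \<le> a1" "0 < b2" "b2 \<le> a2"
    and conj: "C0_conjugate (phase_space a1 b1) (billiard_map a1 b1) (phase_space a2 b2) (billiard_map a2 b2)"
  shows "eccentricity a1 b1 = eccentricity a2 b2"
proof -
  obtain h k where c: "C0_conjugacy (phase_space a1 b1) (billiard_map a1 b1) (phase_space a2 b2) (billiard_map a2 b2) h k"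
    using conj by (auto simp: C0_conjugate_def)
  have "half_aperture a1 b1 = half_aperture a2 b2"
  proof (rule antisym)
    show "half_aperture a1 b1 \<le> half_aperture a2 b2" by (rule C0_conjugate_half_aperture_le[OF ab c])
    show "half_aperture a2 b2 \<le> half_aperture a1 b1"
      using ab by (intro C0_conjugate_half_aperture_le[OF ab(3,4,1,2) C0_conjugacy_sym[OF c]] billiard_map_in) auto
  qed
  moreover have "\<bar>focal_dist a b / a\<bar> \<le> 1" if "0 < b" "b \<le> a" for a b
  proof -
    have "(focal_dist a b)\<^sup>2 \<le> a\<^sup>2" using focal_dist_squared[OF that] by simp
    then have "\<bar>focal_dist a b\<bar> \<le> a" using that by (simp add: abs_le_square_iff[symmetric])
    then show ?thesis using that by (simp add: abs_divide)
  qed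
  ultimately show ?thesis
    using ab by (simp add: eccentricity_focal_dist half_aperture_def arcsin_eq_iff)
qed

section \<open>Similar ellipses\<close>

lemma norm_ellipse:
  assumes "0 < b" "b \<le> a" "p \<in> ellipse a b"
  shows "b \<le> norm p" "norm p \<le> a"
proof -
  have a: "a > 0" using assms by simp
  obtain t where t: "p = ellipse_point a b t" using assms(3) by (rule ellipse_pointE[OF a assms(1)])
  \<comment> \<open>A quarter turn of the parameter exchanges position and velocity up to sign in
    their components' trigonometric factors, so the bounds on \<open>speed\<close> apply.\<close>
  have "norm p = speed a b (t + pi / 2)"
    by (simp add: t ellipse_point_def norm_Pair speed_def sin_add cos_add power_mult_distrib)
  then show "b \<le> norm p" "norm p \<le> a" using speed_ge[OF assms(1,2)] speed_le[OF assms(1,2)] by auto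
qed

lemma ellipse_vertices:
  assumes "0 < b" "b \<le> a"
  shows "(a, 0) \<in> ellipse a b" "norm (a, 0 :: real) = a" "(0, b) \<in> ellipse a b" "norm (0 :: real, b) = b"
  using assms by (auto simp: ellipse_def norm_Pair)

lemma uminus_ellipse: "p \<in> ellipse a b \<Longrightarrow> - p \<in> ellipse a b"
  by (auto simp: ellipse_def)

text \<open>Once the similarity is known to fix the origin, it multiplies norms by \<open>c\<close>,
  and the semiaxes are the extreme norms on an ellipse.\<close>

lemma similar_imp_eccentricity:
  assumes ab: "0 < b1" "b1 \<le> a1" "0 < b2" "b2 \<le> a2" and sim: "similar_sets (ellipse a1 b1) (ellipse a2 b2)"
  shows "eccentricity a1 b1 = eccentricity a2 b2"
proof -
  obtain c T where c: "c > 0" and T: "\<And>x y. dist (T x) (T y) = dist x y"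
    and im: "ellipse a2 b2 = (\<lambda>x. c *\<^sub>R T x) ` ellipse a1 b1"
    using sim by (auto simp: similar_sets_def)
  define L v where "L x = T x - T 0" and "v = c *\<^sub>R T 0" for x
  have "orthogonal_transformation L"
    unfolding orthogonal_transformation_isometry using T by (simp add: L_def dist_norm)
  then have L: "linear L" "\<And>x. norm (L x) = norm x"
    by (auto simp: orthogonal_transformation)
  have cT: "c *\<^sub>R T x = c *\<^sub>R L x + v" for x by (simp add: L_def v_def scaleR_diff_right)
  \<comment> \<open>The image of the centre is again a centre of symmetry; the parallelogram law at
    a vertex of the major axis then forces it to be the origin.\<close>
  have refl: "2 *\<^sub>R v - y \<in> ellipse a2 b2" if y: "y \<in> ellipse a2 b2" for y
  proof -
    obtain x where x: "x \<in> ellipse a1 b1" "y = c *\<^sub>R L x + v" using y unfolding im cT by blast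
    have "2 *\<^sub>R v - y = c *\<^sub>R L (- x) + v"
      by (simp add: x linear_neg[OF L(1)] scaleR_2)
    then show ?thesis unfolding im cT using uminus_ellipse[OF x(1)] by blast
  qed
  have "v = 0"
  proof -
    let ?x = "(a2, 0) :: plane"
    have x: "?x \<in> ellipse a2 b2" "norm ?x = a2" using ellipse_vertices[OF ab(3,4)] by auto
    have "norm (2 *\<^sub>R v + ?x) \<le> a2"
      using norm_ellipse(2)[OF ab(3,4) refl[OF uminus_ellipse[OF x(1)]]] by (simp only: diff_minus_eq_add)
    moreover have "norm (2 *\<^sub>R v - ?x) \<le> a2" using refl[OF x(1)] norm_ellipse(2)[OF ab(3,4)] by blast
    ultimately have "(norm (2 *\<^sub>R v + ?x))\<^sup>2 + (norm (2 *\<^sub>R v - ?x))\<^sup>2 \<le> a2\<^sup>2 + a2\<^sup>2"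
      by (intro add_mono power_mono norm_ge_zero)
    moreover have "(norm (2 *\<^sub>R v + ?x))\<^sup>2 + (norm (2 *\<^sub>R v - ?x))\<^sup>2 = 2 * (norm (2 *\<^sub>R v))\<^sup>2 + 2 * (norm ?x)\<^sup>2"
      by (simp only: power2_norm_eq_inner inner_add inner_diff)
    ultimately show ?thesis using x by simp
  qed
  then have im': "ellipse a2 b2 = (\<lambda>x. c *\<^sub>R L x) ` ellipse a1 b1" using im cT by simp
  have nL: "norm (c *\<^sub>R L x) = c * norm x" for x using c L by simp
  have bounds: "b2 \<le> c * norm x" "c * norm x \<le> a2" if "x \<in> ellipse a1 b1" for x
    using norm_ellipse[OF ab(3,4), of "c *\<^sub>R L x"] that im' nL by auto
  have attained: "\<exists>x\<in>ellipse a1 b1. c * norm x = norm y" if "y \<in> ellipse a2 b2" for y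
    using that nL unfolding im' by force
  have "a2 = c * a1"
  proof (rule antisym)
    obtain x where "x \<in> ellipse a1 b1" "c * norm x = a2"
      using attained ellipse_vertices(1,2)[OF ab(3,4)] by metis
    then show "a2 \<le> c * a1" using norm_ellipse(2)[OF ab(1,2)] c by (metis mult_left_mono less_imp_le)
    show "c * a1 \<le> a2" using bounds(2) ellipse_vertices(1,2)[OF ab(1,2)] by metis
  qed
  moreover have "b2 = c * b1"
  proof (rule antisym)
    obtain x where "x \<in> ellipse a1 b1" "c * norm x = b2"
      using attained ellipse_vertices(3,4)[OF ab(3,4)] by metis
    then show "c * b1 \<le> b2" using norm_ellipse(1)[OF ab(1,2)] c by (metis mult_left_mono less_imp_le)
    show "b2 \<le> c * b1" using bounds(1) ellipse_vertices(3,4)[OF ab(1,2)] by metis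
  qed
  ultimately show ?thesis using c by (simp add: eccentricity_def)
qed

lemma eccentricity_imp_similar:
  assumes ab: "0 < b1" "b1 \<le> a1" "0 < b2" "b2 \<le> a2" and e: "eccentricity a1 b1 = eccentricity a2 b2"
  shows "similar_sets (ellipse a1 b1) (ellipse a2 b2)"
proof -
  have a: "a1 > 0" "a2 > 0" using ab by auto
  have "(b1 / a1)\<^sup>2 = (b2 / a2)\<^sup>2" using e by (simp add: eccentricity_def)
  then have r: "b1 / a1 = b2 / a2" using ab a by (simp add: power2_eq_iff_nonneg)
  define c where "c = a2 / a1"
  have c: "c > 0" "a2 = c * a1" "b2 = c * b1" using a r by (auto simp: c_def field_simps)
  have "ellipse a2 b2 = (\<lambda>x. c *\<^sub>R x) ` ellipse a1 b1"
  proof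
    show "(\<lambda>x. c *\<^sub>R x) ` ellipse a1 b1 \<subseteq> ellipse a2 b2"
      using c by (auto simp: ellipse_def power_mult_distrib)
    show "ellipse a2 b2 \<subseteq> (\<lambda>x. c *\<^sub>R x) ` ellipse a1 b1"
    proof
      fix p assume "p \<in> ellipse a2 b2"
      then have "(1 / c) *\<^sub>R p \<in> ellipse a1 b1"
        using c by (auto simp: ellipse_def power_mult_distrib power_divide field_simps)
      moreover have "p = c *\<^sub>R ((1 / c) *\<^sub>R p)" using c by simp
      ultimately show "p \<in> (\<lambda>x. c *\<^sub>R x) ` ellipse a1 b1" by blast
    qed
  qed
  then show ?thesis unfolding similar_sets_def using c(1) by (intro exI[of _ c] conjI exI[of _ "\<lambda>x. x"]) auto
qed

theorem theorem11:
  fixes a1 b1 a2 b2 :: real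
  assumes "0 < b1" "b1 \<le> a1" and "0 < b2" "b2 \<le> a2"
  shows
    "(\<exists>\<theta>1>0. \<exists>\<theta>2>0. \<exists>V1 V2 h k.
        invariant_nbhd a1 b1 \<theta>1 V1 \<and> invariant_nbhd a2 b2 \<theta>2 V2 \<and>
        C0_conjugacy V1 (billiard_map a1 b1) V2 (billiard_map a2 b2) h k \<and>
        respects_boundary V1 h \<and> respects_boundary V2 k \<and>
        smooth_diffeomorphism
          (V1 \<inter> (ellipse_star a1 b1 \<times> UNIV)) (V2 \<inter> (ellipse_star a2 b2 \<times> UNIV)) h k)
     \<and>
     (C0_conjugate (phase_space a1 b1) (billiard_map a1 b1)
                   (phase_space a2 b2) (billiard_map a2 b2)
        \<longrightarrow> similar_sets (ellipse a1 b1) (ellipse a2 b2))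
     \<and>
     (similar_sets (ellipse a1 b1) (ellipse a2 b2)
        \<longleftrightarrow> eccentricity a1 b1 = eccentricity a2 b2)"
proof (intro conjI impI iffI)
  obtain L1 L2 where L: "0 < L1" "L1 < b1\<^sup>2" "0 < L2" "L2 < b2\<^sup>2" "rotation a1 b1 L1 = rotation a2 b2 L2"
    by (rule common_rotation[OF assms])
  show "\<exists>\<theta>1>0. \<exists>\<theta>2>0. \<exists>V1 V2 h k.
        invariant_nbhd a1 b1 \<theta>1 V1 \<and> invariant_nbhd a2 b2 \<theta>2 V2 \<and>
        C0_conjugacy V1 (billiard_map a1 b1) V2 (billiard_map a2 b2) h k \<and>
        respects_boundary V1 h \<and> respects_boundary V2 k \<and>
        smooth_diffeomorphism
          (V1 \<inter> (ellipse_star a1 b1 \<times> UNIV)) (V2 \<inter> (ellipse_star a2 b2 \<times> UNIV)) h k"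
    by (rule boundary_conjugacy[OF boundary_chart_boundary_map[OF assms(1,2) L(1,2) refl]
          boundary_chart_boundary_map[OF assms(3,4) L(3,4) L(5)]])
next
  show "similar_sets (ellipse a1 b1) (ellipse a2 b2)"
    if "C0_conjugate (phase_space a1 b1) (billiard_map a1 b1) (phase_space a2 b2) (billiard_map a2 b2)"
    by (rule eccentricity_imp_similar[OF assms C0_conjugate_eccentricity[OF assms that]])
  show "eccentricity a1 b1 = eccentricity a2 b2" if "similar_sets (ellipse a1 b1) (ellipse a2 b2)"
    by (rule similar_imp_eccentricity[OF assms that])
  show "similar_sets (ellipse a1 b1) (ellipse a2 b2)" if "eccentricity a1 b1 = eccentricity a2 b2"
    by (rule eccentricity_imp_similar[OF assms that])
qed

end
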